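(* Let $p$ be fixed with $1-(\tfrac12)^{1/2} < p \le 1$, and let $Q \sim Q_2(n,p)$. Then with high probability $\pi_1(Q) \cong F_N$, where $F_N$ denotes a free group on $N$ generators and $N$ denotes the (random) number of maximal $1$-dimensional faces in $Q$.
   Context: $Q^n=[0,1]^n$ is the $n$-dimensional cube with its standard cubical (face) structure, with vertex set $\{0,1\}^n$; $Q^n_k$ denotes its $k$-skeleton. The random $2$-dimensional cubical complex $Q_2(n,p)$ has $1$-skeleton equal to $Q^n_1$, and each $2$-dimensional face of $Q^n$ is included independently with probability $p$. A maximal $1$-face of $Q$ is a $1$-face (edge) which is not contained in any $2$-face of $Q$. "With high probability" means with probability tending to $1$ as $n \to \infty$. *)

theory Defs
  imports "HOL-Probability.Probability" "HOL-Algebra.Group"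
begin

section \<open>Fundamental group\<close>

definition loops_at :: "'a::topological_space set \<Rightarrow> 'a \<Rightarrow> (real \<Rightarrow> 'a) set" where
  "loops_at S x = {g. path g \<and> path_image g \<subseteq> S \<and> pathstart g = x \<and> pathfinish g = x}"

definition loop_class :: "'a::topological_space set \<Rightarrow> (real \<Rightarrow> 'a) \<Rightarrow> (real \<Rightarrow> 'a) set" where
  "loop_class S g = {h. homotopic_paths S g h}"

text \<open>The product of two classes is the union of the classes of all concatenations of
  representatives; by \<open>mult_loop_class\<close> below this union is a single class.\<close>

definition fundamental_group ::
    "'a::topological_space set \<Rightarrow> 'a \<Rightarrow> (real \<Rightarrow> 'a) set monoid" where
  "fundamental_group S x =
     \<lparr>carrier = loop_class S ` loops_at S x,
      mult = (\<lambda>A B. \<Union>g\<in>A. \<Union>h\<in>B. loop_class S (g +++ h)),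
      one = loop_class S (\<lambda>_. x)\<rparr>"

lemma loop_class_eqI:
  "homotopic_paths S g h \<Longrightarrow> loop_class S g = loop_class S h"
  unfolding loop_class_def
  by (rule Collect_cong) (meson homotopic_paths_trans homotopic_paths_sym)

lemma join_in_loops_at:
  "g \<in> loops_at S x \<Longrightarrow> h \<in> loops_at S x \<Longrightarrow> g +++ h \<in> loops_at S x"
  by (auto simp: loops_at_def path_image_join)

lemma mult_loop_class:
  assumes g: "g \<in> loops_at S x" and h: "h \<in> loops_at S x"
  shows "loop_class S g \<otimes>\<^bsub>fundamental_group S x\<^esub> loop_class S h = loop_class S (g +++ h)"
proof -
  have "loop_class S (g' +++ h') = loop_class S (g +++ h)"
    if "g' \<in> loop_class S g" "h' \<in> loop_class S h" for g' h'
  proof -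
    have "homotopic_paths S (g +++ h) (g' +++ h')"
      using that g h by (intro homotopic_paths_join) (auto simp: loop_class_def loops_at_def)
    then show ?thesis
      by (rule loop_class_eqI[symmetric])
  qed
  moreover have "g \<in> loop_class S g" "h \<in> loop_class S h"
    using g h by (auto simp: loop_class_def loops_at_def)
  ultimately have "(\<Union>g'\<in>loop_class S g. \<Union>h'\<in>loop_class S h. loop_class S (g' +++ h')) =
      loop_class S (g +++ h)"
    by blast
  then show ?thesis
    by (simp add: fundamental_group_def)
qed

lemma homotopic_paths_compose_unit_interval:
  assumes "homotopic_paths {0..1::real} u v" and "path g" and "path_image g \<subseteq> S"
  shows "homotopic_paths S (g \<circ> u) (g \<circ> v)"
  using assms by (intro homotopic_paths_continuous_image[where S = "{0..1}"])
    (auto simp: path_def path_image_def)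

lemma group_fundamental_group:
  assumes "x \<in> S"
  shows "group (fundamental_group S x)"
proof -
  let ?G = "fundamental_group S x"
  have const: "(\<lambda>_. x) \<in> loops_at S x"
    using assms by (auto simp: loops_at_def path_def path_image_def pathstart_def pathfinish_def)
  have car: "carrier ?G = loop_class S ` loops_at S x" and one: "\<one>\<^bsub>?G\<^esub> = loop_class S (\<lambda>_. x)"
    by (simp_all add: fundamental_group_def)
  define i where "i = linepath 0 (1::real)"
  have i: "path i" "path_image i \<subseteq> {0..1}" "pathstart i = 0" "pathfinish i = 1"
    by (auto simp: i_def linepath_image_01 closed_segment_eq_real_ivl)
  have lid: "homotopic_paths S ((\<lambda>_. x) +++ g) g"
    and inv: "homotopic_paths S (reversepath g +++ g) (\<lambda>_. x)"
    if "g \<in> loops_at S x" for g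
  proof -
    have g: "path g" "path_image g \<subseteq> S" "g 0 = x" "g 1 = x"
      using that by (auto simp: loops_at_def pathstart_def pathfinish_def)
    have gi: "g \<circ> i = g" "g \<circ> linepath 0 0 = (\<lambda>_. x)" "g \<circ> linepath 1 1 = (\<lambda>_. x)"
      using g by (auto simp: i_def linepath_def fun_eq_iff)
    have rev: "g \<circ> reversepath i = reversepath g"
      by (auto simp: i_def linepath_def fun_eq_iff reversepath_def)
    have "homotopic_paths S (g \<circ> (linepath 0 0 +++ i)) (g \<circ> i)"
      using homotopic_paths_lid[of i "{0..1}"] i g
      by (intro homotopic_paths_compose_unit_interval) auto
    then show "homotopic_paths S ((\<lambda>_. x) +++ g) g"
      by (simp add: path_compose_join gi)
    have "homotopic_paths S (g \<circ> (reversepath i +++ i)) (g \<circ> linepath 1 1)"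
      using homotopic_paths_linv[of i "{0..1}"] i g
      by (intro homotopic_paths_compose_unit_interval) auto
    then show "homotopic_paths S (reversepath g +++ g) (\<lambda>_. x)"
      by (simp add: path_compose_join gi rev)
  qed
  show ?thesis
  proof (rule groupI)
    fix A B assume "A \<in> carrier ?G" "B \<in> carrier ?G"
    then show "A \<otimes>\<^bsub>?G\<^esub> B \<in> carrier ?G"
      by (auto simp: car mult_loop_class join_in_loops_at)
  next
    show "\<one>\<^bsub>?G\<^esub> \<in> carrier ?G"
      using const by (auto simp: car one)
  next
    fix A B C assume "A \<in> carrier ?G" "B \<in> carrier ?G" "C \<in> carrier ?G"
    then obtain f g h where fgh: "f \<in> loops_at S x" "g \<in> loops_at S x" "h \<in> loops_at S x"
      and ABC: "A = loop_class S f" "B = loop_class S g" "C = loop_class S h"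
      by (auto simp: car)
    have "homotopic_paths S (f +++ (g +++ h)) ((f +++ g) +++ h)"
      using fgh by (intro homotopic_paths_assoc) (auto simp: loops_at_def)
    from loop_class_eqI[OF this, symmetric]
    show "A \<otimes>\<^bsub>?G\<^esub> B \<otimes>\<^bsub>?G\<^esub> C = A \<otimes>\<^bsub>?G\<^esub> (B \<otimes>\<^bsub>?G\<^esub> C)"
      using fgh by (simp add: ABC mult_loop_class join_in_loops_at)
  next
    fix A assume "A \<in> carrier ?G"
    then obtain g where g: "g \<in> loops_at S x" "A = loop_class S g"
      by (auto simp: car)
    show "\<one>\<^bsub>?G\<^esub> \<otimes>\<^bsub>?G\<^esub> A = A"
      using g const loop_class_eqI[OF lid[of g]] by (simp add: one mult_loop_class)
    have r: "reversepath g \<in> loops_at S x"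
      using g by (auto simp: loops_at_def)
    then have "loop_class S (reversepath g) \<otimes>\<^bsub>?G\<^esub> A = \<one>\<^bsub>?G\<^esub>"
      using g loop_class_eqI[OF inv[of g]] by (simp add: one mult_loop_class)
    then show "\<exists>B\<in>carrier ?G. B \<otimes>\<^bsub>?G\<^esub> A = \<one>\<^bsub>?G\<^esub>"
      using r by (auto simp: car)
  qed
qed

section \<open>Free groups\<close>

text \<open>The free group on a set of generators, as the group of reduced words.  The letter
  \<open>(True, s)\<close> is the generator \<open>s\<close> and \<open>(False, s)\<close> its inverse.\<close>

definition letter_inv :: "bool \<times> 'a \<Rightarrow> bool \<times> 'a" where
  "letter_inv x = (\<not> fst x, snd x)"

definition reduced_word :: "(bool \<times> 'a) list \<Rightarrow> bool" where
  "reduced_word w \<longleftrightarrow> successively (\<lambda>x y. y \<noteq> letter_inv x) w"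

fun cons_reduce :: "bool \<times> 'a \<Rightarrow> (bool \<times> 'a) list \<Rightarrow> (bool \<times> 'a) list" where
  "cons_reduce x [] = [x]"
| "cons_reduce x (y # w) = (if y = letter_inv x then w else x # y # w)"

definition free_group :: "'a set \<Rightarrow> (bool \<times> 'a) list monoid" where
  "free_group S =
     \<lparr>carrier = {w. reduced_word w \<and> snd ` set w \<subseteq> S},
      mult = (\<lambda>u v. foldr cons_reduce u v),
      one = []\<rparr>"

lemma letter_inv_inv [simp]: "letter_inv (letter_inv x) = x"
  by (simp add: letter_inv_def)

lemma snd_letter_inv [simp]: "snd (letter_inv x) = snd x"
  by (simp add: letter_inv_def)

lemma reduced_word_Nil [simp]: "reduced_word []"
  by (simp add: reduced_word_def)

lemma reduced_word_Cons:
  "reduced_word (x # w) \<longleftrightarrow> reduced_word w \<and> (w \<noteq> [] \<longrightarrow> hd w \<noteq> letter_inv x)"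
  by (cases w) (auto simp: reduced_word_def)

lemma reduced_word_cons_reduce: "reduced_word w \<Longrightarrow> reduced_word (cons_reduce x w)"
  by (cases w) (auto simp: reduced_word_Cons)

lemma reduced_word_foldr: "reduced_word v \<Longrightarrow> reduced_word (foldr cons_reduce u v)"
  by (induction u) (auto simp: reduced_word_cons_reduce)

lemma set_cons_reduce: "set (cons_reduce x w) \<subseteq> insert x (set w)"
  by (cases w) auto

lemma set_foldr: "set (foldr cons_reduce u v) \<subseteq> set u \<union> set v"
  using set_cons_reduce by (induction u) fastforce+

lemma cons_reduce_cancel:
  assumes "reduced_word w"
  shows "cons_reduce (letter_inv x) (cons_reduce x w) = w"
  using assms by (cases w; cases "tl w") (auto simp: reduced_word_Cons)

lemma foldr_cons_reduce:
  assumes "reduced_word w"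
  shows "foldr cons_reduce (cons_reduce x v) w = cons_reduce x (foldr cons_reduce v w)"
proof (cases v)
  case (Cons y v')
  then show ?thesis
    using cons_reduce_cancel[OF reduced_word_foldr[OF assms, of v'], of "letter_inv x"] by simp
qed simp

lemma foldr_cons_reduce_assoc:
  assumes "reduced_word w"
  shows "foldr cons_reduce (foldr cons_reduce u v) w = foldr cons_reduce u (foldr cons_reduce v w)"
  using assms by (induction u) (auto simp: foldr_cons_reduce)

lemma foldr_cons_reduce_Nil: "reduced_word w \<Longrightarrow> foldr cons_reduce w [] = w"
proof (induction w)
  case (Cons x w)
  then show ?case by (cases w) (auto simp: reduced_word_Cons)
qed simp

lemma foldr_cons_reduce_inv:
  "reduced_word v \<Longrightarrow> foldr cons_reduce (rev (map letter_inv u)) (foldr cons_reduce u v) = v"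
  by (induction u) (auto simp: cons_reduce_cancel reduced_word_foldr)

lemma group_free_group: "group (free_group S)"
proof (rule groupI)
  fix u v assume "u \<in> carrier (free_group S)" "v \<in> carrier (free_group S)"
  then have "reduced_word v" and "snd ` (set u \<union> set v) \<subseteq> S"
    by (simp_all add: free_group_def image_Un)
  moreover from this have "snd ` set (foldr cons_reduce u v) \<subseteq> S"
    using image_mono[OF set_foldr[of u v], of snd] by (meson order_trans)
  ultimately show "u \<otimes>\<^bsub>free_group S\<^esub> v \<in> carrier (free_group S)"
    by (simp add: free_group_def reduced_word_foldr)
next
  fix u assume u: "u \<in> carrier (free_group S)"
  define v where "v = foldr cons_reduce (rev (map letter_inv u)) []"
  have "v \<in> carrier (free_group S)"
    using u set_foldr[of "rev (map letter_inv u)" "[]"]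
    by (fastforce simp: free_group_def v_def reduced_word_foldr)
  moreover have "v \<otimes>\<^bsub>free_group S\<^esub> u = \<one>\<^bsub>free_group S\<^esub>"
    using u foldr_cons_reduce_inv[of "[]" u]
      foldr_cons_reduce_assoc[of u "rev (map letter_inv u)" "[]"]
    by (simp add: free_group_def v_def foldr_cons_reduce_Nil)
  ultimately show "\<exists>v\<in>carrier (free_group S). v \<otimes>\<^bsub>free_group S\<^esub> u = \<one>\<^bsub>free_group S\<^esub>"
    by blast
qed (simp_all add: free_group_def foldr_cons_reduce_assoc)

section \<open>Random cubical complexes\<close>

text \<open>The cube \<open>[0,1]\<^sup>n\<close> is placed in \<open>nat \<Rightarrow> real\<close> by setting all coordinates \<open>\<ge> n\<close> to 0, so that
  \<open>n\<close> can vary.  The product topology of \<open>nat \<Rightarrow> real\<close> induces the Euclidean topology on it.  A face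
  is a closed set of points: a product whose factors are \<open>{0}\<close>, \<open>{1}\<close> or \<open>[0,1]\<close>.\<close>

definition cube_faces :: "nat \<Rightarrow> nat \<Rightarrow> (nat \<Rightarrow> real) set set" where
  "cube_faces n k =
     {Pi UNIV I | I. (\<forall>i<n. I i \<in> {{0}, {1}, {0..1}}) \<and> (\<forall>i\<ge>n. I i = {0}) \<and>
                     card {i. I i = {0..1}} = k}"

definition cube_skeleton :: "nat \<Rightarrow> nat \<Rightarrow> (nat \<Rightarrow> real) set set" where
  "cube_skeleton n k = (\<Union>j\<le>k. cube_faces n j)"

text \<open>A complex is the set of its faces; its underlying space is \<open>\<Union>Q\<close>.\<close>

definition random_cubical_complex :: "nat \<Rightarrow> real \<Rightarrow> (nat \<Rightarrow> real) set set pmf" where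
  "random_cubical_complex n p =
     map_pmf (\<lambda>X. cube_skeleton n 1 \<union> {f \<in> cube_faces n 2. X f})
       (Pi_pmf (cube_faces n 2) False (\<lambda>_. bernoulli_pmf p))"

definition maximal_edges :: "nat \<Rightarrow> (nat \<Rightarrow> real) set set \<Rightarrow> (nat \<Rightarrow> real) set set" where
  "maximal_edges n Q =
     {e \<in> Q \<inter> cube_faces n 1. \<not> (\<exists>f \<in> Q \<inter> cube_faces n 2. e \<subseteq> f)}"

text \<open>\<open>Pi_pmf\<close> is the product measure only for a finite index set.\<close>

lemma finite_cube_faces: "finite (cube_faces n k)"
proof (rule finite_subset)
  let ?F = "{I. \<forall>i. (i \<in> {..<n} \<longrightarrow> I i \<in> {{0}, {1}, {0..1}}) \<and>
                    (i \<notin> {..<n} \<longrightarrow> I i = {0::real})}"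
  show "cube_faces n k \<subseteq> Pi UNIV ` ?F"
    by (auto simp: cube_faces_def)
  show "finite (Pi UNIV ` ?F)"
    by (intro finite_imageI finite_set_of_finite_funs) simp_all
qed

end

theory Submission
  imports Defs "HOL-Real_Asymp.Real_Asymp"
begin

text \<open>Write \<open>q = 1 - p\<close>, so that \<open>2 q\<^sup>2 < 1\<close>. Call an edge of the cube light if it lies in at
  most a small proportion of the squares that could contain it. The number of squares present at
  an edge is binomial, so a given pair of edges is light with probability about \<open>q\<close> to the power
  \<open>2 n\<close>, up to a factor that is subexponential if the proportion is small. There are \<open>2\<^sup>n\<close> times a
  polynomial many pairs of edges in a common 3-cube; hence with high probability no 3-cube
  contains two light edges (\<open>prob_two_light_edges\<close>).

  A square all of whose edges are heavy bounds a disc in \<open>Q\<close> even if it is missing: its four edges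
  can be pushed through present squares into four new directions \<open>a, b, c, d\<close>, and the cube
  spanned by these directions and the two of the square provides a parallel copy of it together
  with the four sides of a box. All squares of the box other than the four first pushes involve at
  least two of the new directions. There are of the order of \<open>n\<^sup>2\<close> choices of \<open>a, b, c, d\<close> for
  which these sets of squares are disjoint, hence independent, and so all choices fail only with
  probability \<open>exp (- c n\<^sup>2)\<close>, which beats the number \<open>exp (O(n))\<close> of configurations
  (\<open>prob_no_filling\<close>, \<open>flat_by_filling\<close>).

  The light edges being isolated from each other, they do no further harm. Nonabelian cocycles
  express this without discs. A function that assigns group elements to the oriented edges
  and has trivial product around every present square has trivial product around all squares
  with heavy edges. Redefining its value on a light edge by a detour around three edges of a square makes
  it trivial around every square of the cube, because the remaining faces of a 3-cube show that the
  choice of the detour is irrelevant. On the cube such a function is a coboundary. As a light edge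
  that lies in a present square kept its value, the original function is a coboundary on all
  edges that are not maximal (\<open>gauge_of_sparse_light_edges\<close>). So up to a change of gauge it is
  determined by arbitrary values on the maximal edges.

  The topological side is a Seifert--van Kampen theorem for the cover of \<open>Q\<close> by the open stars of
  its vertices. Transporting a cocycle of the cover along loops gives a homomorphism from the
  fundamental group, and if the values of a cocycle generate its group \<open>G\<close> and every cocycle in
  the fundamental group factors through it up to gauge, then this homomorphism is an isomorphism
  onto \<open>G\<close> (\<open>fundamental_group_iso_universal_cocycle_group\<close>). The cocycle that records the passages
  through maximal edges in the free group on them has these properties
  (\<open>fundamental_group_of_sparse_complex\<close>).\<close>

section \<open>The path groupoid\<close>

definition path_from_to :: "'a::topological_space set \<Rightarrow> 'a \<Rightarrow> 'a \<Rightarrow> (real \<Rightarrow> 'a) set" where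
  "path_from_to S a b = {p. path p \<and> path_image p \<subseteq> S \<and> pathstart p = a \<and> pathfinish p = b}"

definition path_classes :: "'a::topological_space set \<Rightarrow> 'a \<Rightarrow> 'a \<Rightarrow> (real \<Rightarrow> 'a) set set" where
  "path_classes S a b = loop_class S ` path_from_to S a b"

text \<open>This is the formula for the product in \<open>fundamental_group\<close>, but for classes of arbitrary
  composable paths, so that calculations may pass through the whole path groupoid.\<close>

definition class_mult ::
    "'a::topological_space set \<Rightarrow> (real \<Rightarrow> 'a) set \<Rightarrow> (real \<Rightarrow> 'a) set \<Rightarrow> (real \<Rightarrow> 'a) set" where
  "class_mult S A B = (\<Union>g\<in>A. \<Union>h\<in>B. loop_class S (g +++ h))"

lemma fundamental_group_eq:
  "fundamental_group S x =
     \<lparr>carrier = path_classes S x x, mult = class_mult S, one = loop_class S (\<lambda>_. x)\<rparr>"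
  by (simp add: fundamental_group_def path_classes_def path_from_to_def loops_at_def
      class_mult_def fun_eq_iff)

lemma path_from_to_join:
  "p \<in> path_from_to S a b \<Longrightarrow> q \<in> path_from_to S b c \<Longrightarrow> p +++ q \<in> path_from_to S a c"
  by (auto simp: path_from_to_def path_image_join)

lemma path_from_to_reverse:
  "p \<in> path_from_to S a b \<Longrightarrow> reversepath p \<in> path_from_to S b a"
  by (auto simp: path_from_to_def)

lemma path_from_to_const: "a \<in> S \<Longrightarrow> (\<lambda>_. a) \<in> path_from_to S a a"
  by (auto simp: path_from_to_def path_def path_image_def pathstart_def pathfinish_def)

lemma path_from_to_mono: "S \<subseteq> T \<Longrightarrow> p \<in> path_from_to S a b \<Longrightarrow> p \<in> path_from_to T a b"
  by (auto simp: path_from_to_def)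

lemma class_in [simp]: "p \<in> path_from_to S a b \<Longrightarrow> loop_class S p \<in> path_classes S a b"
  by (simp add: path_classes_def)

lemma class_mult_class:
  assumes g: "g \<in> path_from_to S a b" and h: "h \<in> path_from_to S b c"
  shows "class_mult S (loop_class S g) (loop_class S h) = loop_class S (g +++ h)"
proof -
  have "loop_class S (g' +++ h') = loop_class S (g +++ h)"
    if "g' \<in> loop_class S g" "h' \<in> loop_class S h" for g' h'
  proof -
    have "homotopic_paths S (g +++ h) (g' +++ h')"
      using that g h by (intro homotopic_paths_join) (auto simp: loop_class_def path_from_to_def)
    then show ?thesis
      by (rule loop_class_eqI[symmetric])
  qed
  moreover have "g \<in> loop_class S g" "h \<in> loop_class S h"
    using g h by (auto simp: loop_class_def path_from_to_def)
  ultimately show ?thesis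
    unfolding class_mult_def by blast
qed

lemma class_eq_iff:
  "p \<in> path_from_to S a b \<Longrightarrow> loop_class S p = loop_class S q \<longleftrightarrow> homotopic_paths S p q"
  by (metis (no_types, lifting) homotopic_paths_refl homotopic_paths_sym loop_class_def loop_class_eqI
      mem_Collect_eq path_from_to_def)

lemma class_mult_closed:
  "A \<in> path_classes S a b \<Longrightarrow> B \<in> path_classes S b c \<Longrightarrow> class_mult S A B \<in> path_classes S a c"
  by (auto simp: path_classes_def class_mult_class dest: path_from_to_join)

lemma class_mult_assoc:
  assumes "A \<in> path_classes S a b" "B \<in> path_classes S b c" "C \<in> path_classes S c d"
  shows "class_mult S (class_mult S A B) C = class_mult S A (class_mult S B C)"
proof -
  obtain f g h where fgh: "f \<in> path_from_to S a b" "g \<in> path_from_to S b c" "h \<in> path_from_to S c d"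
    and ABC: "A = loop_class S f" "B = loop_class S g" "C = loop_class S h"
    using assms by (auto simp: path_classes_def)
  have "homotopic_paths S (f +++ (g +++ h)) ((f +++ g) +++ h)"
    using fgh by (intro homotopic_paths_assoc) (auto simp: path_from_to_def)
  from loop_class_eqI[OF this, symmetric] show ?thesis
    using fgh path_from_to_join[OF fgh(1,2)] path_from_to_join[OF fgh(2,3)]
    by (simp add: ABC class_mult_class)
qed

lemma class_mult_unit_left:
  assumes "A \<in> path_classes S a b"
  shows "class_mult S (loop_class S (\<lambda>_. a)) A = A"
proof -
  obtain p where p: "p \<in> path_from_to S a b" "A = loop_class S p"
    using assms by (auto simp: path_classes_def)
  have "homotopic_paths S p ((\<lambda>_. a) +++ p)"
    using p(1) by (intro homotopic_paths_reparametrize[where f = "\<lambda>t. max 0 (2 * t - 1)"])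
      (auto simp: path_from_to_def joinpaths_def pathstart_def intro!: continuous_intros)
  moreover have "a \<in> S"
    using p(1) by (auto simp: path_from_to_def)
  ultimately show ?thesis
    using p path_from_to_const[of a S] by (metis class_mult_class loop_class_eqI)
qed

lemma class_mult_unit_right:
  assumes "A \<in> path_classes S a b"
  shows "class_mult S A (loop_class S (\<lambda>_. b)) = A"
proof -
  obtain p where p: "p \<in> path_from_to S a b" "A = loop_class S p"
    using assms by (auto simp: path_classes_def)
  have "homotopic_paths S p (p +++ (\<lambda>_. b))"
    using p(1) by (intro homotopic_paths_reparametrize[where f = "\<lambda>t. min 1 (2 * t)"])
      (auto simp: path_from_to_def joinpaths_def pathfinish_def intro!: continuous_intros)
  moreover have "b \<in> S"
    using p(1) by (auto simp: path_from_to_def)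
  ultimately show ?thesis
    using p path_from_to_const[of b S] by (metis class_mult_class loop_class_eqI)
qed

text \<open>A path is the image of the identity path of the unit interval, where going forth and back
  is null-homotopic.\<close>

lemma class_mult_reverse:
  assumes "p \<in> path_from_to S a b"
  shows "class_mult S (loop_class S p) (loop_class S (reversepath p)) = loop_class S (\<lambda>_. a)"
proof -
  define i where "i = linepath 0 (1::real)"
  have i: "path i" "path_image i \<subseteq> {0..1}" "pathstart i = 0" "pathfinish i = 1"
    by (auto simp: i_def linepath_image_01 closed_segment_eq_real_ivl)
  have p: "path p" "path_image p \<subseteq> S" "p 0 = a"
    using assms by (auto simp: path_from_to_def pathstart_def)
  have pi: "p \<circ> i = p" "p \<circ> linepath 0 0 = (\<lambda>_. a)" "p \<circ> reversepath i = reversepath p"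
    using p by (auto simp: i_def linepath_def fun_eq_iff reversepath_def)
  have "homotopic_paths S (p \<circ> (i +++ reversepath i)) (p \<circ> linepath 0 0)"
    using homotopic_paths_rinv[of i "{0..1}"] i p
    by (intro homotopic_paths_compose_unit_interval) auto
  then have "homotopic_paths S (p +++ reversepath p) (\<lambda>_. a)"
    by (simp add: path_compose_join pi)
  then show ?thesis
    using class_mult_class[OF assms path_from_to_reverse[OF assms]] by (simp add: loop_class_eqI)
qed

lemma class_mult_right_cancel:
  assumes "A \<in> path_classes S a b" "B \<in> path_classes S a b" "C \<in> path_classes S b c"
    and "class_mult S A C = class_mult S B C"
  shows "A = B"
proof -
  obtain p where p: "p \<in> path_from_to S b c" "C = loop_class S p"
    using assms by (auto simp: path_classes_def)
  let ?R = "loop_class S (reversepath p)"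
  have R: "?R \<in> path_classes S c b"
    using p by (simp add: path_from_to_reverse)
  have "class_mult S (class_mult S D C) ?R = D" if "D \<in> path_classes S a b" for D
    using that p class_mult_assoc[OF that assms(3) R]
    by (simp add: class_mult_reverse class_mult_unit_right)
  then show ?thesis
    using assms by metis
qed

lemma subpath_in:
  assumes p: "p \<in> path_from_to S a b" and st: "s \<in> {0..1}" "t \<in> {0..1}"
  shows "p \<circ> linepath s t \<in> path_from_to S (p s) (p t)"
proof -
  have "path_image (linepath s t) \<subseteq> {0..1}"
    using st by (auto simp: closed_segment_eq_real_ivl)
  moreover have "continuous_on {0..1} p"
    using p by (simp add: path_from_to_def path_def)
  ultimately have "path (p \<circ> linepath s t)" "path_image (p \<circ> linepath s t) \<subseteq> path_image p"
    by (auto intro!: path_continuous_image elim: continuous_on_subset simp: path_image_compose)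
      (auto simp: path_image_def)
  then show ?thesis
    using p by (auto simp: path_from_to_def pathstart_def pathfinish_def linepath_def)
qed

text \<open>Two ways to travel between the same parameters are homotopic in the unit interval, which is
  simply connected.\<close>

lemma subpath_join:
  assumes p: "p \<in> path_from_to S a b" and st: "s \<in> {0..1}" "r \<in> {0..1}" "t \<in> {0..1}"
  shows "class_mult S (loop_class S (p \<circ> linepath s r)) (loop_class S (p \<circ> linepath r t)) =
    loop_class S (p \<circ> linepath s t)"
proof -
  have "simply_connected {0..1::real}"
    by (intro convex_imp_simply_connected) simp
  then have "homotopic_paths {0..1} (linepath s r +++ linepath r t) (linepath s t)"
    using st unfolding simply_connected_eq_homotopic_paths
    by (auto simp: path_image_join closed_segment_eq_real_ivl split: if_splits)
  then have "homotopic_paths S (p \<circ> (linepath s r +++ linepath r t)) (p \<circ> linepath s t)"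
    using p by (intro homotopic_paths_compose_unit_interval) (auto simp: path_from_to_def)
  then have "loop_class S ((p \<circ> linepath s r) +++ (p \<circ> linepath r t)) = loop_class S (p \<circ> linepath s t)"
    by (simp add: path_compose_join loop_class_eqI)
  then show ?thesis
    using class_mult_class[OF subpath_in[OF p st(1,2)] subpath_in[OF p st(2,3)]] by simp
qed

section \<open>Transport of cocycles along paths\<close>

text \<open>The hypotheses make every star look like a point and every intersection of two stars like
  an edge of the nerve. Triple intersections enter only as relations, in \<open>cocycle\<close>.\<close>

locale good_cover =
  fixes X :: "'a::topological_space set" and St :: "'v \<Rightarrow> 'a set"
  assumes open_star: "\<And>v. openin (top_of_set X) (St v)"
    and cover: "\<And>a. a \<in> X \<Longrightarrow> \<exists>v. a \<in> St v"
    and star_simply_connected: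
      "\<And>v a b p q. p \<in> path_from_to (St v) a b \<Longrightarrow> q \<in> path_from_to (St v) a b
        \<Longrightarrow> homotopic_paths X p q"
    and meet_path_connected:
      "\<And>u v a b. a \<in> St u \<inter> St v \<Longrightarrow> b \<in> St u \<inter> St v \<Longrightarrow> path_from_to (St u \<inter> St v) a b \<noteq> {}"
begin

lemma star_subset: "St v \<subseteq> X"
  using open_star openin_imp_subset by blast

text \<open>A 1-cocycle of the nerve of the cover. Values on pairs of disjoint stars are arbitrary.\<close>

definition cocycle :: "'k monoid \<Rightarrow> ('v \<Rightarrow> 'v \<Rightarrow> 'k) \<Rightarrow> bool" where
  "cocycle G f \<longleftrightarrow>
     (\<forall>u v. St u \<inter> St v \<noteq> {} \<longrightarrow> f u v \<in> carrier G) \<and>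
     (\<forall>u v w. St u \<inter> St v \<inter> St w \<noteq> {} \<longrightarrow> f u v \<otimes>\<^bsub>G\<^esub> f v w = f u w)"

lemma cocycle_closed: "cocycle G f \<Longrightarrow> a \<in> St u \<Longrightarrow> a \<in> St v \<Longrightarrow> f u v \<in> carrier G"
  unfolding cocycle_def by blast

lemma cocycle_mult:
  "cocycle G f \<Longrightarrow> a \<in> St u \<Longrightarrow> a \<in> St v \<Longrightarrow> a \<in> St w \<Longrightarrow> f u v \<otimes>\<^bsub>G\<^esub> f v w = f u w"
  unfolding cocycle_def by blast

lemma cocycle_refl:
  assumes "group G" "cocycle G f" "a \<in> St u"
  shows "f u u = \<one>\<^bsub>G\<^esub>"
proof -
  interpret group G by fact
  have "f u u \<otimes>\<^bsub>G\<^esub> f u u = f u u" "f u u \<in> carrier G"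
    using assms cocycle_mult cocycle_closed by blast+
  then show ?thesis
    by simp
qed

text \<open>\<open>transport G f g s t u v k\<close> says that \<open>k\<close> is the holonomy of \<open>f\<close> along the path \<open>g\<close> from
  time \<open>s\<close>, viewed in the star of \<open>u\<close>, to time \<open>t\<close>, viewed in the star of \<open>v\<close>: the path is cut
  into pieces that stay in one star, and \<open>f\<close> is multiplied up at the changes of star. As a relation
  it leaves the cutting unspecified; splitting and joining then replace common refinements of
  partitions.\<close>

inductive transport :: "'k monoid \<Rightarrow> ('v \<Rightarrow> 'v \<Rightarrow> 'k) \<Rightarrow> (real \<Rightarrow> 'a) \<Rightarrow> real \<Rightarrow> real \<Rightarrow> 'v \<Rightarrow> 'v \<Rightarrow> 'k \<Rightarrow> bool"
  for G f g where
  stay: "s \<le> t \<Longrightarrow> g ` {s..t} \<subseteq> St u \<Longrightarrow> transport G f g s t u u \<one>\<^bsub>G\<^esub>"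
| switch: "g t \<in> St u \<Longrightarrow> g t \<in> St v \<Longrightarrow> transport G f g t t u v (f u v)"
| join: "transport G f g s r u w k \<Longrightarrow> transport G f g r t w v l
          \<Longrightarrow> transport G f g s t u v (k \<otimes>\<^bsub>G\<^esub> l)"

lemma transport_ends:
  "transport G f g s t u v k \<Longrightarrow> s \<le> t \<and> g s \<in> St u \<and> g t \<in> St v"
  by (induction rule: transport.induct) auto

lemma transport_closed:
  assumes "group G" "cocycle G f" "transport G f g s t u v k"
  shows "k \<in> carrier G"
  using assms(3)
proof (induction rule: transport.induct)
  case (switch t u v)
  then show ?case using assms cocycle_closed by blast
qed (use assms(1) in \<open>auto simp: group.is_monoid monoid.m_closed\<close>)

text \<open>Seen from a star that contains the whole path, every change of star is a difference of
  potentials \<open>f u w\<close>, and the product telescopes.\<close>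

lemma transport_in_star:
  assumes G: "group G" "cocycle G f"
  shows "transport G f g s t u v k \<Longrightarrow> g ` {s..t} \<subseteq> St w \<Longrightarrow> k = f u w \<otimes>\<^bsub>G\<^esub> f w v"
proof (induction arbitrary: rule: transport.induct)
  case (stay s t u)
  then have "g s \<in> St u" "g s \<in> St w" by auto
  then show ?case
    by (metis G cocycle_mult cocycle_refl)
next
  case (switch t u v)
  then show ?case
    using cocycle_mult[OF G(2), of "g t" u w v] by auto
next
  case (join s r u w' k t v l)
  interpret group G by fact
  have r: "s \<le> r" "r \<le> t" "g s \<in> St u" "g r \<in> St w'" "g t \<in> St v"
    using join(1,2)[THEN transport_ends] by auto
  then have w: "g s \<in> St w" "g r \<in> St w" "g t \<in> St w"
    using join.prems by auto
  have "g ` {s..r} \<subseteq> St w" "g ` {r..t} \<subseteq> St w"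
    using join.prems r by auto
  then have kl: "k = f u w \<otimes>\<^bsub>G\<^esub> f w w'" "l = f w' w \<otimes>\<^bsub>G\<^esub> f w v"
    using join.IH by auto
  have c: "f u w \<in> carrier G" "f w w' \<in> carrier G" "f w' w \<in> carrier G" "f w v \<in> carrier G"
    using r w G cocycle_closed by blast+
  have "f w w' \<otimes>\<^bsub>G\<^esub> f w' w = \<one>\<^bsub>G\<^esub>"
    using r w G by (metis cocycle_mult cocycle_refl)
  then have "f w w' \<otimes>\<^bsub>G\<^esub> (f w' w \<otimes>\<^bsub>G\<^esub> f w v) = f w v"
    using c by (simp flip: m_assoc)
  then show ?case
    using c by (simp add: kl m_assoc)
qed

lemma transport_split:
  assumes G: "group G" "cocycle G f"
  shows "transport G f g s t u v k \<Longrightarrow> s \<le> r \<Longrightarrow> r \<le> t \<Longrightarrow> g r \<in> St w \<Longrightarrow>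
    \<exists>k1 k2. transport G f g s r u w k1 \<and> transport G f g r t w v k2 \<and> k = k1 \<otimes>\<^bsub>G\<^esub> k2"
proof (induction arbitrary: r w rule: transport.induct)
  case (stay s t u)
  interpret group G by fact
  have gr: "g r \<in> St u" using stay by auto
  have "transport G f g s r u w (\<one>\<^bsub>G\<^esub> \<otimes>\<^bsub>G\<^esub> f u w)"
    using stay gr by (intro transport.join[OF transport.stay transport.switch]) auto
  moreover have "transport G f g r t w u (f w u \<otimes>\<^bsub>G\<^esub> \<one>\<^bsub>G\<^esub>)"
    using stay gr by (intro transport.join[OF transport.switch transport.stay]) auto
  moreover have "f u w \<in> carrier G" "f w u \<in> carrier G" "f u w \<otimes>\<^bsub>G\<^esub> f w u = \<one>\<^bsub>G\<^esub>"
    using stay gr G by (metis cocycle_mult cocycle_refl cocycle_closed)+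
  ultimately show ?case
    by force
next
  case (switch t u v)
  then have "transport G f g t t u w (f u w)" "transport G f g t t w v (f w v)"
    by (auto intro: transport.switch)
  moreover have "f u v = f u w \<otimes>\<^bsub>G\<^esub> f w v"
    using switch cocycle_mult[OF G(2), of "g t" u w v] by auto
  ultimately show ?case
    using switch by (metis order_antisym)
next
  case (join s r' u w' k t v l)
  interpret group G by fact
  note closed = transport_closed[OF G]
  show ?case
  proof (cases "r \<le> r'")
    case True
    then obtain k1 k2 where k: "transport G f g s r u w k1" "transport G f g r r' w w' k2"
        "k = k1 \<otimes>\<^bsub>G\<^esub> k2"
      using join.IH(1)[of r w] join.prems by blast
    have "transport G f g r t w v (k2 \<otimes>\<^bsub>G\<^esub> l)"
      using k(2) join(2) by (rule transport.join)
    then show ?thesis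
      using k closed join(2) m_assoc by metis
  next
    case False
    then obtain k1 k2 where k: "transport G f g r' r w' w k1" "transport G f g r t w v k2"
        "l = k1 \<otimes>\<^bsub>G\<^esub> k2"
      using join.IH(2)[of r w] join.prems by fastforce
    have "transport G f g s r u w (k \<otimes>\<^bsub>G\<^esub> k1)"
      using join(1) k(1) by (rule transport.join)
    then show ?thesis
      using k closed join(1) m_assoc by metis
  qed
qed

text \<open>Split one derivation at the cuts of the other; each piece then lies in one star, where the
  telescoping formula applies.\<close>

theorem transport_unique:
  assumes G: "group G" "cocycle G f"
  shows "transport G f g s t u v k \<Longrightarrow> transport G f g s t u v l \<Longrightarrow> k = l"
proof (induction arbitrary: l rule: transport.induct)
  case (stay s t u)
  then have "l = f u u \<otimes>\<^bsub>G\<^esub> f u u" "g s \<in> St u"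
    using transport_in_star[OF G] by auto
  then show ?case
    using G cocycle_mult cocycle_refl by metis
next
  case (switch t u v)
  then have "l = f u u \<otimes>\<^bsub>G\<^esub> f u v"
    using transport_in_star[OF G switch.prems, of u] by auto
  then show ?case
    using switch G cocycle_mult by metis
next
  case (join s r u w k t v k')
  have r: "s \<le> r" "r \<le> t" "g r \<in> St w"
    using join(1,2)[THEN transport_ends] by auto
  then show ?case
    using transport_split[OF G join.prems r] join.IH by metis
qed

lemma transport_reparametrize:
  assumes "c > 0"
  shows "transport G f g s t u v k \<Longrightarrow>
    (\<And>x. x \<in> {s..t} \<Longrightarrow> g' (c * x + d) = g x) \<Longrightarrow> transport G f g' (c * s + d) (c * t + d) u v k"
proof (induction rule: transport.induct)
  case (stay s t u)
  have "g' ` {c * s + d..c * t + d} \<subseteq> St u"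
  proof clarify
    fix y assume y: "y \<in> {c * s + d..c * t + d}"
    define x where "x = (y - d) / c"
    have "y = c * x + d" "x \<in> {s..t}"
      using y assms by (auto simp: x_def field_simps)
    then show "g' y \<in> St u"
      using stay by auto
  qed
  then show ?case
    using stay assms by (intro transport.stay) auto
next
  case (switch t u v)
  then show ?case by (intro transport.switch) auto
next
  case (join s r u w k t v l)
  have "s \<le> r" "r \<le> t" using join(1,2)[THEN transport_ends] by auto
  then show ?case
    using join by (intro transport.join[of _ _ _ _ "c * r + d"]) auto
qed

lemma transport_joinpaths:
  assumes "transport G f g 0 1 u w k" "transport G f h 0 1 w v l" "pathfinish g = pathstart h"
  shows "transport G f (g +++ h) 0 1 u v (k \<otimes>\<^bsub>G\<^esub> l)"
proof -
  have "transport G f (g +++ h) (1/2 * 0 + 0) (1/2 * 1 + 0) u w k"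
    by (rule transport_reparametrize[OF _ assms(1)]) (auto simp: joinpaths_def)
  moreover have "transport G f (g +++ h) (1/2 * 0 + 1/2) (1/2 * 1 + 1/2) w v l"
    by (rule transport_reparametrize[OF _ assms(2)])
       (use assms(3) in \<open>auto simp: joinpaths_def pathstart_def pathfinish_def\<close>)
  ultimately show ?thesis
    using transport.join by fastforce
qed

text \<open>Stars are open, so a cutting of one path of a homotopy serves all nearby paths as well.
  The constant homotopy yields the existence of transport.\<close>

lemma transport_exists_nearby:
  fixes h :: "real \<Rightarrow> real \<Rightarrow> 'a"
  assumes h: "continuous_on ({0..1} \<times> {0..1}) (\<lambda>(s, t). h s t)"
    and hX: "\<And>s t. s \<in> {0..1} \<Longrightarrow> t \<in> {0..1} \<Longrightarrow> h s t \<in> X"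
    and s0: "s0 \<in> {0..1}"
    and uv: "h s0 0 \<in> St u" "h s0 1 \<in> St v"
  shows "\<exists>d>0. \<exists>k. \<forall>s\<in>{0..1}. \<bar>s - s0\<bar> < d \<longrightarrow> transport G f (h s) 0 1 u v k"
proof -
  let ?D = "{0..1} \<times> {0..1} :: (real \<times> real) set"
  have near: "\<exists>d>0. \<forall>s\<in>{0..1}. \<forall>t\<in>{0..1}. \<bar>s - s0\<bar> < d \<longrightarrow> \<bar>t - t0\<bar> < d \<longrightarrow> h s t \<in> St w"
    if "t0 \<in> {0..1}" "h s0 t0 \<in> St w" for t0 w
  proof -
    obtain U where U: "open U" "St w = X \<inter> U"
      using open_star[of w] unfolding openin_open by auto
    obtain W where W: "open W" "W \<inter> ?D = (\<lambda>(s, t). h s t) -` U \<inter> ?D"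
      using h U(1) unfolding continuous_on_open_invariant by blast
    have "(s0, t0) \<in> W"
      using that s0 U W by auto
    then obtain e where e: "e > 0" "ball (s0, t0) e \<subseteq> W"
      using W(1) open_contains_ball by blast
    have "h s t \<in> St w" if st: "s \<in> {0..1}" "t \<in> {0..1}" "\<bar>s - s0\<bar> < e / 2" "\<bar>t - t0\<bar> < e / 2" for s t
    proof -
      have "dist (s0, t0) (s, t) \<le> \<bar>s - s0\<bar> + \<bar>t - t0\<bar>"
        unfolding dist_Pair_Pair dist_real_def
        by (rule order_trans[OF sqrt_sum_squares_le_sum_abs]) (simp add: abs_minus_commute)
      then have "(s, t) \<in> W"
        using st e by (auto intro!: subsetD[OF e(2)])
      then have "h s t \<in> U"
        using W(2) st by auto
      then show ?thesis
        using U(2) hX st by auto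
    qed
    then show ?thesis
      using e(1) by (intro exI[of _ "e / 2"]) auto
  qed
  \<comment> \<open>Bisection of the time interval; the stars at both ends are arbitrary so that pieces compose.\<close>
  define P where "P a b \<longleftrightarrow> (0 \<le> a \<longrightarrow> b \<le> 1 \<longrightarrow> a \<le> b \<longrightarrow>
    (\<forall>u v. h s0 a \<in> St u \<longrightarrow> h s0 b \<in> St v \<longrightarrow>
      (\<exists>d>0. \<exists>k. \<forall>s\<in>{0..1}. \<bar>s - s0\<bar> < d \<longrightarrow> transport G f (h s) a b u v k)))" for a b
  have "P 0 1"
  proof (rule Bolzano)
    fix a b c :: real
    assume P: "P a b" "P b c" and abc: "a \<le> b" "b \<le> c"
    show "P a c"
      unfolding P_def
    proof (intro impI allI)
      fix u v
      assume *: "0 \<le> a" "c \<le> 1" "h s0 a \<in> St u" "h s0 c \<in> St v"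
      have "h s0 b \<in> X"
        using hX s0 * abc by auto
      then obtain w where w: "h s0 b \<in> St w"
        using cover by blast
      obtain d k where d: "d > 0" "\<And>s. s \<in> {0..1} \<Longrightarrow> \<bar>s - s0\<bar> < d \<Longrightarrow> transport G f (h s) a b u w k"
        using P(1)[unfolded P_def, rule_format, of u w] * abc w by fastforce
      obtain e l where e: "e > 0" "\<And>s. s \<in> {0..1} \<Longrightarrow> \<bar>s - s0\<bar> < e \<Longrightarrow> transport G f (h s) b c w v l"
        using P(2)[unfolded P_def, rule_format, of w v] * abc w by fastforce
      show "\<exists>d>0. \<exists>k. \<forall>s\<in>{0..1}. \<bar>s - s0\<bar> < d \<longrightarrow> transport G f (h s) a c u v k"
        using d e transport.join[of G f _ a b u w k c v l]
        by (intro exI[of _ "min d e"] conjI exI[of _ "k \<otimes>\<^bsub>G\<^esub> l"]) auto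
    qed
  next
    fix t0 :: real
    assume t0: "0 \<le> t0" "t0 \<le> 1"
    then obtain w where w: "h s0 t0 \<in> St w"
      using cover hX s0 by (meson atLeastAtMost_iff)
    obtain d where d: "d > 0" "\<And>s t. s \<in> {0..1} \<Longrightarrow> t \<in> {0..1} \<Longrightarrow> \<bar>s - s0\<bar> < d \<Longrightarrow> \<bar>t - t0\<bar> < d \<Longrightarrow> h s t \<in> St w"
      using near[OF _ w] t0 by auto
    show "\<exists>d>0. \<forall>a b. a \<le> t0 \<and> t0 \<le> b \<and> b - a < d \<longrightarrow> P a b"
    proof (intro exI[of _ d] conjI allI impI d(1))
      fix a b assume ab: "a \<le> t0 \<and> t0 \<le> b \<and> b - a < d"
      show "P a b"
        unfolding P_def
      proof (intro impI allI)
        fix u v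
        assume *: "0 \<le> a" "b \<le> 1" "h s0 a \<in> St u" "h s0 b \<in> St v"
        obtain e where e: "e > 0" "\<And>s. s \<in> {0..1} \<Longrightarrow> \<bar>s - s0\<bar> < e \<Longrightarrow> h s a \<in> St u"
          using near[OF _ *(3)] * ab by fastforce
        obtain e' where e': "e' > 0" "\<And>s. s \<in> {0..1} \<Longrightarrow> \<bar>s - s0\<bar> < e' \<Longrightarrow> h s b \<in> St v"
          using near[OF _ *(4)] * ab by fastforce
        have "transport G f (h s) a b u v (f u w \<otimes>\<^bsub>G\<^esub> (\<one>\<^bsub>G\<^esub> \<otimes>\<^bsub>G\<^esub> f w v))"
          if s: "s \<in> {0..1}" "\<bar>s - s0\<bar> < min d (min e e')" for s
        proof -
          have "h s ` {a..b} \<subseteq> St w"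
            using s * ab d(2) by auto
          then show ?thesis
            using s e e' ab *
            by (intro transport.join[OF transport.switch] transport.join[OF transport.stay transport.switch]) auto
        qed
        then show "\<exists>d>0. \<exists>k. \<forall>s\<in>{0..1}. \<bar>s - s0\<bar> < d \<longrightarrow> transport G f (h s) a b u v k"
          using d(1) e(1) e'(1)
          by (intro exI[of _ "min d (min e e')"] conjI ballI impI
              exI[of _ "f u w \<otimes>\<^bsub>G\<^esub> (\<one>\<^bsub>G\<^esub> \<otimes>\<^bsub>G\<^esub> f w v)"]) auto
      qed
    qed
  qed simp
  then show ?thesis
    using uv unfolding P_def by auto
qed

lemma transport_exists:
  assumes p: "p \<in> path_from_to X a b" and uv: "a \<in> St u" "b \<in> St v"
  shows "\<exists>k. transport G f p 0 1 u v k"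
proof -
  have c: "continuous_on {0..1} p" and pX: "\<And>t. t \<in> {0..1} \<Longrightarrow> p t \<in> X" and "p 0 = a" "p 1 = b"
    using p by (auto simp: path_from_to_def path_def path_image_def pathstart_def pathfinish_def)
  moreover have "continuous_on ({0..1} \<times> {0..1}) (\<lambda>(s::real, t). p t)"
    unfolding case_prod_unfold by (rule continuous_on_compose2[OF c]) (auto intro: continuous_intros)
  ultimately show ?thesis
    using transport_exists_nearby[of "\<lambda>_. p" 0 u v] uv by fastforce
qed

text \<open>Transport is locally constant in the parameter of the homotopy, hence constant by bisection
  of the parameter interval.\<close>

lemma transport_homotopic:
  assumes G: "group G" "cocycle G f"
    and pq: "homotopic_paths X p q"
    and p: "transport G f p 0 1 u v k"
  shows "transport G f q 0 1 u v k"
proof -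
  obtain h' where h': "continuous_on ({0..1} \<times> {0..1}) h'" "h' \<in> ({0..1} \<times> {0..1}) \<rightarrow> X"
      "\<forall>x \<in> {0..1}. h' (0, x) = p x" "\<forall>x \<in> {0..1}. h' (1, x) = q x"
      "\<forall>t \<in> {0..1::real}. pathstart (h' \<circ> Pair t) = pathstart p \<and> pathfinish (h' \<circ> Pair t) = pathfinish p"
    using pq unfolding homotopic_paths by blast
  define h where "h s t = h' (s, t)" for s t
  have h: "continuous_on ({0..1} \<times> {0..1}) (\<lambda>(s, t). h s t)"
    and hX: "\<And>s t. s \<in> {0..1} \<Longrightarrow> t \<in> {0..1} \<Longrightarrow> h s t \<in> X"
    and h01: "\<And>t. t \<in> {0..1} \<Longrightarrow> h 0 t = p t" "\<And>t. t \<in> {0..1} \<Longrightarrow> h 1 t = q t"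
    and ends: "\<And>s. s \<in> {0..1} \<Longrightarrow> h s 0 = p 0" "\<And>s. s \<in> {0..1} \<Longrightarrow> h s 1 = p 1"
    using h' by (auto simp: h_def pathstart_def pathfinish_def)
  have uv: "p 0 \<in> St u" "p 1 \<in> St v"
    using transport_ends[OF p] by auto
  have cong: "transport G f g' 0 1 u v l"
    if "transport G f g 0 1 u v l" "\<And>t. t \<in> {0..1} \<Longrightarrow> g' t = g t" for g g' l
    using transport_reparametrize[of 1 G f g 0 1 u v l g' 0] that by simp
  define P where "P a b \<longleftrightarrow> (0 \<le> a \<longrightarrow> a \<le> b \<longrightarrow> b \<le> 1 \<longrightarrow>
    (\<forall>l. transport G f (h a) 0 1 u v l \<longrightarrow> transport G f (h b) 0 1 u v l))" for a b
  have "P 0 1"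
  proof (rule Bolzano)
    fix a b c :: real
    assume "P a b" "P b c" "a \<le> b" "b \<le> c"
    then show "P a c"
      unfolding P_def by auto
  next
    fix s0 :: real
    assume s0: "0 \<le> s0" "s0 \<le> 1"
    then have "s0 \<in> {0..1}" "h s0 0 \<in> St u" "h s0 1 \<in> St v"
      using uv ends by auto
    from transport_exists_nearby[OF h hX this, of G f]
    obtain d k where d: "d > 0" "\<And>s. s \<in> {0..1} \<Longrightarrow> \<bar>s - s0\<bar> < d \<Longrightarrow> transport G f (h s) 0 1 u v k"
      by metis
    have "P a b" if "a \<le> s0 \<and> s0 \<le> b \<and> b - a < d" for a b
      unfolding P_def
    proof (intro impI allI)
      fix l assume *: "0 \<le> a" "a \<le> b" "b \<le> 1" "transport G f (h a) 0 1 u v l"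
      then have "transport G f (h a) 0 1 u v k" "transport G f (h b) 0 1 u v k"
        using that by (auto intro!: d(2))
      then show "transport G f (h b) 0 1 u v l"
        using transport_unique[OF G *(4)] by metis
    qed
    then show "\<exists>d>0. \<forall>a b. a \<le> s0 \<and> s0 \<le> b \<and> b - a < d \<longrightarrow> P a b"
      using d(1) by blast
  qed simp
  moreover have "transport G f (h 0) 0 1 u v k"
    using p h01 by (intro cong[OF p]) auto
  ultimately have "transport G f (h 1) 0 1 u v k"
    unfolding P_def by auto
  then show ?thesis
    by (rule cong) (simp add: h01)
qed

inductive cocycle_reachable :: "'k monoid \<Rightarrow> ('v \<Rightarrow> 'v \<Rightarrow> 'k) \<Rightarrow> 'v \<Rightarrow> 'v \<Rightarrow> 'k \<Rightarrow> bool"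
  for G f b where
  start: "cocycle_reachable G f b b \<one>\<^bsub>G\<^esub>"
| step: "cocycle_reachable G f b u k \<Longrightarrow> St u \<inter> St v \<noteq> {} \<Longrightarrow> cocycle_reachable G f b v (k \<otimes>\<^bsub>G\<^esub> f u v)"

lemma reachable_transport:
  assumes G: "group G" "cocycle G f" and x: "x \<in> St b"
  shows "cocycle_reachable G f b v k \<Longrightarrow> a \<in> St v \<Longrightarrow>
    \<exists>p \<in> path_from_to X x a. transport G f p 0 1 b v k"
proof (induction arbitrary: a rule: cocycle_reachable.induct)
  case start
  obtain p where p: "p \<in> path_from_to (St b) x a"
    using meet_path_connected[of x b b a] x start by auto
  then have "p \<in> path_from_to X x a"
    using path_from_to_mono star_subset by blast
  moreover have "transport G f p 0 1 b b \<one>\<^bsub>G\<^esub>"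
    using p by (intro transport.stay) (auto simp: path_from_to_def path_image_def)
  ultimately show ?case
    by blast
next
  case (step u k v)
  interpret group G by fact
  obtain c where c: "c \<in> St u" "c \<in> St v"
    using step by blast
  obtain p where p: "p \<in> path_from_to X x c" "transport G f p 0 1 b u k"
    using step.IH[OF c(1)] by blast
  obtain q where q: "q \<in> path_from_to (St v) c a"
    using meet_path_connected[of c v v a] c step by auto
  then have qX: "q \<in> path_from_to X c a"
    using path_from_to_mono star_subset by blast
  have q0: "q 0 = c" "q ` {0..1} \<subseteq> St v"
    using q by (auto simp: path_from_to_def path_image_def pathstart_def)
  then have "transport G f q 0 1 u v (f u v \<otimes>\<^bsub>G\<^esub> \<one>\<^bsub>G\<^esub>)"
    using c by (intro transport.join[OF transport.switch transport.stay]) auto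
  moreover have "f u v \<in> carrier G"
    using c G cocycle_closed by blast
  ultimately have "transport G f q 0 1 u v (f u v)"
    by simp
  then have "transport G f (p +++ q) 0 1 b v (k \<otimes>\<^bsub>G\<^esub> f u v)"
    using p q by (intro transport_joinpaths) (auto simp: path_from_to_def)
  then show ?case
    using path_from_to_join[OF p(1) qX] by blast
qed

text \<open>Transport of \<open>g\<close> is a homomorphism to \<open>G\<close>, and walks in the nerve show that it is onto. For
  injectivity consider the tautological cocycle \<open>f\<close> with values in the fundamental group. The
  hypothesis \<open>univ\<close> turns it into the image of \<open>g\<close> under a homomorphism \<open>\<Psi>\<close>, so that the class of a
  loop is, up to conjugation, \<open>\<Psi>\<close> of its transport. Hence a loop with trivial transport is
  null-homotopic.\<close>

theorem fundamental_group_iso_universal_cocycle_group: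
  fixes G :: "'k monoid"
  assumes x: "x \<in> St b" and G: "group G" "cocycle G g"
    and reach: "\<And>v w. w \<in> carrier G \<Longrightarrow> St v \<noteq> {} \<Longrightarrow> cocycle_reachable G g b v w"
    and univ: "\<And>f. cocycle (fundamental_group X x) f \<Longrightarrow>
      \<exists>\<Psi> \<in> hom G (fundamental_group X x). \<exists>c. (\<forall>v. c v \<in> carrier (fundamental_group X x)) \<and>
        (\<forall>u v. St u \<inter> St v \<noteq> {} \<longrightarrow>
          c u \<otimes>\<^bsub>fundamental_group X x\<^esub> f u v = \<Psi> (g u v) \<otimes>\<^bsub>fundamental_group X x\<^esub> c v)"
  shows "fundamental_group X x \<cong> G"
proof -
  interpret G: group G by fact
  define \<pi> where "\<pi> = fundamental_group X x"
  define M where "M = class_mult X"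
  define cl where "cl = loop_class X"
  define P where "P = path_classes X x"
  have xX: "x \<in> X"
    using x star_subset by blast
  have grp: "group \<pi>"
    unfolding \<pi>_def using group_fundamental_group[OF xX] .
  have pi_simps: "carrier \<pi> = P x" "mult \<pi> = M" "\<one>\<^bsub>\<pi>\<^esub> = cl (\<lambda>_. x)"
    by (simp_all add: \<pi>_def fundamental_group_eq M_def cl_def P_def)
  note assoc = class_mult_assoc[where S = X, folded M_def]
  have clI: "cl p \<in> path_classes X a c" if "p \<in> path_from_to X a c" for p a c
    using that by (simp add: cl_def)

  \<comment> \<open>\<open>C u a\<close> is the class of the paths from \<open>x\<close> to \<open>a\<close> that first follow a fixed route to the star of
    \<open>u\<close>. As stars are simply connected, it does not matter how they continue to \<open>a\<close>.\<close>
  define ctr where "ctr u = (SOME a. a \<in> St u)" for u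
  define tau where "tau u = (SOME p. p \<in> path_from_to X x (ctr u))" for u
  define sig where "sig u a = (SOME p. p \<in> path_from_to (St u) (ctr u) a)" for u a
  define C where "C u a = M (cl (tau u)) (cl (sig u a))" for u a
  have ctr: "ctr u \<in> St u" if "a \<in> St u" for u a
    unfolding ctr_def using that by (rule someI)
  have tau: "tau u \<in> path_from_to X x (ctr u)" if "a \<in> St u" for u a
  proof -
    have "cocycle_reachable G g b u \<one>\<^bsub>G\<^esub>"
      using that by (intro reach) auto
    from reachable_transport[OF G x this ctr[OF that]]
    show ?thesis
      unfolding tau_def by (metis someI)
  qed
  have sig: "sig u a \<in> path_from_to (St u) (ctr u) a" if "a \<in> St u" for u a
    using meet_path_connected[of "ctr u" u u a] ctr[OF that] that
    unfolding sig_def by (simp add: some_in_eq)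
  have in_X: "q \<in> path_from_to X a c" if "q \<in> path_from_to (St u) a c" for q u a c
    using that path_from_to_mono star_subset by blast
  have C_in: "C u a \<in> P a" if "a \<in> St u" for u a
    unfolding C_def P_def M_def
    by (intro class_mult_closed clI) (use that tau[OF that] sig[OF that] in_X in auto)
  have C_move: "M (C u a) (cl q) = C u c"
    if q: "q \<in> path_from_to (St u) a c" and a: "a \<in> St u" and c: "c \<in> St u" for u q a c
  proof -
    have "homotopic_paths X (sig u a +++ q) (sig u c)"
      using q sig[OF a] sig[OF c] by (intro star_simply_connected path_from_to_join)
    then have "M (cl (sig u a)) (cl q) = cl (sig u c)"
      using class_mult_class[OF in_X[OF sig[OF a]] in_X[OF q]]
      by (simp add: M_def cl_def loop_class_eqI)
    then show ?thesis
      unfolding C_def using tau[OF a] in_X[OF sig[OF a]] in_X[OF q]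
      by (subst assoc[of _ x "ctr u" _ a _ c]) (auto intro: clI)
  qed

  \<comment> \<open>\<open>f u v\<close> compares the two routes to a common point of the stars of \<open>u\<close> and \<open>v\<close>. It does not
    depend on that point because the intersection of the stars is path connected.\<close>
  define f where "f u v = (SOME k. k \<in> P x \<and> (\<exists>a \<in> St u \<inter> St v. M k (C v a) = C u a))" for u v
  have f: "f u v \<in> P x \<and> M (f u v) (C v a) = C u a" if a: "a \<in> St u" "a \<in> St v" for u v a
  proof -
    obtain p where p: "p \<in> path_from_to X x a" "C v a = cl p"
      using C_in[OF a(2)] by (auto simp: P_def path_classes_def cl_def)
    let ?r = "reversepath p"
    have r: "?r \<in> path_from_to X a x"
      using p(1) by (rule path_from_to_reverse)
    have "M (M (C u a) (cl ?r)) (C v a) = M (C u a) (M (cl ?r) (C v a))"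
      using C_in[OF a(1)] clI[OF r] C_in[OF a(2)] unfolding P_def by (rule assoc)
    also have "\<dots> = C u a"
      using class_mult_reverse[OF r] class_mult_unit_right[of "C u a" X x a] C_in[OF a(1)]
      by (simp add: p(2) M_def cl_def P_def)
    finally have "M (M (C u a) (cl ?r)) (C v a) = C u a" .
    moreover have "M (C u a) (cl ?r) \<in> P x"
      using C_in[OF a(1)] clI[OF r] unfolding P_def M_def by (rule class_mult_closed)
    ultimately have "\<exists>k. k \<in> P x \<and> (\<exists>a \<in> St u \<inter> St v. M k (C v a) = C u a)"
      using a by blast
    from someI_ex[OF this] obtain a' where k: "f u v \<in> P x" and a': "a' \<in> St u" "a' \<in> St v"
      "M (f u v) (C v a') = C u a'"
      unfolding f_def by blast
    obtain q where q: "q \<in> path_from_to (St u \<inter> St v) a' a"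
      using meet_path_connected[of a' u v a] a a' by blast
    then have qu: "q \<in> path_from_to (St u) a' a" and qv: "q \<in> path_from_to (St v) a' a"
      by (auto simp: path_from_to_def)
    have "M (f u v) (C v a) = M (f u v) (M (C v a') (cl q))"
      using C_move[OF qv] a a' by simp
    also have "\<dots> = M (M (f u v) (C v a')) (cl q)"
      using assoc[of "f u v" x x "C v a'" a' "cl q" a] k C_in[OF a'(2)] clI[OF in_X[OF qv]]
      by (simp add: P_def)
    also have "\<dots> = C u a"
      using C_move[OF qu] a a' by simp
    finally show ?thesis
      using k by blast
  qed
  have "cocycle \<pi> f"
    unfolding cocycle_def
  proof (intro conjI allI impI)
    fix u v assume "St u \<inter> St v \<noteq> {}"
    then show "f u v \<in> carrier \<pi>"
      using f pi_simps by blast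
  next
    fix u v w assume "St u \<inter> St v \<inter> St w \<noteq> {}"
    then obtain a where a: "a \<in> St u" "a \<in> St v" "a \<in> St w"
      by blast
    have P: "f u v \<in> P x" "f v w \<in> P x" "f u w \<in> P x" "C w a \<in> P a"
      using f a C_in by blast+
    then have "M (M (f u v) (f v w)) (C w a) = M (f u v) (M (f v w) (C w a))"
      unfolding P_def by (intro assoc)
    also have "\<dots> = M (f u w) (C w a)"
      using f a by simp
    finally have "M (f u v) (f v w) = f u w"
      using P class_mult_closed[of "f u v" X x x "f v w" x]
      unfolding P_def M_def
      by (intro class_mult_right_cancel[of "class_mult X (f u v) (f v w)" X x x "f u w" "C w a" a])
    then show "f u v \<otimes>\<^bsub>\<pi>\<^esub> f v w = f u w"
      by (simp add: pi_simps)
  qed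
  then have "\<exists>\<Psi> \<in> hom G \<pi>. \<exists>c. (\<forall>v. c v \<in> P x) \<and>
      (\<forall>u v. St u \<inter> St v \<noteq> {} \<longrightarrow> M (c u) (f u v) = M (\<Psi> (g u v)) (c v))"
    using univ[of f] by (simp only: \<pi>_def[symmetric] pi_simps)
  then obtain \<Psi> where \<Psi>: "\<Psi> \<in> hom G \<pi>" and "\<exists>c. (\<forall>v. c v \<in> P x) \<and>
      (\<forall>u v. St u \<inter> St v \<noteq> {} \<longrightarrow> M (c u) (f u v) = M (\<Psi> (g u v)) (c v))"
    by (elim bexE)
  then obtain c where c_all: "(\<forall>v. c v \<in> P x) \<and>
      (\<forall>u v. St u \<inter> St v \<noteq> {} \<longrightarrow> M (c u) (f u v) = M (\<Psi> (g u v)) (c v))"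
    by (elim exE)
  have c: "c v \<in> P x" for v
    using c_all by (elim conjE allE)
  have gauge: "M (c u) (f u v) = M (\<Psi> (g u v)) (c v)" if "St u \<inter> St v \<noteq> {}" for u v
    using conjunct2[OF c_all, rule_format, OF that] .
  have \<Psi>_in: "\<Psi> w \<in> P x" if "w \<in> carrier G" for w
    using \<Psi> that by (auto simp: hom_def pi_simps)
  have \<Psi>_mult: "\<Psi> (w \<otimes>\<^bsub>G\<^esub> w') = M (\<Psi> w) (\<Psi> w')" if "w \<in> carrier G" "w' \<in> carrier G" for w w'
    using \<Psi> that by (auto simp: hom_def pi_simps)
  have \<Psi>_one: "\<Psi> \<one>\<^bsub>G\<^esub> = cl (\<lambda>_. x)"
    using hom_one[OF \<Psi> G.is_group grp] by (simp add: pi_simps)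

  \<comment> \<open>After the gauge change \<open>c\<close>, switching stars multiplies by \<open>\<Psi> (g u v)\<close>.\<close>
  define D where "D u a = M (c u) (C u a)" for u a
  have D_in: "D u a \<in> P a" if "a \<in> St u" for u a
    using c[of u] C_in[OF that] unfolding D_def P_def M_def by (rule class_mult_closed)
  have D_move: "M (D u a) (cl q) = D u c"
    if q: "q \<in> path_from_to (St u) a c" and a: "a \<in> St u" and c': "c \<in> St u" for u q a c
    using assoc[OF c[of u, unfolded P_def] C_in[OF a, unfolded P_def] clI[OF in_X[OF q]]]
      C_move[OF q a c'] unfolding D_def by simp
  have D_switch: "D u a = M (\<Psi> (g u v)) (D v a)" if a: "a \<in> St u" "a \<in> St v" for u v a
  proof -
    have gw: "\<Psi> (g u v) \<in> P x"
      using \<Psi>_in cocycle_closed[OF G(2) a] .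
    have "D u a = M (c u) (M (f u v) (C v a))"
      using f[OF a] by (simp add: D_def)
    also have "\<dots> = M (M (c u) (f u v)) (C v a)"
      using f[OF a] c[of u] C_in[OF a(2)] unfolding P_def by (intro assoc[symmetric]) auto
    also have "\<dots> = M (M (\<Psi> (g u v)) (c v)) (C v a)"
      using a by (subst gauge) auto
    also have "\<dots> = M (\<Psi> (g u v)) (D v a)"
      unfolding D_def using gw c[of v] C_in[OF a(2)] unfolding P_def by (intro assoc) auto
    finally show ?thesis .
  qed
  have key: "transport G g p s t u v w \<Longrightarrow> 0 \<le> s \<Longrightarrow> t \<le> 1 \<Longrightarrow>
      M (D u (p s)) (cl (p \<circ> linepath s t)) = M (\<Psi> w) (D v (p t))"
    if p: "p \<in> path_from_to X a a'" for p a a' s t u v w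
  proof (induction rule: transport.induct)
    case (stay s t u)
    have st: "{s, t} \<subseteq> {0..1}" "p s \<in> St u" "p t \<in> St u"
      using stay by auto
    have "p ` closed_segment s t \<subseteq> St u"
      using stay by (simp add: closed_segment_eq_real_ivl)
    then have "path_image (p \<circ> linepath s t) \<subseteq> St u"
      by (simp add: path_image_compose)
    then have "p \<circ> linepath s t \<in> path_from_to (St u) (p s) (p t)"
      using subpath_in[OF p, of s t] st by (auto simp: path_from_to_def)
    from D_move[OF this st(2,3)] have "M (D u (p s)) (cl (p \<circ> linepath s t)) = D u (p t)" .
    also have "\<dots> = M (\<Psi> \<one>\<^bsub>G\<^esub>) (D u (p t))"
      using D_in[OF st(3)] class_mult_unit_left[of "D u (p t)" X x "p t"]
      by (simp add: \<Psi>_one P_def M_def cl_def)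
    finally show ?case .
  next
    case (switch t u v)
    have "p \<circ> linepath t t = (\<lambda>_. p t)"
      by (simp add: linepath_def fun_eq_iff left_diff_distrib)
    then have "M (D u (p t)) (cl (p \<circ> linepath t t)) = M (D u (p t)) (cl (\<lambda>_. p t))"
      by (rule arg_cong)
    also have "\<dots> = D u (p t)"
      using D_in[OF switch(1)] class_mult_unit_right[of "D u (p t)" X x "p t"]
      by (simp add: P_def M_def cl_def)
    also have "\<dots> = M (\<Psi> (g u v)) (D v (p t))"
      by (rule D_switch[OF switch(1,2)])
    finally show ?case .
  next
    case (join s r u w k t v l)
    have r: "s \<le> r" "r \<le> t" "p s \<in> St u" "p r \<in> St w" "p t \<in> St v"
      using join(1,2)[THEN transport_ends] by auto
    have st: "s \<in> {0..1}" "r \<in> {0..1}" "t \<in> {0..1}"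
      using r join.prems by auto
    have kl: "k \<in> carrier G" "l \<in> carrier G"
      using join(1,2) transport_closed[OF G] by blast+
    note in1 = clI[OF subpath_in[OF p st(1,2)]] and in2 = clI[OF subpath_in[OF p st(2,3)]]
    have "M (D u (p s)) (cl (p \<circ> linepath s t)) =
        M (D u (p s)) (M (cl (p \<circ> linepath s r)) (cl (p \<circ> linepath r t)))"
      using subpath_join[OF p st] by (simp add: M_def cl_def)
    also have "\<dots> = M (M (D u (p s)) (cl (p \<circ> linepath s r))) (cl (p \<circ> linepath r t))"
      using D_in[OF r(3)] in1 in2 unfolding P_def by (intro assoc[symmetric])
    also have "\<dots> = M (M (\<Psi> k) (D w (p r))) (cl (p \<circ> linepath r t))"
      using join.IH(1) st by (simp only: atLeastAtMost_iff)
    also have "\<dots> = M (\<Psi> k) (M (D w (p r)) (cl (p \<circ> linepath r t)))"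
      using D_in[OF r(4)] \<Psi>_in[OF kl(1)] in2 unfolding P_def by (intro assoc)
    also have "\<dots> = M (\<Psi> k) (M (\<Psi> l) (D v (p t)))"
      using join.IH(2) st by (simp only: atLeastAtMost_iff)
    also have "\<dots> = M (M (\<Psi> k) (\<Psi> l)) (D v (p t))"
      using D_in[OF r(5)] \<Psi>_in[OF kl(1)] \<Psi>_in[OF kl(2)] unfolding P_def by (intro assoc[symmetric])
    finally show ?case
      by (simp only: \<Psi>_mult kl)
  qed

  define hol where "hol A = (THE w. \<exists>p \<in> path_from_to X x x. A = cl p \<and> transport G g p 0 1 b b w)" for A
  have hol: "hol (cl p) = w" if p: "p \<in> path_from_to X x x" and w: "transport G g p 0 1 b b w" for p w
    unfolding hol_def
  proof (rule the_equality)
    fix w' assume "\<exists>q \<in> path_from_to X x x. cl p = cl q \<and> transport G g q 0 1 b b w'"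
    then obtain q where q: "homotopic_paths X p q" "transport G g q 0 1 b b w'"
      using class_eq_iff[OF p] by (auto simp: cl_def)
    show "w' = w"
      using transport_unique[OF G q(2) transport_homotopic[OF G q(1) w]] .
  qed (use that in blast)
  have loop_transport: "\<exists>w. transport G g p 0 1 b b w" if "p \<in> path_from_to X x x" for p
    using transport_exists[OF that x x] .
  have "hol \<in> hom \<pi> G"
  proof (rule homI)
    fix A assume "A \<in> carrier \<pi>"
    then obtain p where p: "p \<in> path_from_to X x x" "A = cl p"
      by (auto simp: pi_simps P_def path_classes_def cl_def)
    then show "hol A \<in> carrier G"
      using loop_transport[OF p(1)] hol[OF p(1)] transport_closed[OF G] by metis
  next
    fix A B assume "A \<in> carrier \<pi>" "B \<in> carrier \<pi>"
    then obtain p q where p: "p \<in> path_from_to X x x" "A = cl p" and q: "q \<in> path_from_to X x x" "B = cl q"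
      by (auto simp: pi_simps P_def path_classes_def cl_def)
    obtain w w' where w: "transport G g p 0 1 b b w" "transport G g q 0 1 b b w'"
      using loop_transport p q by blast
    have "transport G g (p +++ q) 0 1 b b (w \<otimes>\<^bsub>G\<^esub> w')"
      using w p q by (intro transport_joinpaths) (auto simp: path_from_to_def)
    then have "hol (cl (p +++ q)) = hol A \<otimes>\<^bsub>G\<^esub> hol B"
      using hol p q w path_from_to_join[OF p(1) q(1)] by simp
    then show "hol (A \<otimes>\<^bsub>\<pi>\<^esub> B) = hol A \<otimes>\<^bsub>G\<^esub> hol B"
      using class_mult_class[OF p(1) q(1)] p q by (simp add: pi_simps M_def cl_def)
  qed
  moreover have "inj_on hol (carrier \<pi>)"
  proof (rule inj_onI)
    fix A B assume "A \<in> carrier \<pi>" "B \<in> carrier \<pi>" and eq: "hol A = hol B"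
    then obtain p q where p: "p \<in> path_from_to X x x" "A = cl p" and q: "q \<in> path_from_to X x x" "B = cl q"
      by (auto simp: pi_simps P_def path_classes_def cl_def)
    have D: "M (D b x) (cl r) = M (\<Psi> (hol (cl r))) (D b x)" if r: "r \<in> path_from_to X x x" for r
    proof -
      obtain w where w: "transport G g r 0 1 b b w"
        using loop_transport[OF r] by blast
      have "r \<circ> linepath 0 1 = r" "r 0 = x" "r 1 = x"
        using r by (auto simp: linepath_def fun_eq_iff path_from_to_def pathstart_def pathfinish_def)
      then show ?thesis
        using key[OF r w] hol[OF r w] by simp
    qed
    have "M (D b x) A = M (D b x) B"
      using D[OF p(1)] D[OF q(1)] eq p q by simp
    then show "A = B"
      using monoid.Units_l_cancel[OF group.is_monoid[OF grp], of "D b x" A B] D_in[OF x]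
        clI[OF p(1)] clI[OF q(1)] p q
      by (simp add: group.Units_eq[OF grp] pi_simps P_def)
  qed
  moreover have "carrier G \<subseteq> hol ` carrier \<pi>"
  proof
    fix w assume "w \<in> carrier G"
    then have "cocycle_reachable G g b b w"
      using reach x by blast
    from reachable_transport[OF G x this x] obtain p
      where p: "p \<in> path_from_to X x x" "transport G g p 0 1 b b w"
      by blast
    then have "w = hol (cl p)" "cl p \<in> carrier \<pi>"
      using hol clI by (auto simp: pi_simps P_def)
    then show "w \<in> hol ` carrier \<pi>"
      by blast
  qed
  ultimately have "hol \<in> iso \<pi> G"
    by (auto simp: iso_def bij_betw_def hom_def)
  then show ?thesis
    unfolding \<pi>_def[symmetric] by (rule is_isoI)
qed

end

section \<open>Flat connections on a cube\<close>

definition symdiff :: "'d set \<Rightarrow> 'd set \<Rightarrow> 'd set" where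
  "symdiff v U = (v - U) \<union> (U - v)"

text \<open>Vertices of the cube are subsets of the set of directions. Crossing an edge in direction \<open>i\<close>
  changes membership of \<open>i\<close>.\<close>

definition flip :: "'d \<Rightarrow> 'd set \<Rightarrow> 'd set" where
  "flip i v = symdiff v {i}"

lemma symdiff_simps [simp]: "symdiff v {} = v" "symdiff {} v = v" "symdiff v v = {}"
  by (auto simp: symdiff_def)

lemma flip_sdiff: "flip i (symdiff v U) = symdiff v (flip i U)"
  by (auto simp: symdiff_def flip_def)

lemma symdiff_commute: "symdiff u v = symdiff v u"
  by (auto simp: symdiff_def)

lemma symdiff_sdiff: "symdiff (symdiff v U) W = symdiff v (symdiff U W)"
  by (auto simp: symdiff_def)

lemma symdiff_disjoint: "U \<inter> W = {} \<Longrightarrow> symdiff U W = U \<union> W"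
  by (auto simp: symdiff_def)

lemma flip_flip [simp]: "flip i (flip i v) = v"
  by (auto simp: symdiff_def flip_def)

lemma flip_commute: "flip i (flip j v) = flip j (flip i v)"
  by (auto simp: symdiff_def flip_def)

lemma flip_empty [simp]: "flip i {} = {i}"
  by (simp add: flip_def)

lemma flip_insert: "i \<notin> v \<Longrightarrow> flip i v = insert i v"
  by (auto simp: flip_def symdiff_def)

lemma flip_remove: "i \<in> v \<Longrightarrow> flip i v = v - {i}"
  by (auto simp: flip_def symdiff_def)

lemma flip_subset: "v \<subseteq> D \<Longrightarrow> i \<in> D \<Longrightarrow> flip i v \<subseteq> D"
  by (auto simp: flip_def symdiff_def)

lemma symdiff_subset: "v \<subseteq> D \<Longrightarrow> U \<subseteq> D \<Longrightarrow> symdiff v U \<subseteq> D"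
  by (auto simp: symdiff_def)

text \<open>The group element \<open>f v i\<close> sits on the edge in direction \<open>i\<close>, oriented from \<open>v\<close> to \<open>flip i v\<close>.\<close>

locale cube_connection = group G for G :: "'k monoid" (structure) +
  fixes D :: "'d set" and f :: "'d set \<Rightarrow> 'd \<Rightarrow> 'k"
  assumes closed [simp]: "v \<subseteq> D \<Longrightarrow> i \<in> D \<Longrightarrow> f v i \<in> carrier G"
    and inverse: "v \<subseteq> D \<Longrightarrow> i \<in> D \<Longrightarrow> f v i \<otimes> f (flip i v) i = \<one>"
begin

definition flat :: "'d set \<Rightarrow> 'd \<Rightarrow> 'd \<Rightarrow> bool" where
  "flat v i j \<longleftrightarrow> f v i \<otimes> f (flip i v) j = f v j \<otimes> f (flip j v) i"

lemma flat_commute: "flat v i j \<longleftrightarrow> flat v j i"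
  by (auto simp: flat_def)

lemma flat_refl: "flat v i i"
  by (simp add: flat_def)

text \<open>With \<open>flat_commute\<close>, this makes flatness a property of the square and not of its corner \<open>v\<close>.\<close>

lemma flat_flip:
  assumes v: "v \<subseteq> D" "i \<in> D" "j \<in> D" and flat: "flat v i j"
  shows "flat (flip i v) i j"
proof -
  let ?vi = "flip i v" and ?vj = "flip j v" and ?vij = "flip j (flip i v)"
  have s: "?vi \<subseteq> D" "?vj \<subseteq> D" "?vij \<subseteq> D"
    using v by (simp_all add: flip_subset)
  have "f v i \<otimes> f ?vi j \<otimes> f ?vij i = f v j \<otimes> f ?vj i \<otimes> f ?vij i"
    using flat by (simp add: flat_def)
  also have "\<dots> = f v j"
    using v s inverse[of ?vj i] by (simp add: m_assoc flip_commute)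
  finally have "f ?vi i \<otimes> f v j = f ?vi i \<otimes> (f v i \<otimes> (f ?vi j \<otimes> f ?vij i))"
    using v s by (simp add: m_assoc)
  also have "\<dots> = f ?vi j \<otimes> f ?vij i"
    using v s inverse[of ?vi i] by (simp flip: m_assoc)
  finally show ?thesis
    by (simp add: flat_def)
qed

text \<open>The cube is simply connected. A potential on a facet extends to the opposite facet along the
  edges in the new direction, and the squares between the two facets make the extension a
  potential there. The base \<open>w\<close> allows for faces of a larger cube.\<close>

lemma flat_imp_coboundary:
  assumes "finite E" "E \<subseteq> D" "w \<subseteq> D"
    and "\<And>v i j. v \<subseteq> E \<Longrightarrow> i \<in> E \<Longrightarrow> j \<in> E \<Longrightarrow> flat (symdiff w v) i j"
  shows "\<exists>c. (\<forall>v\<subseteq>E. c v \<in> carrier G) \<and> (\<forall>v\<subseteq>E. \<forall>i\<in>E. c v \<otimes> f (symdiff w v) i = c (flip i v))"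
  using assms
proof (induction E rule: finite_induct)
  case empty
  show ?case
    by (intro exI[of _ "\<lambda>_. \<one>"]) auto
next
  case (insert d E)
  have "\<exists>c. (\<forall>v\<subseteq>E. c v \<in> carrier G) \<and> (\<forall>v\<subseteq>E. \<forall>i\<in>E. c v \<otimes> f (symdiff w v) i = c (flip i v))"
    using insert.prems by (intro insert.IH) blast+
  then obtain c where c: "\<And>v. v \<subseteq> E \<Longrightarrow> c v \<in> carrier G"
      "\<And>v i. v \<subseteq> E \<Longrightarrow> i \<in> E \<Longrightarrow> c v \<otimes> f (symdiff w v) i = c (flip i v)"
    by metis
  define e where "e v = (if d \<in> v then c (v - {d}) \<otimes> f (symdiff w (v - {d})) d else c v)" for v
  have wv: "symdiff w v \<subseteq> D" if "v \<subseteq> insert d E" for v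
    using that insert.prems by (intro symdiff_subset) auto
  have d: "d \<in> D" and E: "\<And>i. i \<in> E \<Longrightarrow> i \<in> D"
    using insert.prems by auto
  have old: "e v = c v" "e (insert d v) = c v \<otimes> f (symdiff w v) d" if "v \<subseteq> E" for v
  proof -
    have "d \<notin> v" using that insert.hyps(2) by blast
    then show "e v = c v" "e (insert d v) = c v \<otimes> f (symdiff w v) d"
      by (simp_all add: e_def)
  qed
  have flip_d: "symdiff w (insert d v) = flip d (symdiff w v)" if "v \<subseteq> E" for v
  proof -
    have "d \<notin> v" using that insert.hyps(2) by blast
    then show ?thesis by (simp add: flip_sdiff flip_insert)
  qed
  have cases: "v \<subseteq> E \<or> (\<exists>u\<subseteq>E. v = insert d u)" if "v \<subseteq> insert d E" for v
  proof (cases "d \<in> v")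
    case True
    then have "v - {d} \<subseteq> E" "v = insert d (v - {d})"
      using that by auto
    then show ?thesis by blast
  qed (use that in auto)
  have eclosed: "e v \<in> carrier G" if "v \<subseteq> insert d E" for v
    using cases[OF that]
  proof (elim disjE exE conjE)
    fix u assume u: "u \<subseteq> E" "v = insert d u"
    then have "symdiff w u \<subseteq> D"
      using wv by blast
    then show ?thesis
      using u old(2)[OF u(1)] c(1)[OF u(1)] d by simp
  qed (use old c in simp)
  have "e v \<otimes> f (symdiff w v) i = e (flip i v)" if v: "v \<subseteq> insert d E" and i: "i \<in> insert d E" for v i
    using cases[OF v]
  proof (elim disjE exE conjE)
    assume v: "v \<subseteq> E"
    show ?thesis
    proof (cases "i = d")
      case True
      then show ?thesis
        using v old insert.hyps by (metis flip_insert subsetD)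
    next
      case False
      then show ?thesis
        using v i old c by (metis flip_subset insertE)
    qed
  next
    fix u assume u: "u \<subseteq> E" and v: "v = insert d u"
    have du: "d \<notin> u"
      using u insert.hyps by auto
    have wu: "symdiff w u \<subseteq> D"
      using u wv by blast
    show ?thesis
    proof (cases "i = d")
      case True
      have "e v \<otimes> f (symdiff w v) i = c u \<otimes> (f (symdiff w u) d \<otimes> f (flip d (symdiff w u)) d)"
        using u v True c wu d by (simp add: old flip_d m_assoc flip_subset)
      also have "\<dots> = e (flip i v)"
        using True v du u c old inverse[OF wu d] by (simp add: flip_remove)
      finally show ?thesis .
    next
      case False
      then have i: "i \<in> E" "i \<in> D" using i E by auto
      have fu: "flip i u \<subseteq> E"
        using u i by (simp add: flip_subset)
      have "e v \<otimes> f (symdiff w v) i = c u \<otimes> (f (symdiff w u) d \<otimes> f (flip d (symdiff w u)) i)"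
        using u v c wu d i by (simp add: old flip_d m_assoc flip_subset)
      also have "f (symdiff w u) d \<otimes> f (flip d (symdiff w u)) i = f (symdiff w u) i \<otimes> f (flip i (symdiff w u)) d"
        using insert.prems(3)[of u d i] u i by (auto simp: flat_def)
      also have "c u \<otimes> \<dots> = c (flip i u) \<otimes> f (symdiff w (flip i u)) d"
        using c(2)[OF u i(1), symmetric] c(1)[OF u] wu wv[of "flip i u"] fu d i
        by (simp add: m_assoc flip_sdiff subset_insertI2)
      also have "\<dots> = e (insert d (flip i u))"
        using old(2)[OF fu] by simp
      also have "insert d (flip i u) = flip i v"
        using False v du by (auto simp: flip_def symdiff_def)
      finally show ?thesis .
    qed
  qed
  then show ?case
    using eclosed by blast
qed

text \<open>In terms of potentials \<open>c\<close> and \<open>c'\<close> on two parallel faces, an edge between these faces keeps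
  its value when it slides across a flat square.\<close>

lemma slide:
  assumes "flat w x k" "w \<subseteq> D" "x \<in> D" "k \<in> D" "c \<in> carrier G" "c' \<in> carrier G"
  shows "c \<otimes> f w k \<otimes> f (flip k w) x \<otimes> inv (c' \<otimes> f (flip x w) k) = c \<otimes> f w x \<otimes> inv c'"
proof -
  note s = assms(2-6) flip_subset[OF assms(2,3)] flip_subset[OF assms(2,4)]
  have "c \<otimes> f w k \<otimes> f (flip k w) x \<otimes> inv (c' \<otimes> f (flip x w) k) =
      c \<otimes> (f w x \<otimes> f (flip x w) k) \<otimes> (inv (f (flip x w) k) \<otimes> inv c')"
    using s assms(1) by (simp add: m_assoc inv_mult_group flat_def)
  also have "\<dots> = c \<otimes> f w x \<otimes> ((f (flip x w) k \<otimes> inv (f (flip x w) k)) \<otimes> inv c')"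
    using s by (simp only: m_assoc closed m_closed inv_closed)
  also have "\<dots> = c \<otimes> f w x \<otimes> inv c'"
    using s by simp
  finally show ?thesis .
qed

lemma flat_gauge:
  assumes w: "w \<subseteq> D" "i \<in> D" "j \<in> D" and c: "c0 \<in> carrier G" "ci \<in> carrier G" "cj \<in> carrier G" "cij \<in> carrier G"
  shows "flat w i j \<longleftrightarrow>
    (c0 \<otimes> f w i \<otimes> inv ci) \<otimes> (ci \<otimes> f (flip i w) j \<otimes> inv cij) =
    (c0 \<otimes> f w j \<otimes> inv cj) \<otimes> (cj \<otimes> f (flip j w) i \<otimes> inv cij)"
proof -
  note s = w flip_subset[OF w(1,2)] flip_subset[OF w(1,3)]
  have eq: "(c0 \<otimes> a \<otimes> inv c1) \<otimes> (c1 \<otimes> b \<otimes> inv cij) = c0 \<otimes> (a \<otimes> b) \<otimes> inv cij"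
    if "a \<in> carrier G" "b \<in> carrier G" "c1 \<in> carrier G" for a b c1
  proof -
    have "(c0 \<otimes> a \<otimes> inv c1) \<otimes> (c1 \<otimes> b \<otimes> inv cij) = c0 \<otimes> a \<otimes> (inv c1 \<otimes> c1) \<otimes> b \<otimes> inv cij"
      using that c by (simp only: m_assoc m_closed inv_closed)
    then show ?thesis
      using that c by (simp add: m_assoc)
  qed
  have "c0 \<otimes> a \<otimes> inv cij = c0 \<otimes> b \<otimes> inv cij \<longleftrightarrow> a = b" if "a \<in> carrier G" "b \<in> carrier G" for a b
    using that c by simp
  then show ?thesis
    using s c by (simp add: flat_def eq)
qed

text \<open>The four corners of the square carry parallel cubes in the directions \<open>A\<close>. All
  squares of these cubes are flat, hence there are potentials \<open>C\<close> on them. Let \<open>F x U T\<close> be the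
  value of the edge in direction \<open>x\<close> at level \<open>T\<close>, measured with these potentials. It does not
  change when the level moves across a flat square: among nonempty levels this is always so, and
  the squares in \<open>low\<close> allow the move from the bottom level to a singleton. So the bottom square has
  the same holonomy as the top square, which is flat.\<close>

theorem flat_by_filling:
  assumes ij: "i \<in> D" "j \<in> D" "i \<noteq> j" and A: "A \<subseteq> D" "finite A" "i \<notin> A" "j \<notin> A" and v: "v \<subseteq> D"
    and high: "\<And>U k l. U \<subseteq> A \<union> {i, j} \<Longrightarrow> k \<in> A \<union> {i, j} \<Longrightarrow> l \<in> A \<union> {i, j} \<Longrightarrow> k \<noteq> l \<Longrightarrow>
      2 \<le> card ((U \<union> {k, l}) \<inter> A) \<Longrightarrow> flat (symdiff v U) k l"
    and A2: "2 \<le> card A"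
    and low: "a \<in> A" "flat v i a" "b \<in> A" "flat v j b"
      "c \<in> A" "flat (flip j v) i c" "d \<in> A" "flat (flip i v) j d"
  shows "flat v i j"
proof -
  have two: "2 \<le> card B" if "k \<in> B" "l \<in> B" "k \<noteq> l" "B \<subseteq> A" for B k l
  proof -
    have "card {k, l} \<le> card B"
      using that A(2) by (intro card_mono) (auto intro: finite_subset)
    then show ?thesis using that by simp
  qed
  have "\<exists>c. (\<forall>T\<subseteq>A. c T \<in> carrier G) \<and> (\<forall>T\<subseteq>A. \<forall>k\<in>A. c T \<otimes> f (symdiff (symdiff v U) T) k = c (flip k T))"
    if U: "U \<subseteq> {i, j}" for U
  proof (rule flat_imp_coboundary)
    show "symdiff v U \<subseteq> D"
      using U ij v by (intro symdiff_subset) auto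
    fix T k l assume T: "T \<subseteq> A" "k \<in> A" "l \<in> A"
    show "flat (symdiff (symdiff v U) T) k l"
    proof (cases "k = l")
      case False
      have "U \<inter> T = {}"
        using U T A by auto
      then show ?thesis
        using T U False by (auto simp: symdiff_sdiff symdiff_disjoint intro!: high two[of k _ l])
    qed (simp add: flat_refl)
  qed (use A in auto)
  then obtain C where C: "\<And>U T. U \<subseteq> {i, j} \<Longrightarrow> T \<subseteq> A \<Longrightarrow> C U T \<in> carrier G"
      "\<And>U T k. U \<subseteq> {i, j} \<Longrightarrow> T \<subseteq> A \<Longrightarrow> k \<in> A \<Longrightarrow> C U T \<otimes> f (symdiff (symdiff v U) T) k = C U (flip k T)"
    by metis
  define F where "F x U T = C U T \<otimes> f (symdiff (symdiff v U) T) x \<otimes> inv (C (insert x U) T)" for x U T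
  have step: "F x U (flip k T) = F x U T"
    if U: "x \<in> {i, j}" "U \<subseteq> {i, j}" "x \<notin> U" and T: "T \<subseteq> A" "k \<in> A"
      and fl: "flat (symdiff (symdiff v U) T) x k" for x U k T
  proof -
    let ?w = "symdiff (symdiff v U) T"
    have w: "?w \<subseteq> D"
      using U T ij v A by (intro symdiff_subset) auto
    have D: "x \<in> D" "k \<in> D"
      using U T ij A by auto
    have 1: "symdiff (symdiff v U) (flip k T) = flip k ?w"
      by (simp add: flip_sdiff)
    have 2: "symdiff (symdiff v (insert x U)) T = flip x ?w"
      using U T A by (auto simp: flip_def symdiff_def)
    have U': "insert x U \<subseteq> {i, j}"
      using U by auto
    show ?thesis
      using slide[OF fl w D C(1)[OF U(2) T(1)] C(1)[OF U' T(1)]]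
        C(2)[OF U(2) T] C(2)[OF U' T] unfolding F_def 1 2 by simp
  qed
  have top: "F x U A = F x U {k}" if U: "x \<in> {i, j}" "U \<subseteq> {i, j}" "x \<notin> U" and k: "k \<in> A" for x U k
  proof -
    have "finite R \<Longrightarrow> R \<subseteq> A - {k} \<Longrightarrow> F x U (insert k R) = F x U {k}" for R
    proof (induction R rule: finite_induct)
      case (insert r R)
      have "flat (symdiff (symdiff v U) (insert k R)) x r"
      proof -
        have "U \<inter> insert k R = {}"
          using U insert k A by auto
        then have *: "symdiff (symdiff v U) (insert k R) = symdiff v (U \<union> insert k R)"
          by (simp add: symdiff_sdiff symdiff_disjoint)
        show ?thesis
          unfolding * using U insert k A by (intro high two[of k _ r]) auto
      qed
      then have "F x U (flip r (insert k R)) = F x U (insert k R)"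
        using U insert k by (intro step) auto
      moreover have "flip r (insert k R) = insert k (insert r R)"
        using insert by (subst flip_insert) auto
      ultimately show ?case
        using insert by auto
    qed simp
    from this[of "A - {k}"] show ?thesis
      using A k by (simp add: insert_absorb)
  qed
  have bottom: "F x U A = F x U {}"
    if U: "x \<in> {i, j}" "U \<subseteq> {i, j}" "x \<notin> U" and k: "k \<in> A" and fl: "flat (symdiff v U) x k" for x U k
    using step[OF U, of "{}" k] top[OF U k] fl k by simp
  have "F i {} A = F i {} {}"
    by (rule bottom[of _ _ a]) (use low ij in auto)
  moreover have "F j {} A = F j {} {}"
    by (rule bottom[of _ _ b]) (use low ij in auto)
  moreover have "F i {j} A = F i {j} {}"
    by (rule bottom[of _ _ c]) (use low ij in \<open>auto simp: flip_def\<close>)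
  moreover have "F j {i} A = F j {i} {}"
    by (rule bottom[of _ _ d]) (use low ij in \<open>auto simp: flip_def\<close>)
  moreover have flat_F: "flat (symdiff v T) i j \<longleftrightarrow> F i {} T \<otimes> F j {i} T = F j {} T \<otimes> F i {j} T"
    if T: "T \<subseteq> A" for T
  proof -
    have w: "symdiff v T \<subseteq> D"
      using T v A by (intro symdiff_subset) auto
    have 1: "symdiff (symdiff v {i}) T = flip i (symdiff v T)" "symdiff (symdiff v {j}) T = flip j (symdiff v T)"
      by (auto simp: flip_def symdiff_def)
    show ?thesis
      using flat_gauge[OF w ij(1,2), of "C {} T" "C {i} T" "C {j} T" "C {i, j} T"] C(1) T
      unfolding F_def 1 by (simp add: insert_commute)
  qed
  moreover have "flat (symdiff v A) i j"
  proof (rule high)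
    show "2 \<le> card ((A \<union> {i, j}) \<inter> A)"
      using A2 by (metis Int_absorb1 Un_upper1 inf_commute)
  qed (use ij in auto)
  ultimately have "flat (symdiff v {}) i j"
    by (metis empty_subsetI order_refl)
  then show ?thesis by simp
qed

text \<open>The two detours around an edge in direction \<open>k\<close> form a hexagon in the 3-cube spanned by
  \<open>j\<close>, \<open>k\<close> and \<open>l\<close>. It bounds the disc made of the four faces that do not contain the edge.\<close>

lemma detours_agree:
  assumes v: "v \<subseteq> D" and D: "j \<in> D" "k \<in> D" "l \<in> D"
    and fl: "flat v j l" "flat (flip j v) k l" "flat (flip l v) j k" "flat (flip k v) j l"
  shows "f v j \<otimes> f (flip j v) k \<otimes> f (flip j (flip k v)) j = f v l \<otimes> f (flip l v) k \<otimes> f (flip l (flip k v)) l"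
proof -
  let ?vj = "flip j v" and ?vk = "flip k v" and ?vl = "flip l v"
  let ?jk = "flip j ?vk" and ?jl = "flip j ?vl" and ?lk = "flip l ?vk"
  have com: "flip k ?vj = ?jk" "flip l ?vj = ?jl" "flip k ?vl = ?lk" "flip l ?jk = flip j ?lk"
    by (simp_all add: flip_commute)
  have s: "?vj \<subseteq> D" "?vk \<subseteq> D" "?vl \<subseteq> D" "?jk \<subseteq> D" "?jl \<subseteq> D" "?lk \<subseteq> D" "flip j ?lk \<subseteq> D"
    using v D by (simp_all add: flip_subset)
  note c = v D s
  have flk: "flat ?lk j l"
    using flat_flip[of ?vk l j] fl(4) c by (simp add: flat_commute)
  have 1: "f v j \<otimes> f ?vj l = f v l \<otimes> f ?vl j"
    using fl(1) by (simp add: flat_def)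
  have 2: "f ?vj k \<otimes> f ?jk l = f ?vj l \<otimes> f ?jl k"
    using fl(2) by (simp add: flat_def com)
  have 3: "f ?vl j \<otimes> f ?jl k = f ?vl k \<otimes> f ?lk j"
    using fl(3) by (simp add: flat_def com)
  have 4: "f ?lk j \<otimes> f (flip j ?lk) l = f ?lk l \<otimes> f ?vk j"
    using flk by (simp add: flat_def)
  have i1: "f ?jk l \<otimes> f (flip j ?lk) l = \<one>"
    using inverse[of ?jk l] c by (simp add: com)
  have i2: "f ?vk j \<otimes> f ?jk j = \<one>"
    using inverse[of ?vk j] c by simp
  have "f v j \<otimes> f ?vj k \<otimes> f ?jk j = f v j \<otimes> f ?vj k \<otimes> (f ?jk l \<otimes> f (flip j ?lk) l) \<otimes> f ?jk j"
    using c i1 by simp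
  also have "\<dots> = f v j \<otimes> (f ?vj k \<otimes> f ?jk l) \<otimes> f (flip j ?lk) l \<otimes> f ?jk j"
    using c by (simp only: m_assoc m_closed closed)
  also have "\<dots> = (f v j \<otimes> f ?vj l) \<otimes> f ?jl k \<otimes> f (flip j ?lk) l \<otimes> f ?jk j"
    unfolding 2 using c by (simp only: m_assoc m_closed closed)
  also have "\<dots> = f v l \<otimes> (f ?vl j \<otimes> f ?jl k) \<otimes> f (flip j ?lk) l \<otimes> f ?jk j"
    unfolding 1 using c by (simp only: m_assoc m_closed closed)
  also have "\<dots> = f v l \<otimes> f ?vl k \<otimes> (f ?lk j \<otimes> f (flip j ?lk) l) \<otimes> f ?jk j"
    unfolding 3 using c by (simp only: m_assoc m_closed closed)
  also have "\<dots> = f v l \<otimes> f ?vl k \<otimes> f ?lk l \<otimes> (f ?vk j \<otimes> f ?jk j)"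
    unfolding 4 using c by (simp only: m_assoc m_closed closed)
  also have "\<dots> = f v l \<otimes> f ?vl k \<otimes> f ?lk l"
    using c i2 by simp
  finally show ?thesis .
qed

text \<open>Give a light edge the value of a detour through a parallel edge. All squares become flat:
  those without light edges are so by hypothesis, and a square with a light edge is flat if that edge
  has the value of the detour through this very square, which is true because all detours agree.
  Therefore the new connection is a coboundary. On a light edge in a flat square, nothing was
  changed.\<close>

theorem gauge_of_sparse_light_edges:
  assumes D: "finite D" "\<And>i. i \<in> D \<Longrightarrow> other i \<in> D \<and> other i \<noteq> i"
    and light_flip: "\<And>v i. light v i \<Longrightarrow> light (flip i v) i"
    and sparse: "\<And>v i j l U x. v \<subseteq> D \<Longrightarrow> {i, j, l} \<subseteq> D \<Longrightarrow> U \<subseteq> {i, j, l} \<Longrightarrow> x \<in> {i, j, l} \<Longrightarrow>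
      light v i \<Longrightarrow> light (symdiff v U) x \<Longrightarrow> x = i \<and> U \<subseteq> {i}"
    and heavy_flat: "\<And>v i j. v \<subseteq> D \<Longrightarrow> i \<in> D \<Longrightarrow> j \<in> D \<Longrightarrow> i \<noteq> j \<Longrightarrow> \<not> light v i \<Longrightarrow> \<not> light v j \<Longrightarrow>
      \<not> light (flip i v) j \<Longrightarrow> \<not> light (flip j v) i \<Longrightarrow> flat v i j"
  shows "\<exists>c. (\<forall>v\<subseteq>D. c v \<in> carrier G) \<and>
    (\<forall>v\<subseteq>D. \<forall>i\<in>D. \<not> light v i \<or> (\<exists>j\<in>D - {i}. flat v i j) \<longrightarrow> c v \<otimes> f v i = c (flip i v))"
proof -
  define det where "det v i j = f v j \<otimes> f (flip j v) i \<otimes> f (flip j (flip i v)) j" for v i j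
  have det_closed: "det v i j \<in> carrier G" if "v \<subseteq> D" "i \<in> D" "j \<in> D" for v i j
    using that by (simp add: det_def flip_subset)
  have flat_det: "flat v i j \<longleftrightarrow> f v i = det v i j" if v: "v \<subseteq> D" "i \<in> D" "j \<in> D" for v i j
  proof -
    have s: "flip i v \<subseteq> D" "flip j v \<subseteq> D" "flip j (flip i v) \<subseteq> D"
      using v by (simp_all add: flip_subset)
    have "f v i \<otimes> f (flip i v) j = f v j \<otimes> f (flip j v) i \<longleftrightarrow>
        f v i \<otimes> f (flip i v) j \<otimes> f (flip j (flip i v)) j = det v i j"
      using v s by (simp add: det_def)
    also have "f v i \<otimes> f (flip i v) j \<otimes> f (flip j (flip i v)) j = f v i"
      using v s inverse[of "flip i v" j] by (simp add: m_assoc)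
    finally show ?thesis
      by (simp add: flat_def)
  qed
  \<comment> \<open>The direction \<open>other i\<close> only has to be the same at both ends of the edge, so that the values of
    its two orientations remain inverse.\<close>
  define f' where "f' v i = (if light v i then det v i (other i) else f v i)" for v i
  have light_iff: "light (flip i v) i \<longleftrightarrow> light v i" for v i
    using light_flip[of v i] light_flip[of "flip i v" i] by auto
  have det_any: "f' v i = det v i j" if v: "v \<subseteq> D" "i \<in> D" "j \<in> D" "j \<noteq> i" and light: "light v i" for v i j
  proof (cases "j = other i")
    case True
    then show ?thesis using light by (simp add: f'_def)
  next
    case False
    let ?l = "other i"
    have l: "?l \<in> D" "?l \<noteq> i"
      using D v by auto
    have nl: "\<not> light (symdiff v U) x" if "U \<subseteq> {i, j, ?l}" "x \<in> {i, j, ?l}" "x \<noteq> i \<or> \<not> U \<subseteq> {i}" for U x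
      using sparse[of v i j ?l U x] that v l light by auto
    have heavy: "flat (symdiff v U) x y"
      if "U \<subseteq> {i, j, ?l}" "x \<in> {i, j, ?l}" "y \<in> {i, j, ?l}" "x \<noteq> y"
        "i \<in> {x, y} \<Longrightarrow> \<not> U \<subseteq> {x, y}" for U x y
    proof (rule heavy_flat)
      show "symdiff v U \<subseteq> D" "x \<in> D" "y \<in> D"
        using v l that by (auto simp: symdiff_def)
      show "\<not> light (symdiff v U) x"
        by (rule nl) (use that in auto)
      show "\<not> light (symdiff v U) y"
        by (rule nl) (use that in auto)
      show "\<not> light (flip x (symdiff v U)) y"
        unfolding flip_sdiff by (rule nl) (use that in \<open>auto simp: flip_def symdiff_def\<close>)
      show "\<not> light (flip y (symdiff v U)) x"
        unfolding flip_sdiff by (rule nl) (use that in \<open>auto simp: flip_def symdiff_def\<close>)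
    qed fact
    have "det v i j = det v i ?l"
      unfolding det_def
    proof (rule detours_agree)
      show "flat v j ?l"
        using heavy[of "{}" j ?l] v l False by auto
      show "flat (flip j v) i ?l"
        using heavy[of "{j}" i ?l] v l False by (auto simp: flip_def)
      show "flat (flip ?l v) j i"
        using heavy[of "{?l}" j i] v l False by (auto simp: flip_def)
      show "flat (flip i v) j ?l"
        using heavy[of "{i}" j ?l] v l False by (auto simp: flip_def)
    qed (use v l in auto)
    then show ?thesis
      using light by (simp add: f'_def)
  qed
  interpret C: cube_connection G D f'
  proof
    fix v i assume v: "v \<subseteq> D" "i \<in> D"
    show "f' v i \<in> carrier G"
      using v D det_closed by (simp add: f'_def)
    show "f' v i \<otimes> f' (flip i v) i = \<one>"
    proof (cases "light v i")
      case True
      let ?j = "other i"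
      have j: "?j \<in> D" using v D by auto
      have s: "flip i v \<subseteq> D" "flip ?j v \<subseteq> D" "flip ?j (flip i v) \<subseteq> D"
        using v j by (simp_all add: flip_subset)
      have "f' v i \<otimes> f' (flip i v) i = det v i ?j \<otimes> det (flip i v) i ?j"
        using True light_iff by (simp add: f'_def)
      also have "\<dots> = f v ?j \<otimes> (f (flip ?j v) i \<otimes> ((f (flip ?j (flip i v)) ?j \<otimes> f (flip i v) ?j) \<otimes>
          f (flip ?j (flip i v)) i)) \<otimes> f (flip ?j v) ?j"
        unfolding det_def using v j s by (simp add: m_assoc)
      also have "\<dots> = f v ?j \<otimes> (f (flip ?j v) i \<otimes> f (flip ?j (flip i v)) i) \<otimes> f (flip ?j v) ?j"
        using v j s inverse[of "flip ?j (flip i v)" ?j] by simp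
      also have "\<dots> = \<one>"
        using v j s inverse[of "flip ?j v" i] inverse[of v ?j] by (simp add: flip_commute)
      finally show ?thesis .
    next
      case False
      then show ?thesis
        using light_iff v inverse by (simp add: f'_def)
    qed
  qed
  have light_case: "C.flat v i j"
    if v: "v \<subseteq> D" "i \<in> D" "j \<in> D" "i \<noteq> j" and light: "light v i" for v i j
  proof -
    have s: "flip i v \<subseteq> D" "flip j v \<subseteq> D" "flip j (flip i v) \<subseteq> D"
      using v by (simp_all add: flip_subset)
    have nl: "\<not> light (symdiff v U) x" if "U \<subseteq> {i, j}" "x \<in> {i, j}" "x \<noteq> i \<or> \<not> U \<subseteq> {i}" for U x
      using sparse[of v i j j U x] that v light by auto
    have "f' v j = f v j" "f' (flip j v) i = f (flip j v) i" "f' (flip i v) j = f (flip i v) j"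
      using nl[of "{}" j] nl[of "{j}" i] nl[of "{i}" j] v by (auto simp: f'_def flip_def)
    then have "f' v i \<otimes> f' (flip i v) j = f v j \<otimes> f (flip j v) i \<otimes> (f (flip j (flip i v)) j \<otimes> f (flip i v) j)"
      using det_any[of v i j] v light s by (simp add: det_def m_assoc)
    also have "f (flip j (flip i v)) j \<otimes> f (flip i v) j = \<one>"
      using inverse[of "flip j (flip i v)" j] v s by simp
    finally show ?thesis
      using \<open>f' v j = f v j\<close> \<open>f' (flip j v) i = f (flip j v) i\<close> v s by (simp add: C.flat_def)
  qed
  have flat': "C.flat v i j" if v: "v \<subseteq> D" "i \<in> D" "j \<in> D" for v i j
  proof (cases "i = j")
    case False
    have s: "flip i v \<subseteq> D" "flip j v \<subseteq> D"
      using v by (simp_all add: flip_subset)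
    consider "light v i" | "light v j" | "light (flip j v) i" | "light (flip i v) j"
      | "\<not> light v i" "\<not> light v j" "\<not> light (flip i v) j" "\<not> light (flip j v) i"
      by blast
    then show ?thesis
    proof cases
      case 1
      then show ?thesis using light_case v False by blast
    next
      case 2
      then show ?thesis using light_case v False C.flat_commute by metis
    next
      case 3
      then have "C.flat (flip j v) i j" using light_case v s False by blast
      then show ?thesis
        using C.flat_flip[of "flip j v" j i] v s by (simp add: C.flat_commute)
    next
      case 4
      then have "C.flat (flip i v) j i" using light_case v s False by blast
      then show ?thesis
        using C.flat_flip[of "flip i v" i j] v s by (simp add: C.flat_commute)
    next
      case 5
      then have "flat v i j"
        using heavy_flat v False by blast
      then show ?thesis
        using 5 by (simp add: flat_def C.flat_def f'_def)
    qed
  qed (simp add: C.flat_refl)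
  have "\<exists>c. (\<forall>v\<subseteq>D. c v \<in> carrier G) \<and> (\<forall>v\<subseteq>D. \<forall>i\<in>D. c v \<otimes> f' (symdiff {} v) i = c (flip i v))"
    by (rule C.flat_imp_coboundary) (use D flat' in auto)
  then obtain c where c: "\<forall>v\<subseteq>D. c v \<in> carrier G" "\<forall>v\<subseteq>D. \<forall>i\<in>D. c v \<otimes> f' v i = c (flip i v)"
    by auto
  have "f' v i = f v i" if "v \<subseteq> D" "i \<in> D" "\<not> light v i \<or> (\<exists>j\<in>D - {i}. flat v i j)" for v i
    using that
  proof (cases "light v i")
    case True
    then obtain j where "j \<in> D" "j \<noteq> i" "flat v i j"
      using \<open>\<not> light v i \<or> (\<exists>j\<in>D - {i}. flat v i j)\<close> by blast
    then show ?thesis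
      using det_any[of v i j] flat_det[of v i j] that True by simp
  qed (simp add: f'_def)
  then show ?thesis
    using c by metis
qed

end

section \<open>Words in free groups\<close>

lemma reduced_word_butlast: "reduced_word (w @ [x]) \<Longrightarrow> reduced_word w"
  by (simp add: reduced_word_def successively_append_iff)

lemma free_group_snoc:
  assumes "w @ [x] \<in> carrier (free_group S)"
  shows "w \<in> carrier (free_group S)" "snd x \<in> S" "w @ [x] = w \<otimes>\<^bsub>free_group S\<^esub> [x]"
proof -
  have r: "reduced_word (w @ [x])"
    using assms by (simp add: free_group_def)
  show "w \<in> carrier (free_group S)" "snd x \<in> S"
    using assms reduced_word_butlast[OF r] by (auto simp: free_group_def)
  show "w @ [x] = w \<otimes>\<^bsub>free_group S\<^esub> [x]"
    using foldr_cons_reduce_Nil[OF r] by (simp add: free_group_def)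
qed

text \<open>Multiplying out a word is unaffected by the cancellation in \<open>cons_reduce\<close>.\<close>

lemma (in group) free_group_universal:
  fixes \<kappa> :: "'s \<Rightarrow> 'a"
  assumes \<kappa>: "\<And>s. s \<in> S \<Longrightarrow> \<kappa> s \<in> carrier G"
  obtains \<Psi> where "\<Psi> \<in> hom (free_group S) G" "\<Psi> [] = \<one>"
    "\<And>s. s \<in> S \<Longrightarrow> \<Psi> [(True, s)] = \<kappa> s" "\<And>s. s \<in> S \<Longrightarrow> \<Psi> [(False, s)] = inv (\<kappa> s)"
proof -
  define lt where "lt x = (if fst x then \<kappa> (snd x) else inv (\<kappa> (snd x)))" for x :: "bool \<times> 's"
  define \<Psi> where "\<Psi> w = foldr (\<lambda>x y. lt x \<otimes> y) w \<one>" for w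
  have lt: "lt x \<in> carrier G" "lt x \<otimes> lt (letter_inv x) = \<one>" if "snd x \<in> S" for x
    using \<kappa>[OF that] by (auto simp: lt_def letter_inv_def)
  have closed: "\<Psi> w \<in> carrier G" if "snd ` set w \<subseteq> S" for w
    using that by (induction w) (auto simp: \<Psi>_def lt)
  have cons: "\<Psi> (cons_reduce x w) = lt x \<otimes> \<Psi> w" if "snd x \<in> S" "snd ` set w \<subseteq> S" for x w
  proof (cases w)
    case (Cons y v)
    have "lt x \<otimes> (lt (letter_inv x) \<otimes> \<Psi> v) = \<Psi> v"
      using lt[OF that(1)] lt(1)[of "letter_inv x"] that closed[of v] Cons
      by (simp flip: m_assoc)
    then show ?thesis
      using Cons by (auto simp: \<Psi>_def)
  qed (simp add: \<Psi>_def)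
  have mult: "\<Psi> (foldr cons_reduce u v) = \<Psi> u \<otimes> \<Psi> v"
    if "snd ` set u \<subseteq> S" "snd ` set v \<subseteq> S" for u v
    using that(1)
  proof (induction u)
    case Nil
    then show ?case using closed[OF that(2)] by (simp add: \<Psi>_def)
  next
    case (Cons x u)
    have "snd ` set (foldr cons_reduce u v) \<subseteq> S"
      using set_foldr[of u v] Cons.prems that(2) by fastforce
    then have "\<Psi> (foldr cons_reduce (x # u) v) = lt x \<otimes> (\<Psi> u \<otimes> \<Psi> v)"
      using Cons by (simp add: cons)
    also have "\<dots> = \<Psi> (x # u) \<otimes> \<Psi> v"
      using Cons.prems lt closed[of u] closed[OF that(2)] by (simp add: \<Psi>_def m_assoc)
    finally show ?case .
  qed
  show ?thesis
  proof
    show "\<Psi> \<in> hom (free_group S) G"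
      by (rule homI) (auto simp: free_group_def closed mult)
    show "\<Psi> [(True, s)] = \<kappa> s" "\<Psi> [(False, s)] = inv (\<kappa> s)" if "s \<in> S" for s
      using \<kappa>[OF that] by (simp_all add: \<Psi>_def lt_def)
  qed (simp add: \<Psi>_def)
qed

section \<open>Faces and vertex stars of the cube\<close>

definition vertex :: "nat set \<Rightarrow> nat \<Rightarrow> real" where
  "vertex v k = of_bool (k \<in> v)"

text \<open>The face through the vertex \<open>v\<close> with free directions \<open>S\<close>. Any vertex of the face may serve as
  \<open>v\<close>, since membership in \<open>v\<close> matters outside \<open>S\<close> only.\<close>

definition face :: "nat set \<Rightarrow> nat set \<Rightarrow> (nat \<Rightarrow> real) set" where
  "face v S = {x. \<forall>k. if k \<in> S then 0 \<le> x k \<and> x k \<le> 1 else x k = vertex v k}"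

definition center :: "nat set \<Rightarrow> nat set \<Rightarrow> nat \<Rightarrow> real" where
  "center v S k = (if k \<in> S then 1 / 2 else vertex v k)"

lemma vertex_in_face: "vertex u \<in> face v S \<longleftrightarrow> symdiff u v \<subseteq> S"
  by (auto simp: vertex_def face_def symdiff_def split: if_splits)

lemma center_in_face: "center v S \<in> face v S"
  by (auto simp: face_def center_def)

lemma face_mono:
  assumes "S \<subseteq> T" "symdiff u v \<subseteq> T"
  shows "face u S \<subseteq> face v T"
proof
  fix x assume x: "x \<in> face u S"
  have "if k \<in> T then 0 \<le> x k \<and> x k \<le> 1 else x k = vertex v k" for k
  proof -
    have "k \<in> u \<longleftrightarrow> k \<in> v" if "k \<notin> T"
      using assms(2) that by (auto simp: symdiff_def)
    moreover have "if k \<in> S then 0 \<le> x k \<and> x k \<le> 1 else x k = vertex u k"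
      using x by (auto simp: face_def)
    ultimately show ?thesis
      using assms(1) by (auto simp: vertex_def split: if_splits)
  qed
  then show "x \<in> face v T"
    by (simp add: face_def)
qed

lemma face_subset_iff: "face u S \<subseteq> face v T \<longleftrightarrow> S \<subseteq> T \<and> symdiff u v \<subseteq> T"
proof
  assume sub: "face u S \<subseteq> face v T"
  have "vertex u \<in> face v T"
    using sub vertex_in_face[of u u S] by auto
  moreover have "S \<subseteq> T"
  proof
    fix k assume k: "k \<in> S"
    have "center u S \<in> face v T"
      using sub center_in_face by blast
    then have "if k \<in> T then 0 \<le> center u S k \<and> center u S k \<le> 1 else center u S k = vertex v k"
      by (simp add: face_def)
    then show "k \<in> T"
      using k by (auto simp: center_def vertex_def of_bool_def split: if_splits)
  qed
  ultimately show "S \<subseteq> T \<and> symdiff u v \<subseteq> T"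
    by (simp add: vertex_in_face)
qed (simp add: face_mono)

lemma face_eq_iff: "face u S = face v T \<longleftrightarrow> S = T \<and> symdiff u v \<subseteq> T"
  using face_subset_iff[of u S v T] face_subset_iff[of v T u S] symdiff_commute[of u v] by auto

lemma unit_interval_not_singleton: "{0..1} \<noteq> {a::real}"
proof
  assume eq: "{0..1} = {a}"
  have "0 \<in> {a}" "1 \<in> {a}"
    unfolding eq[symmetric] by auto
  then show False
    by simp
qed

lemma cube_faces_eq:
  "cube_faces n k = {face v S | v S. v \<subseteq> {..<n} \<and> S \<subseteq> {..<n} \<and> card S = k}"
proof (intro equalityI subsetI)
  fix F assume "F \<in> cube_faces n k"
  then obtain I where F: "F = Pi UNIV I" and I: "\<forall>i<n. I i \<in> {{0}, {1}, {0..1::real}}"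
    "\<forall>i\<ge>n. I i = {0}" "card {i. I i = {0..1}} = k"
    unfolding cube_faces_def by blast
  have ne: "{0..1} \<noteq> {0::real}" "{0..1} \<noteq> {1::real}" "{0} \<noteq> {1::real}"
    using unit_interval_not_singleton by auto
  let ?v = "{i. I i = {1}}" and ?S = "{i. I i = {0..1}}"
  have Ik: "I i = (if i \<in> ?S then {0..1} else {vertex ?v i})" for i
    using I(1)[rule_format, of i] I(2)[rule_format, of i] ne by (cases "i < n") (auto simp: vertex_def)
  have "(x i \<in> I i) \<longleftrightarrow> (if i \<in> ?S then 0 \<le> x i \<and> x i \<le> 1 else x i = vertex ?v i)" for x :: "nat \<Rightarrow> real" and i
    using Ik[of i] by (cases "i \<in> ?S") simp_all
  moreover have "F = {x. \<forall>i. x i \<in> I i}"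
    by (simp add: F Pi_def)
  ultimately have "F = face ?v ?S"
    unfolding face_def by simp
  moreover have "?v \<subseteq> {..<n}" "?S \<subseteq> {..<n}"
    using I(2) ne by (force simp: not_less[symmetric])+
  ultimately show "F \<in> {face v S | v S. v \<subseteq> {..<n} \<and> S \<subseteq> {..<n} \<and> card S = k}"
    using I(3) by blast
next
  fix F assume "F \<in> {face v S | v S. v \<subseteq> {..<n} \<and> S \<subseteq> {..<n} \<and> card S = k}"
  then obtain v S where F: "F = face v S" and vS: "v \<subseteq> {..<n}" "S \<subseteq> {..<n}" "card S = k"
    by blast
  define I where "I i = (if i \<in> S then {0..1} else {vertex v i})" for i
  note ne = unit_interval_not_singleton
  have "F = Pi UNIV I"
    unfolding F face_def Pi_def I_def by (auto split: if_splits)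
  moreover have "{i. I i = {0..1}} = S"
    using ne ne[symmetric] by (auto simp: I_def)
  moreover have "\<forall>i<n. I i \<in> {{0}, {1}, {0..1}}" "\<forall>i\<ge>n. I i = {0}"
    using vS by (auto simp: I_def vertex_def)
  ultimately show "F \<in> cube_faces n k"
    unfolding cube_faces_def using vS(3) by blast
qed

lemma face_in_cube_faces:
  assumes "v \<subseteq> {..<n}" "S \<subseteq> {..<n}"
  shows "face v S \<in> cube_faces n k \<longleftrightarrow> card S = k"
proof
  assume "card S = k"
  then show "face v S \<in> cube_faces n k"
    using assms unfolding cube_faces_eq by blast
qed (auto simp: cube_faces_eq face_eq_iff)

locale cubical_complex =
  fixes n :: nat and X :: "(nat \<Rightarrow> real) set \<Rightarrow> bool"
begin

definition Q :: "(nat \<Rightarrow> real) set set" where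
  "Q = cube_skeleton n 1 \<union> {f \<in> cube_faces n 2. X f}"

lemma in_Q_iff:
  assumes "v \<subseteq> {..<n}" "S \<subseteq> {..<n}"
  shows "face v S \<in> Q \<longleftrightarrow> card S \<le> 1 \<or> card S = 2 \<and> X (face v S)"
  using face_in_cube_faces[OF assms] by (auto simp: Q_def cube_skeleton_def)

lemma Q_cases:
  assumes "F \<in> Q"
  obtains v S where "F = face v S" "v \<subseteq> {..<n}" "S \<subseteq> {..<n}" "card S \<le> 2"
  using assms that unfolding Q_def cube_skeleton_def cube_faces_eq by force

lemma maximal_edge_iff:
  assumes "v \<subseteq> {..<n}" "S \<subseteq> {..<n}"
  shows "face v S \<in> maximal_edges n Q \<longleftrightarrow>
    (\<exists>i. S = {i} \<and> (\<forall>j. j < n \<longrightarrow> j \<noteq> i \<longrightarrow> \<not> X (face v {i, j})))"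
proof
  assume max: "face v S \<in> maximal_edges n Q"
  then have "card S = 1"
    using face_in_cube_faces[OF assms] by (auto simp: maximal_edges_def)
  then obtain i where i: "S = {i}"
    by (auto simp: card_1_singleton_iff)
  have "\<not> X (face v {i, j})" if "j < n" "j \<noteq> i" for j
  proof
    assume X: "X (face v {i, j})"
    have ij: "{i, j} \<subseteq> {..<n}" "card {i, j} = 2"
      using that assms i by auto
    have "face v {i, j} \<in> Q \<inter> cube_faces n 2"
      using in_Q_iff[OF assms(1) ij(1)] face_in_cube_faces[OF assms(1) ij(1)] X ij by auto
    moreover have "face v S \<subseteq> face v {i, j}"
      by (simp add: face_subset_iff i)
    ultimately show False
      using max by (auto simp: maximal_edges_def)
  qed
  then show "\<exists>i. S = {i} \<and> (\<forall>j. j < n \<longrightarrow> j \<noteq> i \<longrightarrow> \<not> X (face v {i, j}))"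
    using i by blast
next
  assume "\<exists>i. S = {i} \<and> (\<forall>j. j < n \<longrightarrow> j \<noteq> i \<longrightarrow> \<not> X (face v {i, j}))"
  then obtain i where i: "S = {i}" and no: "\<And>j. j < n \<Longrightarrow> j \<noteq> i \<Longrightarrow> \<not> X (face v {i, j})"
    by blast
  have "face v S \<in> Q \<inter> cube_faces n 1"
    using in_Q_iff[OF assms] face_in_cube_faces[OF assms] i by auto
  moreover have False if F: "F \<in> Q" "F \<in> cube_faces n 2" "face v S \<subseteq> F" for F
  proof -
    obtain u T where T: "F = face u T" "u \<subseteq> {..<n}" "T \<subseteq> {..<n}" "card T = 2"
      using F(2) unfolding cube_faces_eq by blast
    have sub: "i \<in> T" "symdiff v u \<subseteq> T"
      using F(3) T(1) i by (auto simp: face_subset_iff)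
    obtain j where j: "T = {i, j}" "j \<noteq> i"
      using sub(1) T(4) by (metis card_2_iff doubleton_eq_iff insertE singletonD)
    have "F = face v {i, j}"
      using T(1) sub(2) j by (simp add: face_eq_iff symdiff_commute)
    then show False
      using no[of j] j T in_Q_iff[OF T(2,3)] F(1) by auto
  qed
  ultimately show "face v S \<in> maximal_edges n Q"
    by (auto simp: maximal_edges_def)
qed

text \<open>The open star of a vertex: if a point of a face differs from \<open>v\<close> by less than 1 in every
  coordinate, then \<open>v\<close> is a vertex of that face (\<open>face_vertex\<close>).\<close>

definition star :: "nat set \<Rightarrow> (nat \<Rightarrow> real) set" where
  "star v = {x \<in> \<Union>Q. \<forall>k. \<bar>x k - vertex v k\<bar> < 1}"

lemma star_face:
  assumes "x \<in> star v"
  obtains u S where "x \<in> face u S" "face u S \<in> Q" "u \<subseteq> {..<n}" "S \<subseteq> {..<n}" "card S \<le> 2"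
proof -
  obtain F where F: "x \<in> F" "F \<in> Q"
    using assms by (auto simp: star_def)
  from F(2) show ?thesis
    by (rule Q_cases) (use F in \<open>auto intro: that\<close>)
qed

lemma face_vertex:
  assumes "x \<in> star v" "x \<in> face u S"
  shows "symdiff v u \<subseteq> S"
proof
  fix k assume k: "k \<in> symdiff v u"
  have "\<bar>x k - vertex v k\<bar> < 1" "if k \<in> S then 0 \<le> x k \<and> x k \<le> 1 else x k = vertex u k"
    using assms by (auto simp: star_def face_def)
  then show "k \<in> S"
    using k by (auto simp: vertex_def symdiff_def split: if_splits)
qed

lemma star_vertex_subset:
  assumes "x \<in> star v"
  shows "v \<subseteq> {..<n}"
proof -
  obtain u S where u: "x \<in> face u S" "u \<subseteq> {..<n}" "S \<subseteq> {..<n}"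
    using star_face[OF assms] by metis
  then show ?thesis
    using face_vertex[OF assms u(1)] unfolding symdiff_def by blast
qed

lemma in_star_center:
  assumes "face u S \<in> Q" "symdiff v u \<subseteq> S"
  shows "center u S \<in> star v"
proof -
  have "\<bar>center u S k - vertex v k\<bar> < 1" for k
    using assms(2) by (auto simp: center_def vertex_def symdiff_def)
  then show ?thesis
    using assms(1) center_in_face[of u S] by (auto simp: star_def)
qed

lemma face_convex:
  assumes "x \<in> face u S" "y \<in> face u S" "0 \<le> t" "t \<le> 1"
  shows "(\<lambda>k. (1 - t) * x k + t * y k) \<in> face u S"
proof -
  have "if k \<in> S then 0 \<le> (1 - t) * x k + t * y k \<and> (1 - t) * x k + t * y k \<le> 1
      else (1 - t) * x k + t * y k = vertex u k" for k
  proof -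
    have "if k \<in> S then 0 \<le> x k \<and> x k \<le> 1 else x k = vertex u k"
      "if k \<in> S then 0 \<le> y k \<and> y k \<le> 1 else y k = vertex u k"
      using assms(1,2) by (auto simp: face_def)
    moreover have "0 \<le> (1 - t) * x k + t * y k" if "0 \<le> x k" "0 \<le> y k"
      using that assms(3,4) by simp
    moreover have "(1 - t) * x k + t * y k \<le> 1" if "x k \<le> 1" "y k \<le> 1"
      using convex_bound_le[of "x k" 1 "y k" "1 - t" t] that assms(3,4) by simp
    moreover have "(1 - t) * c + t * c = c" for c
      by (simp add: left_diff_distrib)
    ultimately show ?thesis
      by (cases "k \<in> S") simp_all
  qed
  then show ?thesis
    by (simp add: face_def)
qed

lemma star_convex_combination:
  assumes x: "x \<in> star v" and y: "\<And>u S. x \<in> face u S \<Longrightarrow> face u S \<in> Q \<Longrightarrow> y \<in> face u S"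
    and yv: "\<And>k. \<bar>y k - vertex v k\<bar> < 1" and t: "0 \<le> t" "t \<le> 1"
  shows "(\<lambda>k. (1 - t) * x k + t * y k) \<in> star v"
proof -
  obtain u S where u: "x \<in> face u S" "face u S \<in> Q"
    using x star_face by metis
  then have "(\<lambda>k. (1 - t) * x k + t * y k) \<in> \<Union>Q"
    using face_convex[OF u(1) y[OF u] t] by blast
  moreover have "\<bar>(1 - t) * x k + t * y k - vertex v k\<bar> < 1" for k
  proof -
    have xk: "\<bar>x k - vertex v k\<bar> < 1"
      using x by (simp add: star_def)
    have "(1 - t) * x k + t * y k - vertex v k = (1 - t) * (x k - vertex v k) + t * (y k - vertex v k)"
      by (simp add: algebra_simps)
    also have "\<bar>\<dots>\<bar> \<le> (1 - t) * \<bar>x k - vertex v k\<bar> + t * \<bar>y k - vertex v k\<bar>"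
      using t by (intro order_trans[OF abs_triangle_ineq]) (simp add: abs_mult)
    also have "\<dots> < 1"
      using convex_bound_lt[OF xk yv[of k], of "1 - t" t] t by simp
    finally show ?thesis .
  qed
  ultimately show ?thesis
    by (simp add: star_def)
qed

lemma star_contract:
  assumes "x \<in> star v" "0 \<le> t" "t \<le> 1"
  shows "(\<lambda>k. (1 - t) * x k + t * vertex v k) \<in> star v"
  using assms face_vertex[OF assms(1)]
  by (intro star_convex_combination) (auto simp: vertex_in_face)

text \<open>Both paths are homotopic to the path \<open>r\<close> that goes straight from \<open>a\<close> to the vertex, rests
  there, and goes straight to \<open>b\<close>. The homotopy does two things at once. The factor \<open>mu\<close> contracts
  the path towards the vertex, fully in the middle third of the time and not at all at the ends;
  the reparametrization \<open>chi\<close> keeps the original path at \<open>a\<close> during the first third and at \<open>b\<close>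
  during the last third.\<close>

lemma stars_homotopic:
  assumes p: "p \<in> path_from_to (star v) a b" and q: "q \<in> path_from_to (star v) a b"
  shows "homotopic_paths (\<Union>Q) p q"
proof -
  define mu where "mu t = min 1 (min (3 * t) (3 * (1 - t)))" for t :: real
  define chi where "chi t = max 0 (min 1 (3 * t - 1))" for t :: real
  define r where "r t = (\<lambda>k. (1 - mu t) * (if t \<le> 1 / 2 then a k else b k) + mu t * vertex v k)" for t
  have "homotopic_paths (\<Union>Q) p r" if p: "p \<in> path_from_to (star v) a b" for p
  proof -
    have pc: "continuous_on {0..1} p" and ps: "\<And>t. t \<in> {0..1} \<Longrightarrow> p t \<in> star v" and p01: "p 0 = a" "p 1 = b"
      using p by (auto simp: path_from_to_def path_def path_image_def pathstart_def pathfinish_def)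
    define rho where "rho z = (1 - fst z) * snd z + fst z * chi (snd z)" for z :: "real \<times> real"
    define h where "h z = (\<lambda>k. (1 - fst z * mu (snd z)) * p (rho z) k + fst z * mu (snd z) * vertex v k)"
      for z :: "real \<times> real"
    have mu: "0 \<le> mu t" "mu t \<le> 1" if "t \<in> {0..1}" for t
      using that by (auto simp: mu_def)
    have chi: "0 \<le> chi t" "chi t \<le> 1" for t
      by (auto simp: chi_def)
    have rho: "rho z \<in> {0..1}" if "z \<in> {0..1} \<times> {0..1}" for z
      using that chi[of "snd z"] convex_bound_le[of "snd z" 1 "chi (snd z)" "1 - fst z" "fst z"]
      by (auto simp: rho_def)
    have "continuous_on ({0..1} \<times> {0..1}) h"
    proof (rule continuous_on_coordinatewise_then_product)
      fix k
      have "continuous_on {0..1} (\<lambda>t. p t k)"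
        using continuous_on_product_then_coordinatewise[OF pc] .
      moreover have "continuous_on ({0..1} \<times> {0..1}) rho"
        unfolding rho_def chi_def by (intro continuous_intros)
      ultimately have "continuous_on ({0..1} \<times> {0..1}) (\<lambda>z. p (rho z) k)"
        by (rule continuous_on_compose2) (use rho in auto)
      then show "continuous_on ({0..1} \<times> {0..1}) (\<lambda>z. h z k)"
        unfolding h_def mu_def by (intro continuous_intros)
    qed
    moreover have "h z \<in> \<Union>Q" if z: "z \<in> {0..1} \<times> {0..1}" for z
    proof -
      have "fst z * mu (snd z) \<le> 1"
        using z mu[of "snd z"] by (intro mult_le_one) auto
      then have "h z \<in> star v"
        unfolding h_def using z mu[of "snd z"] by (intro star_contract ps rho) auto
      then show ?thesis
        by (simp add: star_def)
    qed
    moreover have "h (0, t) = p t" for t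
      by (simp add: h_def rho_def)
    moreover have "h (1, t) = r t" if "t \<in> {0..1}" for t
    proof -
      consider "t \<le> 1 / 3" | "1 / 3 \<le> t" "t \<le> 2 / 3" | "2 / 3 \<le> t"
        by linarith
      then show ?thesis
      proof cases
        case 1
        then have "chi t = 0" by (simp add: chi_def)
        then show ?thesis using 1 p01 by (simp add: h_def rho_def r_def)
      next
        case 2
        then have "mu t = 1" by (simp add: mu_def)
        then show ?thesis by (simp add: h_def rho_def r_def)
      next
        case 3
        then have "chi t = 1" by (simp add: chi_def)
        then show ?thesis using 3 p01 by (simp add: h_def rho_def r_def)
      qed
    qed
    moreover have "h (s, 0) = p 0" "h (s, 1) = p 1" for s
      by (simp_all add: h_def rho_def mu_def chi_def)
    ultimately show ?thesis
      unfolding homotopic_paths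
      by (intro exI[of _ h]) (auto simp: pathstart_def pathfinish_def)
  qed
  then show ?thesis
    using p q homotopic_paths_sym homotopic_paths_trans by blast
qed

text \<open>The intersection is star-shaped around the midpoint of the two vertices, since every face
  that meets it contains both of them.\<close>

lemma star_meet_path:
  assumes a: "a \<in> star u \<inter> star v" and b: "b \<in> star u \<inter> star v"
  shows "path_from_to (star u \<inter> star v) a b \<noteq> {}"
proof -
  define m where "m k = (1 - 1 / 2) * vertex u k + 1 / 2 * vertex v k" for k
  define seg where "seg c t = (\<lambda>k. (1 - t) * c k + t * m k)" for c and t :: real
  have seg: "seg c \<in> path_from_to (star u \<inter> star v) c m" if c: "c \<in> star u \<inter> star v" for c
  proof -
    have "m \<in> face w S" if "c \<in> face w S" for w S
      unfolding m_def using that c by (intro face_convex) (auto simp: vertex_in_face dest: face_vertex)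
    moreover have "\<bar>m k - vertex u k\<bar> < 1" "\<bar>m k - vertex v k\<bar> < 1" for k
      by (auto simp: m_def vertex_def)
    ultimately have "seg c t \<in> star u \<inter> star v" if "t \<in> {0..1}" for t
      unfolding seg_def using c that by (auto intro!: star_convex_combination)
    moreover have "path (seg c)"
      unfolding path_def seg_def by (intro continuous_on_coordinatewise_then_product continuous_intros)
    ultimately show ?thesis
      by (auto simp: path_from_to_def path_image_def pathstart_def pathfinish_def seg_def)
  qed
  from path_from_to_join[OF seg[OF a] path_from_to_reverse[OF seg[OF b]]] show ?thesis
    by blast
qed

sublocale good_cover "\<Union>Q" star
proof
  fix v
  show "openin (top_of_set (\<Union>Q)) (star v)"
  proof (cases "v \<subseteq> {..<n}")
    case True
    have x0: "x k = 0" if x: "x \<in> \<Union>Q" and k: "k \<ge> n" for x k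
    proof -
      obtain F where F: "F \<in> Q" "x \<in> F"
        using x by blast
      obtain u S where u: "F = face u S" "u \<subseteq> {..<n}" "S \<subseteq> {..<n}"
        using Q_cases[OF F(1)] by metis
      then have "k \<notin> S" "k \<notin> u"
        using k by auto
      moreover have "if k \<in> S then 0 \<le> x k \<and> x k \<le> 1 else x k = vertex u k"
        using F(2) u(1) by (simp add: face_def)
      ultimately show ?thesis
        by (simp add: vertex_def)
    qed
    have v0: "vertex v k = 0" if "k \<ge> n" for k
      using that True by (auto simp: vertex_def)
    have far: "\<bar>x k - vertex v k\<bar> < 1" if "x \<in> \<Union>Q" "k \<ge> n" for x k
      using x0[OF that] v0[OF that(2)] by simp
    have "star v = \<Union>Q \<inter> (\<Inter>k<n. {x. \<bar>x k - vertex v k\<bar> < 1})"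
    proof (intro equalityI subsetI)
      fix x assume x: "x \<in> \<Union>Q \<inter> (\<Inter>k<n. {x. \<bar>x k - vertex v k\<bar> < 1})"
      then have "\<bar>x k - vertex v k\<bar> < 1" for k
        using far[of x k] by (cases "k < n") auto
      then show "x \<in> star v"
        using x by (simp add: star_def)
    qed (simp add: star_def)
    moreover have "open {x :: nat \<Rightarrow> real. \<bar>x k - vertex v k\<bar> < 1}" for k
      by (intro open_Collect_less continuous_intros continuous_on_product_coordinates)
    ultimately show ?thesis
      by (simp add: openin_open_Int open_INT)
  next
    case False
    then have "star v = {}"
      using star_vertex_subset by blast
    then show ?thesis
      by simp
  qed
next
  fix a assume a: "a \<in> \<Union>Q"
  define v where "v = {k. a k \<ge> 1 / 2}"
  obtain F where F: "F \<in> Q" "a \<in> F"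
    using a by blast
  obtain u S where u: "F = face u S"
    using Q_cases[OF F(1)] by metis
  have "\<bar>a k - vertex v k\<bar> < 1" for k
  proof -
    have "if k \<in> S then 0 \<le> a k \<and> a k \<le> 1 else a k = vertex u k"
      using F(2) u by (simp add: face_def)
    then show ?thesis
      by (auto simp: v_def vertex_def split: if_splits)
  qed
  then show "\<exists>v. a \<in> star v"
    using a by (auto simp: star_def)
qed (use stars_homotopic star_meet_path in auto)

section \<open>Complexes whose light edges are sparse\<close>

definition edge_degree :: "nat set \<Rightarrow> nat \<Rightarrow> nat" where
  "edge_degree v i = card {j \<in> {..<n} - {i}. X (face v {i, j})}"

text \<open>The box of \<open>flat_by_filling\<close>: the squares that extend or are displaced in at least two of the
  new directions \<open>A\<close>, and one square at each edge of the given square.\<close>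

definition square_fillable :: "nat set \<Rightarrow> nat \<Rightarrow> nat \<Rightarrow> bool" where
  "square_fillable v i j \<longleftrightarrow> (\<exists>A a b c d. A \<subseteq> {..<n} - {i, j} \<and> 2 \<le> card A \<and> {a, b, c, d} \<subseteq> A \<and>
     X (face v {i, a}) \<and> X (face v {j, b}) \<and> X (face (flip j v) {i, c}) \<and> X (face (flip i v) {j, d}) \<and>
     (\<forall>U k l. U \<subseteq> A \<union> {i, j} \<longrightarrow> k \<in> A \<union> {i, j} \<longrightarrow> l \<in> A \<union> {i, j} \<longrightarrow> k \<noteq> l \<longrightarrow>
        2 \<le> card ((U \<union> {k, l}) \<inter> A) \<longrightarrow> X (face (symdiff v U) {k, l})))"

lemma face_flip: "i \<in> S \<Longrightarrow> face (flip i v) S = face v S"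
  by (auto simp: face_eq_iff flip_def symdiff_def)

lemma stars_meet:
  assumes "face z S \<in> Q" "symdiff u z \<subseteq> S" "symdiff v z \<subseteq> S" "symdiff w z \<subseteq> S"
  shows "star u \<inter> star v \<inter> star w \<noteq> {}"
  using assms in_star_center by blast

lemma triple_meet:
  assumes "star u \<inter> star v \<inter> star w \<noteq> {}"
  obtains z S where "face z S \<in> Q" "z \<subseteq> {..<n}" "S \<subseteq> {..<n}" "card S \<le> 2"
    "symdiff u z \<subseteq> S" "symdiff v z \<subseteq> S" "symdiff w z \<subseteq> S"
proof -
  obtain x where x: "x \<in> star u" "x \<in> star v" "x \<in> star w"
    using assms by blast
  obtain z S where "x \<in> face z S" "face z S \<in> Q" "z \<subseteq> {..<n}" "S \<subseteq> {..<n}" "card S \<le> 2"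
    using star_face[OF x(1)] by metis
  then show ?thesis
    using that face_vertex x by metis
qed

text \<open>The open stars of the vertices form a good cover, and they meet exactly if the vertices have a
  common face in \<open>Q\<close>. The cocycle \<open>g\<close> has a letter for each maximal edge and is trivial on all other
  pairs. It is a cocycle because three vertices of a common face either lie in a square, which has no
  maximal edge, or repeat. Every cocycle \<open>f\<close> restricts to a connection on the cube that is flat on
  the present squares, and a gauge that trivializes it off the maximal edges exhibits \<open>f\<close> as an
  image of \<open>g\<close>. Edges of degree at most \<open>K\<close> are the light ones.\<close>

theorem fundamental_group_of_sparse_complex:
  assumes n: "n \<ge> 2"
    and sparse: "\<And>v i j l U x. v \<subseteq> {..<n} \<Longrightarrow> {i, j, l} \<subseteq> {..<n} \<Longrightarrow> U \<subseteq> {i, j, l} \<Longrightarrow> x \<in> {i, j, l} \<Longrightarrow>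
      edge_degree v i \<le> K \<Longrightarrow> edge_degree (symdiff v U) x \<le> K \<Longrightarrow> x = i \<and> U \<subseteq> {i}"
    and fillable: "\<And>v i j. v \<subseteq> {..<n} \<Longrightarrow> i < n \<Longrightarrow> j < n \<Longrightarrow> i \<noteq> j \<Longrightarrow>
      K < edge_degree v i \<Longrightarrow> K < edge_degree v j \<Longrightarrow>
      K < edge_degree (flip i v) j \<Longrightarrow> K < edge_degree (flip j v) i \<Longrightarrow> square_fillable v i j"
    and x: "x \<in> \<Union>Q"
  shows "fundamental_group (\<Union>Q) x \<cong> free_group {..<card (maximal_edges n Q)}"
proof -
  define D where "D = {..<n}"
  define \<pi> where "\<pi> = fundamental_group (\<Union>Q) x"
  define N where "N = card (maximal_edges n Q)"
  define light where "light v i \<longleftrightarrow> edge_degree v i \<le> K" for v i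
  define other where "other i = (if i = 0 then 1 else 0 :: nat)" for i :: nat
  have other: "other i \<in> D \<and> other i \<noteq> i" if "i \<in> D" for i
    using n by (auto simp: other_def D_def)
  have light_flip: "light (flip i v) i" if "light v i" for v i
    using that by (simp add: light_def edge_degree_def face_flip)
  obtain b where b: "x \<in> star b"
    using cover[OF x] by blast
  have bD: "b \<subseteq> D"
    using star_vertex_subset[OF b] by (simp add: D_def)
  have squareQ: "face v {i, j} \<in> Q" if "v \<subseteq> D" "i \<in> D" "j \<in> D" "i \<noteq> j" "X (face v {i, j})" for v i j
    using that by (subst in_Q_iff) (auto simp: D_def)
  have edgeQ: "face v {i} \<in> Q" if "v \<subseteq> D" "i \<in> D" for v i
    using that by (subst in_Q_iff) (auto simp: D_def)

  define Mx where "Mx = maximal_edges n Q"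
  have "finite Mx"
    unfolding Mx_def maximal_edges_def using finite_cube_faces[of n 1] by auto
  then obtain idx where idx: "bij_betw idx Mx {..<N}"
    using ex_bij_betw_finite_nat unfolding N_def Mx_def[symmetric] lessThan_atLeast0 by blast
  have Mx_iff: "face v S \<in> Mx \<longleftrightarrow> (\<exists>i. S = {i} \<and> (\<forall>j\<in>D. j \<noteq> i \<longrightarrow> \<not> X (face v {i, j})))"
    if "v \<subseteq> D" "S \<subseteq> D" for v S
    unfolding Mx_def using maximal_edge_iff that by (auto simp: D_def)
  have Mx_light: "light v i" if "v \<subseteq> D" "i \<in> D" "face v {i} \<in> Mx" for v i
  proof -
    have "{j \<in> {..<n} - {i}. X (face v {i, j})} = {}"
      using Mx_iff[of v "{i}"] that by (auto simp: D_def)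
    then have "edge_degree v i = 0"
      unfolding edge_degree_def by (simp only: card.empty)
    then show ?thesis
      by (simp add: light_def)
  qed
  have not_Mx: "\<exists>j\<in>D - {i}. X (face v {i, j})" if "v \<subseteq> D" "i \<in> D" "face v {i} \<notin> Mx" for v i
    using Mx_iff[of v "{i}"] that by blast

  \<comment> \<open>\<open>E u v\<close> is the smallest face containing the vertices \<open>u\<close> and \<open>v\<close>. A maximal edge is oriented
    from its smaller to its larger end.\<close>
  let ?F = "free_group {..<N}"
  define E where "E u v = face u (symdiff u v)" for u v
  have E_commute: "E u v = E v u" for u v
    unfolding E_def by (simp add: face_eq_iff symdiff_commute)
  define g where "g u v = (if E u v \<in> Mx then [(u \<subset> v, idx (E u v))] else [])" for u v
  have E_flip: "E u (flip i u) = face u {i}" for u i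
  proof -
    have "symdiff u (flip i u) = {i}"
      by (auto simp: flip_def symdiff_def)
    then show ?thesis
      by (simp add: E_def)
  qed
  have E_Mx: "\<exists>i. v = flip i u \<and> i \<in> D" if "E u v \<in> Mx" "u \<subseteq> D" "v \<subseteq> D" for u v
  proof -
    have sD: "symdiff u v \<subseteq> D"
      using that by (auto simp: symdiff_def)
    have "\<exists>i. symdiff u v = {i}"
      using that Mx_iff[OF that(2) sD] by (auto simp: E_def)
    then obtain i where i: "symdiff u v = {i}"
      by blast
    then have "v = flip i u"
      by (auto simp: flip_def symdiff_def set_eq_iff)
    then show ?thesis
      using i sD by blast
  qed
  have small: "E u v \<notin> Mx"
    if "X (face z S)" "card S = 2" "z \<subseteq> D" "S \<subseteq> D" "symdiff u z \<subseteq> S" "symdiff v z \<subseteq> S" for u v z S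
  proof
    assume E: "E u v \<in> Mx"
    have "E u v \<subseteq> face z S"
      unfolding E_def by (intro face_mono) (use that in \<open>auto simp: symdiff_def\<close>)
    moreover have "face z S \<in> Q \<inter> cube_faces n 2"
      using that in_Q_iff[of z S] face_in_cube_faces[of z n S 2] by (auto simp: D_def)
    ultimately show False
      using E by (auto simp: Mx_def maximal_edges_def)
  qed
  have g_closed: "g u v \<in> carrier ?F" for u v
    using bij_betwE[OF idx] by (auto simp: g_def free_group_def reduced_word_def)
  have g_refl: "g u u = []" if "u \<subseteq> D" for u
    using Mx_iff[OF that, of "{}"] by (auto simp: g_def E_def)
  have g_inverse: "g u v \<otimes>\<^bsub>?F\<^esub> g v u = []" if "u \<subseteq> D" "v \<subseteq> D" for u v
  proof (cases "E u v \<in> Mx")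
    case True
    then have "\<exists>i. v = flip i u"
      using E_Mx that by blast
    then obtain i where "v = flip i u" ..
    then have "(u \<subset> v) \<noteq> (v \<subset> u)"
      by (cases "i \<in> u") (auto simp: flip_insert flip_remove)
    then show ?thesis
      using True E_commute[of u v] by (auto simp: g_def free_group_def letter_inv_def)
  next
    case False
    then show ?thesis
      using E_commute[of u v] by (simp add: g_def free_group_def)
  qed
  have "cocycle ?F g"
    unfolding cocycle_def
  proof (intro conjI allI impI g_closed)
    fix u v w assume "star u \<inter> star v \<inter> star w \<noteq> {}"
    then obtain z S where z: "face z S \<in> Q" "z \<subseteq> {..<n}" "S \<subseteq> {..<n}" "card S \<le> 2"
      "symdiff u z \<subseteq> S" "symdiff v z \<subseteq> S" "symdiff w z \<subseteq> S"
      by (rule triple_meet)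
    have uvw: "u \<subseteq> D" "v \<subseteq> D" "w \<subseteq> D"
      using z unfolding symdiff_def D_def by blast+
    show "g u v \<otimes>\<^bsub>?F\<^esub> g v w = g u w"
    proof (cases "card S = 2")
      case True
      then have "X (face z S)"
        using z in_Q_iff by auto
      then have "E u v \<notin> Mx" "E v w \<notin> Mx" "E u w \<notin> Mx"
        using z True small[of z S u v] small[of z S v w] small[of z S u w] by (simp_all add: D_def)
      then show ?thesis
        by (simp add: g_def free_group_def)
    next
      case False
      then have "card S \<le> 1" "finite S"
        using z finite_subset[OF z(3)] by auto
      then obtain s where "S \<subseteq> {s}"
        using card_le_Suc0_iff_eq[of S] by (cases "S = {}") auto
      then have "symdiff u z \<subseteq> {s}" "symdiff v z \<subseteq> {s}" "symdiff w z \<subseteq> {s}"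
        using z by auto
      then have "u = v \<or> v = w \<or> u = w"
        unfolding symdiff_def by blast
      then show ?thesis
        using uvw g_refl g_inverse g_closed[of v w] g_closed[of u v] foldr_cons_reduce_Nil
        by (auto simp: free_group_def)
    qed
  qed
  note cocycle_g = this
  let ?R = "cocycle_reachable ?F g b"

  have nonmax_step: "?R (flip i u) k"
    if "?R u k" "k \<in> carrier ?F" "u \<subseteq> D" "i \<in> D" "face u {i} \<notin> Mx" for u i k
  proof -
    have "star u \<inter> star (flip i u) \<noteq> {}"
      using stars_meet[OF edgeQ[OF that(3,4)], of u "flip i u" u] by (auto simp: flip_def symdiff_def)
    moreover have "k \<otimes>\<^bsub>?F\<^esub> g u (flip i u) = k"
      using that foldr_cons_reduce_Nil[of k] by (simp add: g_def E_flip free_group_def)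
    ultimately show ?thesis
      using cocycle_reachable.step[OF that(1), of "flip i u"] by simp
  qed
  have sparse': "y = i \<and> U \<subseteq> {i}"
    if "v \<subseteq> D" "{i, j, l} \<subseteq> D" "U \<subseteq> {i, j, l}" "y \<in> {i, j, l}" "light v i" "light (symdiff v U) y"
    for v i j l U y
    using sparse[of v i j l U y] that by (simp only: D_def light_def)
  \<comment> \<open>Maximal edges are light, so the other three edges of any square of the cube at a maximal edge are
    not maximal and lead around it without producing a letter.\<close>
  have flip_step: "?R (flip i u) k"
    if r: "?R u k" "k \<in> carrier ?F" "u \<subseteq> D" "i \<in> D" for u i k
  proof (cases "face u {i} \<in> Mx")
    case True
    define j where "j = other i"
    have j: "j \<in> D" "j \<noteq> i"
      using other[OF r(4)] by (auto simp: j_def)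
    have l: "light u i"
      using Mx_light True r by blast
    have nl: "\<not> light (symdiff u U) y" if "U \<subseteq> {i, j}" "y \<in> {i, j}" "y \<noteq> i \<or> j \<in> U" for U y
      using sparse'[of u i j j U y] that r j l by auto
    have "face u {j} \<notin> Mx" "face (flip j u) {i} \<notin> Mx" "face (flip i (flip j u)) {j} \<notin> Mx"
      using nl[of "{}" j] nl[of "{j}" i] nl[of "{i, j}" j] r j Mx_light[of u j]
        Mx_light[of "flip j u" i] Mx_light[of "flip i (flip j u)" j]
      by (auto simp: flip_subset) (auto simp: flip_def symdiff_sdiff symdiff_disjoint insert_commute)
    then have "?R (flip j (flip i (flip j u))) k"
      using r j by (intro nonmax_step) (simp_all add: flip_subset)
    then show ?thesis
      by (simp add: flip_commute)
  qed (use nonmax_step r in blast)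
  have move: "?R v k"
    if r: "?R u k" "k \<in> carrier ?F" "u \<subseteq> D" "v \<subseteq> D" for u v k
  proof -
    have "finite U \<Longrightarrow> U \<subseteq> D \<Longrightarrow> cocycle_reachable ?F g b (symdiff u U) k" for U
    proof (induction U rule: finite_induct)
      case (insert i U)
      have "symdiff u (insert i U) = flip i (symdiff u U)"
        using insert by (simp add: flip_sdiff flip_insert)
      then show ?case
        using insert r flip_step[of "symdiff u U" k i] symdiff_subset[of u D U] by simp
    qed (use r in simp)
    moreover have "finite (symdiff u v)" "symdiff u v \<subseteq> D" "symdiff u (symdiff u v) = v"
      using r by (auto simp: symdiff_def D_def intro: finite_subset)
    ultimately show ?thesis
      by metis
  qed
  have reach: "?R v w" if "w \<in> carrier ?F" "v \<subseteq> D" for v w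
    using that
  proof (induction w arbitrary: v rule: rev_induct)
    case Nil
    have "?R b []"
      using cocycle_reachable.start[of ?F g b] by (simp add: free_group_def)
    then show ?case
      using move Nil bD by blast
  next
    case (snoc y w)
    note w = free_group_snoc[OF snoc.prems(1)]
    obtain e where e: "e \<in> Mx" "idx e = snd y"
      using w(2) bij_betw_imp_surj_on[OF idx] by (metis imageE)
    obtain u0 S where u0: "e = face u0 S" "u0 \<subseteq> D" "S \<subseteq> D"
      using e(1) unfolding Mx_def maximal_edges_def cube_faces_eq D_def by blast
    then obtain i where i: "S = {i}" "i \<in> D"
      using Mx_iff[OF u0(2,3)] e by auto
    define lo where "lo = u0 - {i}"
    define hi where "hi = insert i lo"
    have lohi: "lo \<subseteq> D" "hi \<subseteq> D" "lo \<subset> hi" "hi = flip i lo" "lo = flip i hi"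
      using u0 i by (auto simp: lo_def hi_def flip_def symdiff_def)
    have eE: "E lo hi = e"
      unfolding lohi(4) E_flip using u0 i by (auto simp: face_eq_iff lo_def symdiff_def)
    have meet: "star lo \<inter> star hi \<noteq> {}"
    proof -
      have "symdiff lo lo \<subseteq> {i}" "symdiff hi lo \<subseteq> {i}"
        by (auto simp: hi_def symdiff_def)
      then show ?thesis
        using stars_meet[OF edgeQ[OF lohi(1) i(2)], of lo hi lo] by blast
    qed
    have glh: "g lo hi = [(True, snd y)]" "g hi lo = [(False, snd y)]"
    proof -
      have "\<not> hi \<subset> lo" "E hi lo = e"
        using lohi(3) eE E_commute[of hi lo] by auto
      then show "g lo hi = [(True, snd y)]" "g hi lo = [(False, snd y)]"
        using eE e lohi(3) by (simp_all add: g_def)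
    qed
    have "\<exists>v'\<subseteq>D. cocycle_reachable ?F g b v' (w @ [y])"
    proof (cases "fst y")
      case True
      then have "[y] = g lo hi"
        using glh by (metis prod.collapse)
      then show ?thesis
        using cocycle_reachable.step[OF snoc.IH[OF w(1) lohi(1)] meet] w(3) lohi(2) by auto
    next
      case False
      then have "[y] = g hi lo"
        using glh by (metis prod.collapse)
      then show ?thesis
        using cocycle_reachable.step[OF snoc.IH[OF w(1) lohi(2)], of lo] meet w(3) lohi(1) by auto
    qed
    then show ?case
      using move snoc.prems by blast
  qed

  have grp: "group \<pi>"
    unfolding \<pi>_def using x by (rule group_fundamental_group)
  have univ: "\<exists>\<Psi> \<in> hom ?F \<pi>. \<exists>c. (\<forall>v. c v \<in> carrier \<pi>) \<and>
      (\<forall>u v. star u \<inter> star v \<noteq> {} \<longrightarrow> c u \<otimes>\<^bsub>\<pi>\<^esub> f u v = \<Psi> (g u v) \<otimes>\<^bsub>\<pi>\<^esub> c v)"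
    if f: "cocycle \<pi> f" for f
  proof -
    interpret group \<pi> by fact
    have f_closed: "f u v \<in> carrier \<pi>" if "star u \<inter> star v \<noteq> {}" for u v
      using f that unfolding cocycle_def by blast
    have f_mult: "f u v \<otimes>\<^bsub>\<pi>\<^esub> f v w = f u w" if "star u \<inter> star v \<inter> star w \<noteq> {}" for u v w
      using f that unfolding cocycle_def by blast
    have edge_meet: "star u \<inter> star (flip i u) \<noteq> {}" if "u \<subseteq> D" "i \<in> D" for u i
      using stars_meet[OF edgeQ[OF that], of u "flip i u" u] by (auto simp: flip_def symdiff_def)
    have f_refl: "f u u = \<one>\<^bsub>\<pi>\<^esub>" if "u \<subseteq> D" for u
    proof -
      have "face u {} \<in> Q"
        using that by (subst in_Q_iff) (auto simp: D_def)
      then obtain a where "a \<in> star u"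
        using in_star_center[of u "{}" u] by auto
      then show ?thesis
        using cocycle_refl[OF grp f] by blast
    qed
    interpret C: cube_connection \<pi> D "\<lambda>v i. f v (flip i v)"
    proof
      fix v i assume v: "v \<subseteq> D" "i \<in> D"
      show "f v (flip i v) \<in> carrier \<pi>"
        using f_closed edge_meet v by blast
      have "f v (flip i v) \<otimes>\<^bsub>\<pi>\<^esub> f (flip i v) v = f v v"
        using edge_meet[OF v] by (intro f_mult) blast
      then show "f v (flip i v) \<otimes>\<^bsub>\<pi>\<^esub> f (flip i v) (flip i (flip i v)) = \<one>\<^bsub>\<pi>\<^esub>"
        using f_refl v by simp
    qed
    have square: "f v (flip i v) \<otimes>\<^bsub>\<pi>\<^esub> f (flip i v) (flip j (flip i v)) = f v (flip j (flip i v))"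
      if "v \<subseteq> D" "i \<in> D" "j \<in> D" "i \<noteq> j" "X (face v {i, j})" for v i j
      by (intro f_mult stars_meet[OF squareQ[OF that]]) (auto simp: flip_def symdiff_def)
    have flat: "C.flat v i j" if v: "v \<subseteq> D" "i \<in> D" "j \<in> D" "i \<noteq> j" "X (face v {i, j})" for v i j
      using square[OF v] square[of v j i] v
      by (simp add: C.flat_def insert_commute flip_commute)
    have "\<exists>c. (\<forall>v\<subseteq>D. c v \<in> carrier \<pi>) \<and> (\<forall>v\<subseteq>D. \<forall>i\<in>D. \<not> light v i \<or> (\<exists>j\<in>D - {i}. C.flat v i j) \<longrightarrow>
        c v \<otimes>\<^bsub>\<pi>\<^esub> f v (flip i v) = c (flip i v))"
    proof (rule C.gauge_of_sparse_light_edges[where other = other and light = light])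
      show "finite D" by (simp add: D_def)
    next
      fix v i j assume v: "v \<subseteq> D" "i \<in> D" "j \<in> D" "i \<noteq> j" and
        heavy: "\<not> light v i" "\<not> light v j" "\<not> light (flip i v) j" "\<not> light (flip j v) i"
      have "square_fillable v i j"
        using v heavy by (intro fillable) (auto simp: D_def light_def)
      then obtain A a b c d where A: "A \<subseteq> D - {i, j}" "2 \<le> card A" "{a, b, c, d} \<subseteq> A"
        and low: "X (face v {i, a})" "X (face v {j, b})" "X (face (flip j v) {i, c})" "X (face (flip i v) {j, d})"
        and high: "\<And>U k l. U \<subseteq> A \<union> {i, j} \<Longrightarrow> k \<in> A \<union> {i, j} \<Longrightarrow> l \<in> A \<union> {i, j} \<Longrightarrow> k \<noteq> l \<Longrightarrow>
            2 \<le> card ((U \<union> {k, l}) \<inter> A) \<Longrightarrow> X (face (symdiff v U) {k, l})"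
        unfolding square_fillable_def D_def by metis
      show "C.flat v i j"
      proof (rule C.flat_by_filling[where A = A and a = a and b = b and c = c and d = d])
        show "A \<subseteq> D" "i \<notin> A" "j \<notin> A" "a \<in> A" "b \<in> A" "c \<in> A" "d \<in> A"
          using A by auto
        show "finite A"
          using A finite_subset[of A D] by (auto simp: D_def)
        show "C.flat v i a" "C.flat v j b" "C.flat (flip j v) i c" "C.flat (flip i v) j d"
          using A v low flip_subset[OF v(1,2)] flip_subset[OF v(1,3)] by (auto intro!: flat)
        fix U k l assume U: "U \<subseteq> A \<union> {i, j}" "k \<in> A \<union> {i, j}" "l \<in> A \<union> {i, j}" "k \<noteq> l"
          "2 \<le> card ((U \<union> {k, l}) \<inter> A)"
        have "U \<subseteq> D" "k \<in> D" "l \<in> D"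
          using U A v by auto
        then show "C.flat (symdiff v U) k l"
          using U v by (intro flat high symdiff_subset)
      qed (use v A in auto)
    qed (rule other light_flip sparse'; assumption)+
    then obtain c where c_all: "(\<forall>v\<subseteq>D. c v \<in> carrier \<pi>) \<and>
        (\<forall>v\<subseteq>D. \<forall>i\<in>D. \<not> light v i \<or> (\<exists>j\<in>D - {i}. C.flat v i j) \<longrightarrow>
          c v \<otimes>\<^bsub>\<pi>\<^esub> f v (flip i v) = c (flip i v))"
      by (elim exE)
    have c: "c v \<in> carrier \<pi>" if "v \<subseteq> D" for v
      using conjunct1[OF c_all] that by simp
    have c_nonmax: "c v \<otimes>\<^bsub>\<pi>\<^esub> f v (flip i v) = c (flip i v)"
      if v: "v \<subseteq> D" "i \<in> D" "face v {i} \<notin> Mx" for v i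
    proof -
      obtain j where "j \<in> D - {i}" "X (face v {i, j})"
        using not_Mx[OF v] by blast
      then have "\<exists>j\<in>D - {i}. C.flat v i j"
        using flat[of v i j] v by auto
      then show ?thesis
        using conjunct2[OF c_all, rule_format, OF v(1,2)] by simp
    qed
    \<comment> \<open>The ends of an edge \<open>e\<close>, recovered from \<open>e\<close> as a set of points. The letter of \<open>e\<close> goes to the
      value of \<open>f\<close> on it after the change of gauge.\<close>
    define low where "low e = {k. \<forall>y\<in>e. y k = (1::real)}" for e :: "(nat \<Rightarrow> real) set"
    define high where "high e = {k. \<exists>y\<in>e. y k = (1::real)}" for e :: "(nat \<Rightarrow> real) set"
    have lowhigh: "low (face u {i}) = u - {i} \<and> high (face u {i}) = insert i u" for u i
    proof -
      have ends: "vertex (u - {i}) \<in> face u {i}" "vertex (insert i u) \<in> face u {i}"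
        by (auto simp: vertex_in_face symdiff_def)
      have yk: "y k = vertex u k" if "y \<in> face u {i}" "k \<noteq> i" for y k
        using that by (auto simp: face_def split: if_splits)
      have "k \<in> low (face u {i}) \<longleftrightarrow> k \<in> u - {i}" for k
      proof (cases "k = i")
        case True
        have "vertex (u - {i}) i = 0"
          by (simp add: vertex_def)
        then show ?thesis
          using ends(1) True by (auto simp: low_def intro!: bexI[OF _ ends(1)])
      next
        case False
        then have "(\<forall>y\<in>face u {i}. y k = 1) \<longleftrightarrow> vertex u k = 1"
          using yk[OF _ False] ends(1) by (metis (full_types))
        then show ?thesis
          using False by (simp add: low_def vertex_def)
      qed
      moreover have "k \<in> high (face u {i}) \<longleftrightarrow> k \<in> insert i u" for k
      proof (cases "k = i")
        case True
        have "vertex (insert i u) i = 1"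
          by (simp add: vertex_def)
        then show ?thesis
          using ends(2) True by (auto simp: high_def intro!: bexI[OF _ ends(2)])
      next
        case False
        then have "(\<exists>y\<in>face u {i}. y k = 1) \<longleftrightarrow> vertex u k = 1"
          using yk[OF _ False] ends(1) by (metis (full_types))
        then show ?thesis
          using False by (simp add: high_def vertex_def)
      qed
      ultimately show ?thesis
        by blast
    qed
    define \<kappa> where "\<kappa> m = (let e = inv_into Mx idx m in
        c (low e) \<otimes>\<^bsub>\<pi>\<^esub> f (low e) (high e) \<otimes>\<^bsub>\<pi>\<^esub> inv\<^bsub>\<pi>\<^esub> c (high e))" for m
    have \<kappa>: "\<kappa> (idx (face u {i})) = c u \<otimes>\<^bsub>\<pi>\<^esub> f u (flip i u) \<otimes>\<^bsub>\<pi>\<^esub> inv\<^bsub>\<pi>\<^esub> c (flip i u)"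
      if "face u {i} \<in> Mx" "i \<notin> u" for u i
      using that lowhigh[of u i] bij_betw_inv_into_left[OF idx that(1)]
      by (simp add: \<kappa>_def Let_def flip_insert)
    have "\<kappa> m \<in> carrier \<pi>" if m: "m \<in> {..<N}" for m
    proof -
      obtain e where e: "e \<in> Mx" "idx e = m"
        using m bij_betw_imp_surj_on[OF idx] by (metis imageE)
      obtain u0 S where u0: "e = face u0 S" "u0 \<subseteq> D" "S \<subseteq> D"
        using e(1) unfolding Mx_def maximal_edges_def cube_faces_eq D_def by blast
      then obtain i where i: "S = {i}" "i \<in> D"
        using Mx_iff[OF u0(2,3)] e by auto
      define lo where "lo = u0 - {i}"
      have lo: "lo \<subseteq> D" "i \<notin> lo" "e = face lo {i}"
        using u0 i by (auto simp: lo_def face_eq_iff symdiff_def)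
      then show ?thesis
        using \<kappa>[of lo i] e c i by (simp add: flip_subset)
    qed
    then obtain \<Psi> where \<Psi>: "\<Psi> \<in> hom ?F \<pi>" "\<Psi> [] = \<one>\<^bsub>\<pi>\<^esub>"
      "\<And>s. s \<in> {..<N} \<Longrightarrow> \<Psi> [(True, s)] = \<kappa> s" "\<And>s. s \<in> {..<N} \<Longrightarrow> \<Psi> [(False, s)] = inv\<^bsub>\<pi>\<^esub> (\<kappa> s)"
      using free_group_universal[of "{..<N}" \<kappa>] by metis
    have up: "c u \<otimes>\<^bsub>\<pi>\<^esub> f u (flip i u) = \<Psi> (g u (flip i u)) \<otimes>\<^bsub>\<pi>\<^esub> c (flip i u) \<and>
        c (flip i u) \<otimes>\<^bsub>\<pi>\<^esub> f (flip i u) u = \<Psi> (g (flip i u) u) \<otimes>\<^bsub>\<pi>\<^esub> c u"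
      if u: "u \<subseteq> D" "i \<in> D" "i \<notin> u" "face u {i} \<in> Mx" for u i
    proof -
      let ?w = "flip i u"
      have w: "?w \<subseteq> D" using u by (simp add: flip_subset)
      have cl: "c u \<in> carrier \<pi>" "c ?w \<in> carrier \<pi>" "f u ?w \<in> carrier \<pi>" "f ?w u \<in> carrier \<pi>"
        using u w c C.closed[of u i] C.closed[of ?w i] by auto
      have inv: "inv\<^bsub>\<pi>\<^esub> f u ?w = f ?w u"
        using C.inverse[of ?w i] u w cl by (intro inv_equality) simp_all
      have less: "u \<subset> ?w" "\<not> ?w \<subset> u"
        using u by (auto simp: flip_insert)
      let ?m = "idx (face u {i})"
      have m: "?m \<in> {..<N}"
        using u(4) bij_betwE[OF idx] by blast
      have g: "g u ?w = [(True, ?m)]" "g ?w u = [(False, ?m)]"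
        using u less E_flip[of u i] E_commute[of ?w u] by (auto simp: g_def)
      have "\<Psi> (g u ?w) \<otimes>\<^bsub>\<pi>\<^esub> c ?w = c u \<otimes>\<^bsub>\<pi>\<^esub> f u ?w"
        using g \<Psi>(3)[OF m] \<kappa>[OF u(4,3)] cl by (simp add: m_assoc)
      moreover have "\<Psi> (g ?w u) \<otimes>\<^bsub>\<pi>\<^esub> c u = c ?w \<otimes>\<^bsub>\<pi>\<^esub> f ?w u"
        using g \<Psi>(4)[OF m] \<kappa>[OF u(4,3)] cl by (simp add: m_assoc inv_mult_group inv)
      ultimately show ?thesis
        by simp
    qed
    have edge: "c u \<otimes>\<^bsub>\<pi>\<^esub> f u (flip i u) = \<Psi> (g u (flip i u)) \<otimes>\<^bsub>\<pi>\<^esub> c (flip i u)"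
      if u: "u \<subseteq> D" "i \<in> D" for u i
    proof (cases "face u {i} \<in> Mx")
      case True
      show ?thesis
      proof (cases "i \<in> u")
        case i: True
        have "flip i u \<subseteq> D" "i \<notin> flip i u" "face (flip i u) {i} \<in> Mx"
          using flip_subset[OF u] i True by (simp_all add: face_flip) (simp add: flip_remove)
        from up[OF this(1) u(2) this(2,3)] show ?thesis
          by simp
      qed (use up u True in blast)
    next
      case False
      then have "g u (flip i u) = []"
        by (simp add: g_def E_flip)
      then show ?thesis
        using c_nonmax[OF u False] c[of "flip i u"] u \<Psi>(2) by (simp add: flip_subset)
    qed
    have main: "c u \<otimes>\<^bsub>\<pi>\<^esub> f u v = \<Psi> (g u v) \<otimes>\<^bsub>\<pi>\<^esub> c v \<and> u \<subseteq> D \<and> v \<subseteq> D"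
      if meet: "star u \<inter> star v \<noteq> {}" for u v
    proof -
      obtain z S where z: "face z S \<in> Q" "z \<subseteq> {..<n}" "S \<subseteq> {..<n}" "card S \<le> 2"
        "symdiff u z \<subseteq> S" "symdiff v z \<subseteq> S"
        using triple_meet[of u v v] meet by (metis Int_assoc Int_absorb)
      have uv: "u \<subseteq> D" "v \<subseteq> D"
        using z unfolding symdiff_def D_def by blast+
      have sub: "symdiff u v \<subseteq> S"
        using z(5,6) unfolding symdiff_def by blast
      have fin: "finite S"
        using z finite_subset[OF z(3)] by auto
      have v: "v = symdiff u (symdiff u v)"
        by (auto simp: symdiff_def)
      have "card (symdiff u v) \<le> 2"
        using card_mono[OF fin sub] z by simp
      then consider "card (symdiff u v) = 0" | "card (symdiff u v) = 1" | "card (symdiff u v) = 2"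
        by linarith
      then have "c u \<otimes>\<^bsub>\<pi>\<^esub> f u v = \<Psi> (g u v) \<otimes>\<^bsub>\<pi>\<^esub> c v"
      proof cases
        case 1
        then have "symdiff u v = {}"
          using finite_subset[OF sub fin] by simp
        then have "u = v"
          using v by simp
        then show ?thesis
          using uv f_refl g_refl \<Psi>(2) c by simp
      next
        case 2
        then obtain i where i: "symdiff u v = {i}"
          by (auto simp: card_1_singleton_iff)
        then have "v = flip i u" "i \<in> D"
          using v sub z by (auto simp: flip_def D_def)
        then show ?thesis
          using edge uv by blast
      next
        case 3
        then have S: "symdiff u v = S" "card S = 2"
          using card_subset_eq[OF fin sub] z card_mono[OF fin sub] by auto
        then obtain i j where ij: "S = {i, j}" "i \<noteq> j"
          by (auto simp: card_2_iff)
        have D: "i \<in> D" "j \<in> D"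
          using ij z by (auto simp: D_def)
        let ?w = "flip i u"
        have "symdiff u {i, j} = v"
          using v[symmetric] S(1) ij(1) by simp
        then have w: "?w \<subseteq> D" "v = flip j ?w"
          using flip_subset[OF uv(1) D(1)] ij(2)
          by (simp_all add: flip_def symdiff_sdiff symdiff_disjoint insert_commute)
        have Xz: "X (face z S)"
          using z S in_Q_iff by auto
        have "face u {i, j} = face z S"
          using z ij by (simp add: face_eq_iff)
        then have Xu: "X (face u {i, j})"
          using Xz by simp
        have "face u {i} \<notin> Mx"
          using Mx_iff[OF uv(1), of "{i}"] D ij(2) Xu by auto
        moreover have "face ?w {j, i} = face u {i, j}"
          using face_flip[of i "{i, j}" u] by (simp add: insert_commute)
        then have "face ?w {j} \<notin> Mx"
          using Mx_iff[OF w(1), of "{j}"] D ij(2) Xu by auto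
        moreover have "E u v \<notin> Mx"
          using small[OF Xz S(2) _ _ z(5,6)] z(2,3) by (simp add: D_def)
        ultimately have "c u \<otimes>\<^bsub>\<pi>\<^esub> f u ?w = c ?w" "c ?w \<otimes>\<^bsub>\<pi>\<^esub> f ?w v = c v" "g u v = []"
          using c_nonmax[OF uv(1) D(1)] c_nonmax[OF w(1) D(2)] unfolding w(2)[symmetric]
          by (simp_all add: g_def)
        moreover have "f u ?w \<otimes>\<^bsub>\<pi>\<^esub> f ?w v = f u v"
          using square[OF uv(1) D ij(2) Xu] unfolding w(2)[symmetric] .
        moreover have "c u \<in> carrier \<pi>" "f u ?w \<in> carrier \<pi>" "f ?w v \<in> carrier \<pi>" "c v \<in> carrier \<pi>"
          using c uv C.closed[OF uv(1) D(1)] C.closed[OF w(1) D(2)] unfolding w(2)[symmetric] by simp_all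
        ultimately show ?thesis
          using \<Psi>(2) by (metis l_one m_assoc)
      qed
      then show ?thesis
        using uv by simp
    qed
    define c' where "c' v = (if v \<subseteq> D then c v else \<one>\<^bsub>\<pi>\<^esub>)" for v
    have "\<forall>v. c' v \<in> carrier \<pi>"
      using c by (simp add: c'_def)
    moreover have "c' u \<otimes>\<^bsub>\<pi>\<^esub> f u v = \<Psi> (g u v) \<otimes>\<^bsub>\<pi>\<^esub> c' v" if "star u \<inter> star v \<noteq> {}" for u v
      using main[OF that] by (simp add: c'_def)
    ultimately show ?thesis
      using \<Psi>(1) by blast
  qed
  have "\<pi> \<cong> ?F"
    unfolding \<pi>_def
  proof (rule fundamental_group_iso_universal_cocycle_group[OF b group_free_group cocycle_g])
    fix v w assume "w \<in> carrier ?F" "star v \<noteq> {}"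
    then show "?R v w"
      using reach star_vertex_subset unfolding D_def by blast
  qed (use univ in \<open>simp add: \<pi>_def\<close>)
  then show ?thesis
    by (simp add: \<pi>_def N_def)
qed

end

section \<open>Two estimates for independent coin flips\<close>

abbreviation coin_flips :: "'a set \<Rightarrow> real \<Rightarrow> ('a \<Rightarrow> bool) pmf" where
  "coin_flips I p \<equiv> Pi_pmf I False (\<lambda>_. bernoulli_pmf p)"

text \<open>Markov's inequality for \<open>s\<close> to the power of the number of successes.\<close>

lemma prob_few_successes:
  fixes p s :: real
  assumes I: "finite I" "S \<subseteq> I" and p: "0 \<le> p" "p \<le> 1" and s: "0 < s" "s \<le> 1"
  shows "measure_pmf.prob (coin_flips I p) {X. card {a \<in> S. X a} \<le> k} \<le> (1 - p + p * s) ^ card S / s ^ k"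
proof -
  define f where "f a b = (if a \<in> S \<and> b then s else 1)" for a :: 'a and b
  have S: "finite S"
    using I finite_subset by blast
  have prod_f: "(\<Prod>a\<in>I. f a (X a)) = s ^ card {a \<in> S. X a}" for X
  proof -
    have "(\<Prod>a\<in>I. f a (X a)) = (\<Prod>a\<in>{a \<in> S. X a}. s)"
      unfolding f_def by (rule prod.mono_neutral_cong_right) (use I in auto)
    then show ?thesis by simp
  qed
  have fin: "finite (set_pmf (coin_flips I p))"
    by (rule finite_subset[OF set_Pi_pmf_subset'[OF I(1)]]) (intro finite_PiE_dflt I, simp)
  have "measure_pmf.prob (coin_flips I p) {X. card {a \<in> S. X a} \<le> k} =
      measure_pmf.expectation (coin_flips I p) (indicator {X. card {a \<in> S. X a} \<le> k})"
    by simp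
  also have "\<dots> \<le> measure_pmf.expectation (coin_flips I p) (\<lambda>X. (\<Prod>a\<in>I. f a (X a)) / s ^ k)"
  proof (rule integral_mono)
    fix X
    show "indicator {X. card {a \<in> S. X a} \<le> k} X \<le> (\<Prod>a\<in>I. f a (X a)) / s ^ k"
      using s power_decreasing[of "card {a \<in> S. X a}" k s]
      by (auto simp: prod_f indicator_def)
  qed (use fin in \<open>auto intro: integrable_measure_pmf_finite\<close>)
  also have "\<dots> = (\<Prod>a\<in>I. measure_pmf.expectation (bernoulli_pmf p) (f a)) / s ^ k"
  proof -
    have "measure_pmf.expectation (coin_flips I p) (\<lambda>X. \<Prod>a\<in>I. f a (X a)) =
        (\<Prod>a\<in>I. measure_pmf.expectation (bernoulli_pmf p) (f a))"
      by (rule expectation_prod_Pi_pmf)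
        (use I s in \<open>auto simp: f_def intro: integrable_measure_pmf_finite\<close>)
    then show ?thesis
      by simp
  qed
  also have "(\<Prod>a\<in>I. measure_pmf.expectation (bernoulli_pmf p) (f a)) = (\<Prod>a\<in>S. 1 - p + p * s)"
    using p I by (intro prod.mono_neutral_cong_right) (auto simp: f_def algebra_simps)
  finally show ?thesis
    by simp
qed

text \<open>Disjoint blocks are independent: split off the coordinates of one block from the product.\<close>

lemma prob_all_blocks_fail:
  fixes p :: real
  assumes p: "0 \<le> p" "p \<le> 1" and T: "finite T"
  shows "finite I \<Longrightarrow> (\<And>t. t \<in> T \<Longrightarrow> H t \<subseteq> I) \<Longrightarrow> disjoint_family_on H T \<Longrightarrow>
    measure_pmf.prob (coin_flips I p) {X. \<forall>t\<in>T. \<exists>a\<in>H t. \<not> X a} = (\<Prod>t\<in>T. 1 - p ^ card (H t))"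
  using T
proof (induction T arbitrary: I rule: finite_induct)
  case (insert t T)
  define J where "J = I - H t"
  have fin: "finite (H t)" "finite J"
    using insert.prems(1) finite_subset[OF insert.prems(2)[of t] insert.prems(1)] by (auto simp: J_def)
  have I: "I = H t \<union> J" "H t \<inter> J = {}"
    using insert.prems by (auto simp: J_def)
  have HJ: "H u \<subseteq> J" if "u \<in> T" for u
  proof -
    have "H t \<inter> H u = {}"
      using disjoint_family_onD[OF insert.prems(3), of t u] that insert.hyps by auto
    then show ?thesis
      using insert.prems(2)[of u] that by (auto simp: J_def)
  qed
  let ?A = "{X. \<exists>a\<in>H t. \<not> X a}" and ?B = "{X. \<forall>u\<in>T. \<exists>a\<in>H u. \<not> X a}"
  let ?M = "coin_flips (H t) p" and ?N = "coin_flips J p"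
  let ?h = "\<lambda>(f, g) x. if x \<in> H t then f x else g x :: bool"
  have pre: "?h -` {X. \<forall>u\<in>insert t T. \<exists>a\<in>H u. \<not> X a} = ?A \<times> ?B"
  proof -
    have 1: "(\<exists>a\<in>H u. \<not> (if a \<in> H t then f a else g a)) \<longleftrightarrow> (\<exists>a\<in>H u. \<not> g a)"
      if "u \<in> T" for f g u
      by (intro bex_cong refl) (use HJ[OF that] in \<open>auto simp: J_def\<close>)
    have 2: "(\<exists>a\<in>H t. \<not> (if a \<in> H t then f a else g a)) \<longleftrightarrow> (\<exists>a\<in>H t. \<not> f a)" for f g
      by (intro bex_cong refl) simp
    have "(\<forall>u\<in>insert t T. \<exists>a\<in>H u. \<not> (if a \<in> H t then f a else g a)) \<longleftrightarrow>
        (\<exists>a\<in>H t. \<not> f a) \<and> (\<forall>u\<in>T. \<exists>a\<in>H u. \<not> g a)" for f g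
    proof
      assume *: "\<forall>u\<in>insert t T. \<exists>a\<in>H u. \<not> (if a \<in> H t then f a else g a)"
      have "\<exists>a\<in>H u. \<not> g a" if "u \<in> T" for u
        using *[THEN bspec, of u] that 1[OF that, of f g] by (simp only: insertI2)
      moreover have "\<exists>a\<in>H t. \<not> f a"
        using *[THEN bspec, OF insertI1] unfolding 2 .
      ultimately show "(\<exists>a\<in>H t. \<not> f a) \<and> (\<forall>u\<in>T. \<exists>a\<in>H u. \<not> g a)"
        by (intro conjI ballI)
    next
      assume *: "(\<exists>a\<in>H t. \<not> f a) \<and> (\<forall>u\<in>T. \<exists>a\<in>H u. \<not> g a)"
      show "\<forall>u\<in>insert t T. \<exists>a\<in>H u. \<not> (if a \<in> H t then f a else g a)"
      proof
        fix u assume "u \<in> insert t T"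
        then show "\<exists>a\<in>H u. \<not> (if a \<in> H t then f a else g a)"
        proof
          assume "u = t"
          then show ?thesis
            using conjunct1[OF *] 2[of f g] by (simp only:)
        next
          assume "u \<in> T"
          from 1[OF this, of f g] bspec[OF conjunct2[OF *] this] show ?thesis
            by (simp only:)
        qed
      qed
    qed
    then show ?thesis
      by (simp only: set_eq_iff vimage_eq split_paired_All mem_Sigma_iff mem_Collect_eq case_prod_conv)
        simp
  qed
  have "measure_pmf.prob (coin_flips I p) {X. \<forall>u\<in>insert t T. \<exists>a\<in>H u. \<not> X a} =
      measure_pmf.prob (pair_pmf ?M ?N) (?A \<times> ?B)"
    unfolding I(1) Pi_pmf_union[OF fin I(2)] measure_map_pmf pre ..
  also have "\<dots> = measure_pmf.prob (pair_pmf ?M ?N) ((?A \<inter> set_pmf ?M) \<times> (?B \<inter> set_pmf ?N))"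
  proof -
    have "(?A \<times> ?B) \<inter> set_pmf (pair_pmf ?M ?N) = (?A \<inter> set_pmf ?M) \<times> (?B \<inter> set_pmf ?N)"
      unfolding set_pair_pmf by (rule Times_Int_Times)
    then show ?thesis
      using measure_Int_set_pmf[of "pair_pmf ?M ?N" "?A \<times> ?B"] by (simp only:)
  qed
  also have "\<dots> = measure_pmf.prob ?M (?A \<inter> set_pmf ?M) * measure_pmf.prob ?N (?B \<inter> set_pmf ?N)"
    by (rule measure_pmf_prob_product) (auto intro: countable_subset[OF _ countable_set_pmf])
  also have "\<dots> = measure_pmf.prob ?M ?A * measure_pmf.prob ?N ?B"
    by (simp only: measure_Int_set_pmf)
  also have "measure_pmf.prob ?N ?B = (\<Prod>u\<in>T. 1 - p ^ card (H u))"
    using insert.prems(3) by (intro insert.IH fin HJ) (auto simp: disjoint_family_on_def)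
  also have "measure_pmf.prob ?M ?A = 1 - p ^ card (H t)"
  proof -
    have "?A = space (measure_pmf ?M) - Pi (H t) (\<lambda>_. {True})"
      by (auto simp: Pi_def)
    then have "measure_pmf.prob ?M ?A = 1 - measure_pmf.prob ?M (Pi (H t) (\<lambda>_. {True}))"
      using measure_pmf.prob_compl[of "Pi (H t) (\<lambda>_. {True})" ?M] by simp
    also have "measure_pmf.prob ?M (Pi (H t) (\<lambda>_. {True})) = p ^ card (H t)"
      using fin p by (simp add: measure_Pi_pmf_Pi measure_pmf_single)
    finally show ?thesis .
  qed
  finally show ?case
    using insert.hyps by simp
qed simp

lemma prob_all_blocks_fail_le:
  fixes p :: real
  assumes p: "0 \<le> p" "p \<le> 1" and "finite T" "finite I" "\<And>t. t \<in> T \<Longrightarrow> H t \<subseteq> I"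
    "disjoint_family_on H T" and L: "\<And>t. t \<in> T \<Longrightarrow> card (H t) \<le> L"
  shows "measure_pmf.prob (coin_flips I p) {X. \<forall>t\<in>T. \<exists>a\<in>H t. \<not> X a} \<le> (1 - p ^ L) ^ card T"
proof -
  have "(\<Prod>t\<in>T. 1 - p ^ card (H t)) \<le> (\<Prod>t\<in>T. 1 - p ^ L)"
    using p L by (intro prod_mono) (auto simp: power_le_one intro: power_decreasing)
  then show ?thesis
    using prob_all_blocks_fail[of p T I H] assms by simp
qed

lemma prob_UN_le:
  assumes "finite J" "\<And>j. j \<in> J \<Longrightarrow> measure_pmf.prob M (B j) \<le> e" "real (card J) \<le> c" "0 \<le> e"
  shows "measure_pmf.prob M (\<Union>j\<in>J. B j) \<le> c * e"
proof -
  have "measure_pmf.prob M (\<Union>j\<in>J. B j) \<le> (\<Sum>j\<in>J. measure_pmf.prob M (B j))"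
    using assms by (intro measure_pmf.finite_measure_subadditive_finite) auto
  also have "\<dots> \<le> card J * e"
    using assms sum_bounded_above[of J "\<lambda>j. measure_pmf.prob M (B j)" e] by simp
  also have "\<dots> \<le> c * e"
    using assms by (intro mult_right_mono)
  finally show ?thesis .
qed

section \<open>Random squares\<close>

definition squares_at :: "nat \<Rightarrow> nat set \<Rightarrow> nat \<Rightarrow> (nat \<Rightarrow> real) set set" where
  "squares_at n v i = (\<lambda>j. face v {i, j}) ` ({..<n} - {i})"

lemma inj_squares_at: "inj_on (\<lambda>j. face v {i, j}) ({..<n} - {i})"
  by (rule inj_onI) (auto simp: face_eq_iff doubleton_eq_iff)

lemma squares_at_subset:
  assumes "v \<subseteq> {..<n}" "i < n"
  shows "squares_at n v i \<subseteq> cube_faces n 2"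
  unfolding squares_at_def
proof (rule image_subsetI)
  fix j assume j: "j \<in> {..<n} - {i}"
  then have "i \<noteq> j"
    by auto
  then show "face v {i, j} \<in> cube_faces n 2"
    using j assms by (subst face_in_cube_faces) auto
qed

lemma edge_degree_eq: "cubical_complex.edge_degree n X v i = card {F \<in> squares_at n v i. X F}"
proof -
  have "{F \<in> squares_at n v i. X F} = (\<lambda>j. face v {i, j}) ` {j \<in> {..<n} - {i}. X (face v {i, j})}"
    by (auto simp: squares_at_def)
  moreover have "inj_on (\<lambda>j. face v {i, j}) {j \<in> {..<n} - {i}. X (face v {i, j})}"
    by (rule inj_on_subset[OF inj_squares_at]) auto
  ultimately show ?thesis
    by (simp add: cubical_complex.edge_degree_def card_image)
qed

text \<open>Two different edges lie in at most one common square.\<close>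

lemma card_squares_at_Un:
  assumes "i < n" "x < n" and distinct: "\<not> (x = i \<and> symdiff v u \<subseteq> {i})"
  shows "2 * n - 3 \<le> card (squares_at n v i \<union> squares_at n u x)"
proof -
  let ?A = "squares_at n v i" and ?B = "squares_at n u x"
  have fin: "finite ?A" "finite ?B"
    by (auto simp: squares_at_def)
  have card: "card ?A = n - 1" "card ?B = n - 1"
    using assms(1,2) by (simp_all add: squares_at_def card_image inj_squares_at)
  have "F = G" if FG: "F \<in> ?A \<inter> ?B" "G \<in> ?A \<inter> ?B" for F G
  proof -
    obtain j k j' k' where F: "F = face v {i, j}" "face v {i, j} = face u {x, k}" "j \<noteq> i" "k \<noteq> x"
      and G: "G = face v {i, j'}" "face v {i, j'} = face u {x, k'}" "j' \<noteq> i" "k' \<noteq> x"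
      using FG unfolding squares_at_def by auto
    have e: "{i, j} = {x, k}" "symdiff v u \<subseteq> {i, j}" "{i, j'} = {x, k'}" "symdiff v u \<subseteq> {i, j'}"
      using F(2) G(2) by (simp_all add: face_eq_iff)
    have "j = j'"
    proof (cases "x = i")
      case True
      then obtain y where "y \<in> symdiff v u" "y \<noteq> i"
        using distinct by auto
      then show ?thesis
        using e(2,4) by auto
    next
      case False
      then show ?thesis
        using e(1,3) by (auto simp: doubleton_eq_iff)
    qed
    then show ?thesis
      using F(1) G(1) by simp
  qed
  then have "card (?A \<inter> ?B) \<le> 1"
    using fin card_le_Suc0_iff_eq[of "?A \<inter> ?B"] by auto
  then show ?thesis
    using card_Un_Int[OF fin] card by linarith
qed

lemma prob_two_light_edges:
  fixes p s :: real
  assumes v: "v \<subseteq> {..<n}" "u \<subseteq> {..<n}" "i < n" "x < n" "\<not> (x = i \<and> symdiff v u \<subseteq> {i})"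
    and p: "0 \<le> p" "p \<le> 1" and s: "0 < s" "s \<le> 1"
  shows "measure_pmf.prob (coin_flips (cube_faces n 2) p)
      {X. cubical_complex.edge_degree n X v i \<le> K \<and> cubical_complex.edge_degree n X u x \<le> K}
    \<le> (1 - p + p * s) ^ (2 * n - 3) / s ^ (2 * K)"
proof -
  let ?S = "squares_at n v i \<union> squares_at n u x"
  have "{X. cubical_complex.edge_degree n X v i \<le> K \<and> cubical_complex.edge_degree n X u x \<le> K}
      \<subseteq> {X. card {F \<in> ?S. X F} \<le> 2 * K}"
  proof clarify
    fix X assume X: "cubical_complex.edge_degree n X v i \<le> K" "cubical_complex.edge_degree n X u x \<le> K"
    have "card {F \<in> ?S. X F} \<le> card {F \<in> squares_at n v i. X F} + card {F \<in> squares_at n u x. X F}"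
      by (rule order_trans[OF _ card_Un_le]) (simp add: Collect_disj_eq[symmetric] Un_def conj_disj_distribR)
    then show "card {F \<in> ?S. X F} \<le> 2 * K"
      using X by (simp add: edge_degree_eq)
  qed
  then have "measure_pmf.prob (coin_flips (cube_faces n 2) p)
      {X. cubical_complex.edge_degree n X v i \<le> K \<and> cubical_complex.edge_degree n X u x \<le> K}
    \<le> measure_pmf.prob (coin_flips (cube_faces n 2) p) {X. card {F \<in> ?S. X F} \<le> 2 * K}"
    by (intro measure_pmf.finite_measure_mono) auto
  also have "\<dots> \<le> (1 - p + p * s) ^ card ?S / s ^ (2 * K)"
    using v by (intro prob_few_successes p s) (auto simp: finite_cube_faces dest: squares_at_subset)
  also have "\<dots> \<le> (1 - p + p * s) ^ (2 * n - 3) / s ^ (2 * K)"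
  proof (rule divide_right_mono)
    have "p * s \<le> p"
      using p s by (simp add: mult_left_le)
    moreover have "0 \<le> p * s"
      using p s by simp
    ultimately show "(1 - p + p * s) ^ card ?S \<le> (1 - p + p * s) ^ (2 * n - 3)"
      using p card_squares_at_Un[OF v(3,4,5)] by (intro power_decreasing) auto
  qed (use s in simp)
  finally show ?thesis .
qed

text \<open>The squares that \<open>square_fillable\<close> requires of a box in the new directions \<open>T\<close>, except for
  the four squares at the edges of the given one.\<close>

definition high_squares :: "nat set \<Rightarrow> nat \<Rightarrow> nat \<Rightarrow> nat set \<Rightarrow> (nat \<Rightarrow> real) set set" where
  "high_squares v i j T = {face (symdiff v U) {k, l} | U k l.
     U \<subseteq> T \<union> {i, j} \<and> k \<in> T \<union> {i, j} \<and> l \<in> T \<union> {i, j} \<and> k \<noteq> l \<and> 2 \<le> card ((U \<union> {k, l}) \<inter> T)}"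

lemma high_squares_subset:
  assumes "v \<subseteq> {..<n}" "i < n" "j < n" "T \<subseteq> {..<n}"
  shows "high_squares v i j T \<subseteq> cube_faces n 2"
proof
  fix F assume "F \<in> high_squares v i j T"
  then obtain U k l where F: "F = face (symdiff v U) {k, l}" "U \<subseteq> T \<union> {i, j}"
    "k \<in> T \<union> {i, j}" "l \<in> T \<union> {i, j}" "k \<noteq> l"
    unfolding high_squares_def by blast
  have "symdiff v U \<subseteq> {..<n}" "{k, l} \<subseteq> {..<n}"
    using F assms unfolding symdiff_def by auto
  then show "F \<in> cube_faces n 2"
    using face_in_cube_faces[of "symdiff v U" n "{k, l}" 2] F by simp
qed

text \<open>At most 64 sets \<open>U\<close> and 6 choices each of \<open>k\<close> and \<open>l\<close>.\<close>

lemma card_high_squares: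
  assumes "finite T" "card T \<le> 4"
  shows "card (high_squares v i j T) \<le> 2304"
proof -
  let ?W = "T \<union> {i, j}"
  have W: "card ?W \<le> 6" "finite ?W"
    using card_Un_le[of T "{i, j}"] card_insert_le_m1[of 2 "{j}" i] assms by auto
  have "card (Pow ?W) \<le> 2 ^ 6"
    unfolding card_Pow[OF W(2)] by (rule power_increasing[OF W(1)]) simp
  then have "card (Pow ?W \<times> ?W \<times> ?W) \<le> 2 ^ 6 * (6 * 6)"
    unfolding card_cartesian_product using W by (intro mult_le_mono)
  moreover have "high_squares v i j T \<subseteq> (\<lambda>(U, k, l). face (symdiff v U) {k, l}) ` (Pow ?W \<times> ?W \<times> ?W)"
  proof
    fix F assume "F \<in> high_squares v i j T"
    then obtain U k l where "F = face (symdiff v U) {k, l}" "U \<in> Pow ?W" "k \<in> ?W" "l \<in> ?W"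
      unfolding high_squares_def mem_Collect_eq Pow_iff by (elim exE conjE)
    then show "F \<in> (\<lambda>(U, k, l). face (symdiff v U) {k, l}) ` (Pow ?W \<times> ?W \<times> ?W)"
      by (intro image_eqI[of _ _ "(U, k, l)"] SigmaI) (simp_all only: case_prod_conv)
  qed
  then have "card (high_squares v i j T) \<le> card (Pow ?W \<times> ?W \<times> ?W)"
    using W by (intro surj_card_le) auto
  ultimately show ?thesis
    by simp
qed

text \<open>A square determines the set of directions that it uses or in which it is displaced from \<open>v\<close>.
  In a common square, at least two of these are new directions of both boxes.\<close>

lemma high_squares_disjoint:
  assumes "i \<notin> T" "j \<notin> T" "i \<notin> T'" "j \<notin> T'" "finite T" "card (T \<inter> T') \<le> 1"
  shows "high_squares v i j T \<inter> high_squares v i j T' = {}"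
proof (rule ccontr)
  assume "high_squares v i j T \<inter> high_squares v i j T' \<noteq> {}"
  then obtain G where G: "G \<in> high_squares v i j T" "G \<in> high_squares v i j T'"
    by blast
  from G(1) obtain U k l where
    F: "U \<subseteq> T \<union> {i, j}" "k \<in> T \<union> {i, j}" "l \<in> T \<union> {i, j}" "2 \<le> card ((U \<union> {k, l}) \<inter> T)"
    and G1: "G = face (symdiff v U) {k, l}"
    unfolding high_squares_def mem_Collect_eq by (elim exE conjE)
  from G(2) obtain U' k' l' where
    F': "U' \<subseteq> T' \<union> {i, j}" "k' \<in> T' \<union> {i, j}" "l' \<in> T' \<union> {i, j}"
    and G2: "G = face (symdiff v U') {k', l'}"
    unfolding high_squares_def mem_Collect_eq by (elim exE conjE)
  have eq: "face (symdiff v U) {k, l} = face (symdiff v U') {k', l'}"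
    using G1 G2 by simp
  have kl: "{k, l} = {k', l'}" "symdiff (symdiff v U) (symdiff v U') \<subseteq> {k', l'}"
    using eq by (auto simp: face_eq_iff)
  have "U \<union> {k, l} = U' \<union> {k', l'}"
    using kl unfolding symdiff_def by blast
  then have "(U \<union> {k, l}) \<inter> T \<subseteq> T \<inter> T'"
    using F F' assms(1,2) by blast
  then have "card ((U \<union> {k, l}) \<inter> T) \<le> card (T \<inter> T')"
    using assms(5) by (intro card_mono) auto
  then show False
    using F(4) assms(6) by linarith
qed

definition direction_sets ::
    "nat \<Rightarrow> nat \<Rightarrow> nat \<Rightarrow> nat \<Rightarrow> nat set \<Rightarrow> nat set \<Rightarrow> nat set \<Rightarrow> nat set \<Rightarrow> bool" where
  "direction_sets n m i j A1 A2 A3 A4 \<longleftrightarrow> A1 \<union> A2 \<union> A3 \<union> A4 \<subseteq> {..<n} - {i, j} \<and>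
     card A1 = 3 * m \<and> card A2 = 3 * m \<and> card A3 = 3 * m \<and> card A4 = 3 * m \<and>
     A1 \<inter> A2 = {} \<and> A1 \<inter> A3 = {} \<and> A1 \<inter> A4 = {} \<and> A2 \<inter> A3 = {} \<and> A2 \<inter> A4 = {} \<and> A3 \<inter> A4 = {}"

text \<open>Enumerate the four sets and use the \<open>m\<^sup>2\<close> quadruples with the indices \<open>x\<close>, \<open>y\<close>, \<open>x + y\<close> and
  \<open>x + 2 y\<close> for \<open>x, y < m\<close>, all of which are below \<open>3 m\<close>. Any two of these indices determine \<open>x\<close> and
  \<open>y\<close>, so different quadruples have at most one direction in common and their squares are
  independent.\<close>

lemma prob_no_filling:
  fixes p :: real
  assumes v: "v \<subseteq> {..<n}" "i < n" "j < n" and p: "0 \<le> p" "p \<le> 1"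
    and quad: "direction_sets n m i j A1 A2 A3 A4"
  shows "measure_pmf.prob (coin_flips (cube_faces n 2) p)
      {X. \<forall>a\<in>A1. \<forall>b\<in>A2. \<forall>c\<in>A3. \<forall>d\<in>A4. \<exists>F\<in>high_squares v i j {a, b, c, d}. \<not> X F}
    \<le> (1 - p ^ 2304) ^ (m ^ 2)"
proof -
  have A: "A1 \<union> A2 \<union> A3 \<union> A4 \<subseteq> {..<n} - {i, j}"
    and card: "card A1 = 3 * m" "card A2 = 3 * m" "card A3 = 3 * m" "card A4 = 3 * m"
    and disj: "A1 \<inter> A2 = {}" "A1 \<inter> A3 = {}" "A1 \<inter> A4 = {}" "A2 \<inter> A3 = {}" "A2 \<inter> A4 = {}" "A3 \<inter> A4 = {}"
    using quad unfolding direction_sets_def by simp_all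
  have "\<exists>e. bij_betw e {..<3 * m} A" if "A \<subseteq> {..<n} - {i, j}" "card A = 3 * m" for A
    using ex_bij_betw_nat_finite[of A] that finite_subset[of A "{..<n}"]
    by (auto simp: lessThan_atLeast0)
  then obtain e1 e2 e3 e4 where e: "bij_betw e1 {..<3 * m} A1" "bij_betw e2 {..<3 * m} A2"
      "bij_betw e3 {..<3 * m} A3" "bij_betw e4 {..<3 * m} A4"
    using A card by (metis Un_subset_iff)
  define T where "T z = {e1 (fst z), e2 (snd z), e3 (fst z + snd z), e4 (fst z + 2 * snd z)}" for z
  let ?P = "{..<m} \<times> {..<m}"
  have in_A: "e1 x \<in> A1" "e2 y \<in> A2" "e3 (x + y) \<in> A3" "e4 (x + 2 * y) \<in> A4" if "x < m" "y < m" for x y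
    using that e[THEN bij_betwE] by auto
  have eq_iff: "e1 x = e1 x' \<longleftrightarrow> x = x'" "e2 y = e2 y' \<longleftrightarrow> y = y'"
    "e3 (x + y) = e3 (x' + y') \<longleftrightarrow> x + y = x' + y'"
    "e4 (x + 2 * y) = e4 (x' + 2 * y') \<longleftrightarrow> x + 2 * y = x' + 2 * y'"
    if "x < m" "y < m" "x' < m" "y' < m" for x y x' y'
    using that e[THEN bij_betw_imp_inj_on] by (auto simp: inj_on_eq_iff)
  have T_sub: "T z \<subseteq> {..<n} - {i, j}" if "z \<in> ?P" for z
    using in_A[of "fst z" "snd z"] that A by (auto simp: T_def)
  have share: "card (T z \<inter> T z') \<le> 1" if z: "z \<in> ?P" "z' \<in> ?P" "z \<noteq> z'" for z z'
  proof -
    obtain x y x' y' where xy: "z = (x, y)" "z' = (x', y')" "x < m" "y < m" "x' < m" "y' < m"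
      using z by auto
    have eq: "a = b" if ab: "a \<in> T z \<inter> T z'" "b \<in> T z \<inter> T z'" for a b
    proof -
      define R where "R c \<longleftrightarrow> c = e1 x \<and> x = x' \<or> c = e2 y \<and> y = y' \<or>
        c = e3 (x + y) \<and> x + y = x' + y' \<or> c = e4 (x + 2 * y) \<and> x + 2 * y = x' + 2 * y'" for c
      note a = in_A[OF xy(3,4)] and b = in_A[OF xy(5,6)]
      have sep: "p \<noteq> q" if "p \<in> B" "q \<in> C" "B \<inter> C = {}" for p q :: nat and B C
        using that by auto
      have R: "R c" if c: "c \<in> T z \<inter> T z'" for c
      proof -
        have "c \<in> {e1 x, e2 y, e3 (x + y), e4 (x + 2 * y)}" "c \<in> {e1 x', e2 y', e3 (x' + y'), e4 (x' + 2 * y')}"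
          using c by (simp_all add: T_def xy)
        then have "c = e1 x \<and> e1 x = e1 x' \<or> c = e2 y \<and> e2 y = e2 y' \<or>
            c = e3 (x + y) \<and> e3 (x + y) = e3 (x' + y') \<or>
            c = e4 (x + 2 * y) \<and> e4 (x + 2 * y) = e4 (x' + 2 * y')"
          using
          sep[OF a(1) b(2) disj(1)] sep[OF b(1) a(2) disj(1)]
          sep[OF a(1) b(3) disj(2)] sep[OF b(1) a(3) disj(2)]
          sep[OF a(1) b(4) disj(3)] sep[OF b(1) a(4) disj(3)]
          sep[OF a(2) b(3) disj(4)] sep[OF b(2) a(3) disj(4)]
          sep[OF a(2) b(4) disj(5)] sep[OF b(2) a(4) disj(5)]
          sep[OF a(3) b(4) disj(6)] sep[OF b(3) a(4) disj(6)]
          by (elim insertE emptyE) simp_all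
        then show ?thesis
          unfolding R_def using eq_iff[OF xy(3-6)] by simp
      qed
      show ?thesis
        using R[OF ab(1)] R[OF ab(2)] z(3) unfolding R_def xy(1,2) by (elim disjE conjE) auto
    qed
    have fin: "finite (T z \<inter> T z')"
      by (simp add: T_def)
    show ?thesis
      unfolding One_nat_def card_le_Suc0_iff_eq[OF fin] by (intro ballI eq)
  qed
  have "measure_pmf.prob (coin_flips (cube_faces n 2) p)
      {X. \<forall>a\<in>A1. \<forall>b\<in>A2. \<forall>c\<in>A3. \<forall>d\<in>A4. \<exists>F\<in>high_squares v i j {a, b, c, d}. \<not> X F}
    \<le> measure_pmf.prob (coin_flips (cube_faces n 2) p) {X. \<forall>z\<in>?P. \<exists>F\<in>high_squares v i j (T z). \<not> X F}"
  proof (rule measure_pmf.finite_measure_mono)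
    show "{X. \<forall>a\<in>A1. \<forall>b\<in>A2. \<forall>c\<in>A3. \<forall>d\<in>A4. \<exists>F\<in>high_squares v i j {a, b, c, d}. \<not> X F}
      \<subseteq> {X. \<forall>z\<in>?P. \<exists>F\<in>high_squares v i j (T z). \<not> X F}"
      using in_A by (auto simp: T_def)
  qed simp
  also have "\<dots> \<le> (1 - p ^ 2304) ^ card ?P"
  proof (rule prob_all_blocks_fail_le[OF p])
    show "high_squares v i j (T z) \<subseteq> cube_faces n 2" if "z \<in> ?P" for z
      using T_sub[OF that] by (intro high_squares_subset v) auto
    show "disjoint_family_on (\<lambda>z. high_squares v i j (T z)) ?P"
      unfolding disjoint_family_on_def
    proof (intro ballI impI)
      fix z z' assume z: "z \<in> ?P" "z' \<in> ?P" "z \<noteq> z'"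
      show "high_squares v i j (T z) \<inter> high_squares v i j (T z') = {}"
      proof (rule high_squares_disjoint[OF _ _ _ _ _ share[OF z]])
        show "i \<notin> T z" "j \<notin> T z" "i \<notin> T z'" "j \<notin> T z'"
          using T_sub[OF z(1)] T_sub[OF z(2)] by blast+
      qed (simp add: T_def)
    qed
    show "card (high_squares v i j (T z)) \<le> 2304" if "z \<in> ?P" for z
    proof (rule card_high_squares)
      show "card (T z) \<le> 4"
        unfolding T_def by (rule card_insert_le_m1 | simp)+
    qed (simp add: T_def)
  qed (auto simp: finite_cube_faces)
  also have "card ?P = m ^ 2"
    by (simp add: power2_eq_square)
  finally show ?thesis .
qed

text \<open>Choose the four sets greedily among the directions of the squares at the four edges. Each edge
  has at least \<open>12 m\<close> candidates, of which earlier choices use up at most \<open>9 m\<close>.\<close>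

lemma (in cubical_complex) heavy_square_fillable:
  assumes ij: "i < n" "j < n" "i \<noteq> j" and m: "0 < m"
    and heavy: "12 * m < edge_degree v i" "12 * m < edge_degree v j"
      "12 * m < edge_degree (flip i v) j" "12 * m < edge_degree (flip j v) i"
    and filling: "\<And>A1 A2 A3 A4. direction_sets n m i j A1 A2 A3 A4 \<Longrightarrow>
      \<exists>a\<in>A1. \<exists>b\<in>A2. \<exists>c\<in>A3. \<exists>d\<in>A4. \<forall>F\<in>high_squares v i j {a, b, c, d}. X F"
  shows "square_fillable v i j"
proof -
  define nb where "nb u x y = {a \<in> {..<n} - {x}. X (face u {x, a})} - {y}" for u x y
  have nb: "12 * m \<le> card (nb u x y)" if "12 * m < edge_degree u x" for u x y
    using that card_Diff1_le[of "{a \<in> {..<n} - {x}. X (face u {x, a})}" y]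
      card_Diff_singleton_if[of "{a \<in> {..<n} - {x}. X (face u {x, a})}" y]
    by (auto simp: nb_def edge_degree_def split: if_splits)
  have pick: "\<exists>A\<subseteq>nb u x y - B. card A = 3 * m"
    if "12 * m < edge_degree u x" "card B \<le> 9 * m" "finite B" for u x y B
  proof -
    have "card (nb u x y) - card B \<le> card (nb u x y - B)"
      using that(3) by (rule diff_card_le_card_Diff)
    then have "3 * m \<le> card (nb u x y - B)"
      using nb[OF that(1), of y] that(2) by linarith
    then show ?thesis
      using obtain_subset_with_card_n by metis
  qed
  have fin: "finite A" if "card A = 3 * m" for A :: "nat set"
    using that m by (intro card_ge_0_finite) simp
  obtain A1 where A1: "A1 \<subseteq> nb v i j" "card A1 = 3 * m"
    using pick[OF heavy(1), of "{}" j] by auto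
  obtain A2 where A2: "A2 \<subseteq> nb v j i - A1" "card A2 = 3 * m"
    using pick[OF heavy(2), of A1 i] A1 fin by auto
  have c2: "card (A1 \<union> A2) \<le> 9 * m" "finite (A1 \<union> A2)"
    using card_Un_le[of A1 A2] A1 A2 fin by auto
  obtain A3 where A3: "A3 \<subseteq> nb (flip j v) i j - (A1 \<union> A2)" "card A3 = 3 * m"
    using pick[OF heavy(4) c2, of j] by auto
  have c3: "card (A1 \<union> A2 \<union> A3) \<le> 9 * m" "finite (A1 \<union> A2 \<union> A3)"
    using card_Un_le[of A1 A2] card_Un_le[of "A1 \<union> A2" A3] A1 A2 A3 fin by auto
  obtain A4 where A4: "A4 \<subseteq> nb (flip i v) j i - (A1 \<union> A2 \<union> A3)" "card A4 = 3 * m"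
    using pick[OF heavy(3) c3, of i] by auto
  have "\<exists>a\<in>A1. \<exists>b\<in>A2. \<exists>c\<in>A3. \<exists>d\<in>A4. \<forall>F\<in>high_squares v i j {a, b, c, d}. X F"
  proof (rule filling)
    have "A1 \<union> A2 \<union> A3 \<union> A4 \<subseteq> {..<n} - {i, j}"
      using A1(1) A2(1) A3(1) A4(1) unfolding nb_def by blast
    then show "direction_sets n m i j A1 A2 A3 A4"
      unfolding direction_sets_def using A1 A2 A3 A4 by (intro conjI) auto
  qed
  then obtain a b c d where abcd: "a \<in> A1" "b \<in> A2" "c \<in> A3" "d \<in> A4"
    and high: "\<And>F. F \<in> high_squares v i j {a, b, c, d} \<Longrightarrow> X F"
    by blast
  let ?A = "{a, b, c, d}"
  have "a \<noteq> b"
    using abcd A2 by auto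
  then have "2 \<le> card ?A"
    using card_mono[of ?A "{a, b}"] by simp
  moreover have "?A \<subseteq> {..<n} - {i, j}"
    using abcd A1(1) A2(1) A3(1) A4(1) unfolding nb_def by blast
  moreover have "X (face v {i, a})" "X (face v {j, b})" "X (face (flip j v) {i, c})" "X (face (flip i v) {j, d})"
    using abcd A1(1) A2(1) A3(1) A4(1) unfolding nb_def by blast+
  moreover have "X (face (symdiff v U) {k, l})"
    if "U \<subseteq> ?A \<union> {i, j}" "k \<in> ?A \<union> {i, j}" "l \<in> ?A \<union> {i, j}" "k \<noteq> l" "2 \<le> card ((U \<union> {k, l}) \<inter> ?A)" for U k l
    by (rule high) (use that in \<open>unfold high_squares_def, blast\<close>)
  moreover have "{a, b, c, d} \<subseteq> ?A"
    by simp
  ultimately show ?thesis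
    unfolding square_fillable_def
    by (intro exI[of _ ?A] exI[of _ a] exI[of _ b] exI[of _ c] exI[of _ d] conjI allI impI)
qed

section \<open>Probability of the free fundamental group\<close>

text \<open>The union bound over all pairs of edges in a common 3-cube, and over all squares with all
  quadruples of sets of directions.\<close>

lemma prob_isomorphism_ge:
  fixes p s :: real and n m :: nat
  assumes n: "2 \<le> n" and m: "0 < m" and p: "0 \<le> p" "p \<le> 1" and s: "0 < s" "s \<le> 1"
  shows "1 - 2 ^ n * (n * (n * (n * (8 * (3 * ((1 - p + p * s) ^ (2 * n - 3) / s ^ (24 * m)))))))
      - 2 ^ n * (n * (n * (2 ^ n * (2 ^ n * (2 ^ n * (2 ^ n * (1 - p ^ 2304) ^ (m ^ 2)))))))
    \<le> measure_pmf.prob (random_cubical_complex n p)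
        {Q. \<forall>x \<in> \<Union>Q. fundamental_group (\<Union>Q) x \<cong> free_group {..<card (maximal_edges n Q)}}"
proof -
  let ?M = "coin_flips (cube_faces n 2) p"
  let ?K = "12 * m"
  let ?deg = "cubical_complex.edge_degree n"
  let ?iso = "\<lambda>Q. \<forall>x \<in> \<Union>Q. fundamental_group (\<Union>Q) x \<cong> free_group {..<card (maximal_edges n Q)}"
  let ?Q = "\<lambda>X. cube_skeleton n 1 \<union> {f \<in> cube_faces n 2. X f}"
  define e1 where "e1 = (1 - p + p * s) ^ (2 * n - 3) / s ^ (24 * m)"
  define e2 where "e2 = (1 - p ^ 2304) ^ (m ^ 2)"
  have e_nonneg: "0 \<le> e1" "0 \<le> e2"
    using p s by (simp_all add: e1_def e2_def power_le_one)
  define B1 where "B1 = (\<Union>v\<in>Pow {..<n}. \<Union>i\<in>{..<n}. \<Union>j\<in>{..<n}. \<Union>l\<in>{..<n}. \<Union>U\<in>Pow {i, j, l}. \<Union>x\<in>{i, j, l}.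
    {X. \<not> (x = i \<and> U \<subseteq> {i}) \<and> ?deg X v i \<le> ?K \<and> ?deg X (symdiff v U) x \<le> ?K})"
  define B2 where "B2 = (\<Union>v\<in>Pow {..<n}. \<Union>i\<in>{..<n}. \<Union>j\<in>{..<n}.
    \<Union>A1\<in>Pow {..<n}. \<Union>A2\<in>Pow {..<n}. \<Union>A3\<in>Pow {..<n}. \<Union>A4\<in>Pow {..<n}.
    {X. direction_sets n m i j A1 A2 A3 A4 \<and> (\<forall>a\<in>A1. \<forall>b\<in>A2. \<forall>c\<in>A3. \<forall>d\<in>A4. \<exists>F\<in>high_squares v i j {a, b, c, d}. \<not> X F)})"
  have card_Pow_n: "real (card (Pow {..<n})) \<le> 2 ^ n"
    by (simp add: card_Pow)
  have card3: "card {i, j, l} \<le> 3" for i j l :: nat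
    by (rule card_insert_le_m1 | simp)+
  have card8: "real (card (Pow {i, j, l})) \<le> 8" for i j l :: nat
  proof -
    have "card (Pow {i, j, l}) = 2 ^ card {i, j, l}"
      by (rule card_Pow) simp
    also have "\<dots> \<le> 2 ^ 3"
      by (rule power_increasing[OF card3]) simp
    finally show ?thesis
      by simp
  qed
  have one1: "measure_pmf.prob ?M {X. \<not> (x = i \<and> U \<subseteq> {i}) \<and> ?deg X v i \<le> ?K \<and> ?deg X (symdiff v U) x \<le> ?K} \<le> e1"
    if "v \<in> Pow {..<n}" "i \<in> {..<n}" "j \<in> {..<n}" "l \<in> {..<n}" "U \<in> Pow {i, j, l}" "x \<in> {i, j, l}" for v i j l U x
  proof (cases "x = i \<and> U \<subseteq> {i}")
    case True
    then show ?thesis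
      using e_nonneg by simp
  next
    case False
    have "symdiff v (symdiff v U) = U"
      by (auto simp: symdiff_def)
    then have "measure_pmf.prob ?M {X. ?deg X v i \<le> ?K \<and> ?deg X (symdiff v U) x \<le> ?K}
        \<le> (1 - p + p * s) ^ (2 * n - 3) / s ^ (2 * ?K)"
      using that False by (intro prob_two_light_edges p s symdiff_subset) auto
    then show ?thesis
      using False by (simp add: e1_def)
  qed
  have "measure_pmf.prob ?M B1 \<le> 2 ^ n * (n * (n * (n * (8 * (3 * e1)))))"
    unfolding B1_def
    by (intro prob_UN_le one1 card8 card_Pow_n)
      (use e_nonneg card3 in \<open>auto simp: finite_subset\<close>)
  moreover have one2: "measure_pmf.prob ?M {X. direction_sets n m i j A1 A2 A3 A4 \<and>
      (\<forall>a\<in>A1. \<forall>b\<in>A2. \<forall>c\<in>A3. \<forall>d\<in>A4. \<exists>F\<in>high_squares v i j {a, b, c, d}. \<not> X F)} \<le> e2"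
    if "v \<in> Pow {..<n}" "i \<in> {..<n}" "j \<in> {..<n}" for v i j A1 A2 A3 A4
  proof (cases "direction_sets n m i j A1 A2 A3 A4")
    case True
    then have "measure_pmf.prob ?M
        {X. \<forall>a\<in>A1. \<forall>b\<in>A2. \<forall>c\<in>A3. \<forall>d\<in>A4. \<exists>F\<in>high_squares v i j {a, b, c, d}. \<not> X F} \<le> e2"
      unfolding e2_def using that by (intro prob_no_filling p) auto
    then show ?thesis
      using True by simp
  next
    case False
    then show ?thesis
      using e_nonneg by simp
  qed
  have "measure_pmf.prob ?M B2 \<le> 2 ^ n * (n * (n * (2 ^ n * (2 ^ n * (2 ^ n * (2 ^ n * e2))))))"
    unfolding B2_def
    by (intro prob_UN_le one2 card_Pow_n) (use e_nonneg in auto)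
  ultimately have bad: "measure_pmf.prob ?M (B1 \<union> B2) \<le> 2 ^ n * (n * (n * (n * (8 * (3 * e1))))) +
      2 ^ n * (n * (n * (2 ^ n * (2 ^ n * (2 ^ n * (2 ^ n * e2))))))"
    using measure_Un_le[of B1 ?M B2] by simp
  have good: "?iso (?Q X)" if X: "X \<notin> B1 \<union> B2" for X
  proof -
    interpret cubical_complex n X .
    have Q: "?Q X = Q"
      by (simp add: Q_def)
    have sparse: "x = i \<and> U \<subseteq> {i}"
      if "v \<subseteq> {..<n}" "{i, j, l} \<subseteq> {..<n}" "U \<subseteq> {i, j, l}" "x \<in> {i, j, l}"
        "edge_degree v i \<le> ?K" "edge_degree (symdiff v U) x \<le> ?K" for v i j l U x
    proof (rule ccontr)
      assume "\<not> (x = i \<and> U \<subseteq> {i})"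
      moreover have "v \<in> Pow {..<n}" "i \<in> {..<n}" "j \<in> {..<n}" "l \<in> {..<n}" "U \<in> Pow {i, j, l}"
        using that by auto
      ultimately have "X \<in> B1"
        unfolding B1_def UN_iff using that(4-6) by blast
      then show False
        using X by blast
    qed
    have fill: "square_fillable v i j"
      if v: "v \<subseteq> {..<n}" "i < n" "j < n" "i \<noteq> j" and heavy: "?K < edge_degree v i" "?K < edge_degree v j"
        "?K < edge_degree (flip i v) j" "?K < edge_degree (flip j v) i" for v i j
    proof (rule heavy_square_fillable[OF v(2-4) m heavy])
      fix A1 A2 A3 A4 :: "nat set"
      assume ok: "direction_sets n m i j A1 A2 A3 A4"
      show "\<exists>a\<in>A1. \<exists>b\<in>A2. \<exists>c\<in>A3. \<exists>d\<in>A4. \<forall>F\<in>high_squares v i j {a, b, c, d}. X F"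
      proof (rule ccontr)
        assume "\<not> ?thesis"
        then have "\<forall>a\<in>A1. \<forall>b\<in>A2. \<forall>c\<in>A3. \<forall>d\<in>A4. \<exists>F\<in>high_squares v i j {a, b, c, d}. \<not> X F"
          by simp
        moreover have "v \<in> Pow {..<n}" "i \<in> {..<n}" "j \<in> {..<n}"
          "A1 \<in> Pow {..<n}" "A2 \<in> Pow {..<n}" "A3 \<in> Pow {..<n}" "A4 \<in> Pow {..<n}"
          using v ok unfolding direction_sets_def by auto
        ultimately have "X \<in> B2"
          unfolding B2_def UN_iff using ok by blast
        then show False
          using X by blast
      qed
    qed
    show ?thesis
      unfolding Q
    proof
      fix y assume y: "y \<in> \<Union>Q"
      show "fundamental_group (\<Union>Q) y \<cong> free_group {..<card (maximal_edges n Q)}"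
        by (rule fundamental_group_of_sparse_complex[where K = ?K, OF n _ _ y])
          (rule sparse fill; assumption)+
    qed
  qed
  have "1 - measure_pmf.prob ?M (B1 \<union> B2) = measure_pmf.prob ?M (- (B1 \<union> B2))"
    using measure_pmf.prob_compl[of "B1 \<union> B2" ?M] by (simp add: Compl_eq_Diff_UNIV)
  also have "\<dots> \<le> measure_pmf.prob ?M (?Q -` {Q. ?iso Q})"
    by (rule measure_pmf.finite_measure_mono) (use good in auto)
  also have "\<dots> = measure_pmf.prob (random_cubical_complex n p) {Q. ?iso Q}"
    by (simp only: random_cubical_complex_def measure_map_pmf)
  finally show ?thesis
    using bad unfolding e1_def e2_def by linarith
qed

theorem theorem1p3:
  fixes p :: real
  assumes "1 - sqrt (1 / 2) < p" and "p \<le> 1"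
  shows "(\<lambda>n. measure_pmf.prob (random_cubical_complex n p)
            {Q. \<forall>x \<in> \<Union>Q. fundamental_group (\<Union>Q) x \<cong> free_group {..<card (maximal_edges n Q)}})
         \<longlonglongrightarrow> 1"
proof -
  let ?P = "\<lambda>n. measure_pmf.prob (random_cubical_complex n p)
      {Q. \<forall>x \<in> \<Union>Q. fundamental_group (\<Union>Q) x \<cong> free_group {..<card (maximal_edges n Q)}}"
  have "sqrt (1 / 2) \<le> 1"
    by simp
  then have p: "0 < p" "0 \<le> p" "p \<le> 1"
    using assms by linarith+
  \<comment> \<open>With \<open>s\<close> small the base \<open>r\<close> of the bound for a pair of light edges is so close to \<open>1 - p\<close> that \<open>r\<^sup>2\<close>
    is below one half. Then \<open>m = n div d\<close> with \<open>d\<close> large makes the price for the threshold \<open>12 m\<close> at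
    most \<open>\<gamma>\<^sup>n\<close>, where \<open>\<gamma>\<close> is so close to 1 that \<open>\<beta> = 2 r\<^sup>2 \<gamma>\<close> remains below 1.\<close>
  define s where "s = min 1 ((sqrt (1 / 2) - (1 - p)) / (2 * p))"
  have s: "0 < s" "s \<le> 1"
    using assms p by (auto simp: s_def)
  define r where "r = 1 - p + p * s"
  have r0: "0 < r"
    using p s by (simp add: r_def add_nonneg_pos)
  have "p * s \<le> p * ((sqrt (1 / 2) - (1 - p)) / (2 * p))"
    using p by (intro mult_left_mono) (auto simp: s_def)
  also have "\<dots> = (sqrt (1 / 2) - (1 - p)) / 2"
    using p by simp
  finally have "r < sqrt (1 / 2)"
    using assms(1) by (simp add: r_def)
  then have "r ^ 2 < (sqrt (1 / 2)) ^ 2"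
    using r0 by (intro power_strict_mono) auto
  then have r2: "2 * r ^ 2 < 1"
    by simp
  obtain \<gamma> where \<gamma>: "1 < \<gamma>" "\<gamma> < 1 / (2 * r ^ 2)"
    using dense[of 1 "1 / (2 * r ^ 2)"] r2 r0 by auto
  define \<beta> where "\<beta> = 2 * r ^ 2 * \<gamma>"
  have \<beta>: "0 < \<beta>" "\<beta> < 1"
    using \<gamma> r0 by (auto simp: \<beta>_def field_simps)
  obtain d0 where d0: "1 / s ^ 24 < \<gamma> ^ d0"
    using real_arch_pow[OF \<gamma>(1)] by blast
  define d where "d = Suc d0"
  have "\<gamma> ^ d0 \<le> \<gamma> ^ d"
    unfolding d_def using \<gamma>(1) by (intro power_increasing) auto
  then have d: "0 < d" "1 / s ^ 24 \<le> \<gamma> ^ d"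
    using d0 by (simp add: d_def, linarith)
  define f1 where "f1 n = 24 / r ^ 3 * (real n ^ 3 * \<beta> ^ n)" for n
  define f2 where "f2 n = real n ^ 2 * 32 ^ n * exp (- (p ^ 2304) * (real n / d - 1) ^ 2)" for n
  have "f1 \<longlonglongrightarrow> 0"
  proof -
    define a where "a = - ln \<beta>"
    have a: "0 < a" "\<beta> = exp (- a)"
      using \<beta> by (auto simp: a_def)
    have "(\<lambda>n. 24 / r ^ 3 * (real n ^ 3 * exp (- a * real n))) \<longlonglongrightarrow> 0"
      using a(1) r0 by real_asymp
    moreover have "\<beta> ^ n = exp (- a * real n)" for n
      by (simp add: a(2) exp_of_nat_mult[symmetric] mult.commute)
    ultimately show ?thesis
      unfolding f1_def by simp
  qed
  moreover have "f2 \<longlonglongrightarrow> 0"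
  proof -
    define b where "b = p ^ 2304"
    define D where "D = real d"
    have "0 < b" "0 < D"
      using p d by (auto simp: b_def D_def)
    then have "(\<lambda>n. real n ^ 2 * 32 ^ n * exp (- b * (real n / D - 1) ^ 2)) \<longlonglongrightarrow> 0"
      by real_asymp
    then show ?thesis
      unfolding f2_def b_def D_def .
  qed
  ultimately have lim: "(\<lambda>n. 1 - f1 n - f2 n) \<longlonglongrightarrow> 1 - 0 - 0"
    by (intro tendsto_intros)
  have bound: "1 - f1 n - f2 n \<le> ?P n"
    if n: "max 2 d \<le> n" for n
  proof -
    define m where "m = n div d"
    have m: "0 < m"
      using n d by (simp add: m_def div_greater_zero_iff)
    have "1 / s ^ (24 * m) = (1 / s ^ 24) ^ m"
      by (simp add: power_mult power_one_over)
    also have "\<dots> \<le> (\<gamma> ^ d) ^ m"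
      using d s by (intro power_mono) auto
    also have "\<dots> = \<gamma> ^ (d * m)"
      by (simp add: power_mult)
    also have "\<dots> \<le> \<gamma> ^ n"
      using \<gamma> by (intro power_increasing) (auto simp: m_def)
    finally have s_bound: "1 / s ^ (24 * m) \<le> \<gamma> ^ n" .
    have r_eq: "r ^ (2 * n - 3) = (r ^ 2) ^ n / r ^ 3"
    proof -
      have "r ^ (2 * n - 3) * r ^ 3 = r ^ (2 * n)"
        using n by (simp add: power_add[symmetric])
      then have "r ^ (2 * n - 3) * r ^ 3 = (r ^ 2) ^ n"
        by (simp only: power_mult)
      moreover have "r ^ 3 \<noteq> 0"
        using r0 by simp
      ultimately show ?thesis
        by (simp only: eq_divide_eq simp_thms if_True)
    qed
    have "r ^ (2 * n - 3) / s ^ (24 * m) \<le> (r ^ 2) ^ n / r ^ 3 * \<gamma> ^ n"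
      using mult_left_mono[OF s_bound, of "r ^ (2 * n - 3)"] r0 by (simp add: r_eq)
    then have "2 ^ n * (n * (n * (n * (8 * (3 * (r ^ (2 * n - 3) / s ^ (24 * m)))))))
        \<le> 2 ^ n * (n * (n * (n * (8 * (3 * ((r ^ 2) ^ n / r ^ 3 * \<gamma> ^ n))))))" (is "?L1 \<le> _")
      by (intro mult_left_mono) auto
    also have "\<dots> = f1 n"
      by (simp add: f1_def \<beta>_def power_mult_distrib power3_eq_cube)
    finally have t1: "?L1 \<le> f1 n" .
    have m_ge: "real n / d - 1 \<le> m"
    proof -
      have "n = d * m + n mod d" "n mod d < d"
        using d by (simp_all add: m_def)
      then have "n < d * m + d"
        by linarith
      then have "real n < real d * m + d"
        by (metis of_nat_add of_nat_less_iff of_nat_mult)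
      then show ?thesis
        using d by (simp add: field_simps)
    qed
    have nd: "0 \<le> real n / d - 1"
      using n d by (simp add: field_simps)
    have "(1 - p ^ 2304) ^ (m ^ 2) \<le> exp (- (p ^ 2304)) ^ (m ^ 2)"
    proof (rule power_mono)
      show "1 - p ^ 2304 \<le> exp (- (p ^ 2304))"
        using exp_ge_add_one_self[of "- (p ^ 2304)"] by simp
      show "0 \<le> 1 - p ^ 2304"
        using p by (simp add: power_le_one)
    qed
    also have "\<dots> = exp (- (p ^ 2304) * real m ^ 2)"
      by (simp add: exp_of_nat_mult[symmetric] mult.commute)
    also have "\<dots> \<le> exp (- (p ^ 2304) * (real n / d - 1) ^ 2)"
    proof -
      have "(real n / d - 1) ^ 2 \<le> real m ^ 2"
        using m_ge nd by (rule power_mono)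
      then have "p ^ 2304 * (real n / d - 1) ^ 2 \<le> p ^ 2304 * real m ^ 2"
        using p by (intro mult_left_mono) auto
      then show ?thesis
        by simp
    qed
    finally have "2 ^ n * (n * (n * (2 ^ n * (2 ^ n * (2 ^ n * (2 ^ n * (1 - p ^ 2304) ^ (m ^ 2)))))))
        \<le> 2 ^ n * (n * (n * (2 ^ n * (2 ^ n * (2 ^ n * (2 ^ n * exp (- (p ^ 2304) * (real n / d - 1) ^ 2)))))))" (is "?L2 \<le> _")
      by (intro mult_left_mono) auto
    also have "\<dots> = f2 n"
    proof -
      have "(32::real) ^ n = 2 ^ n * 2 ^ n * 2 ^ n * 2 ^ n * 2 ^ n"
        by (simp flip: power_mult_distrib)
      then show ?thesis
        by (simp only: f2_def power2_eq_square mult_ac)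
    qed
    finally have t2: "?L2 \<le> f2 n" .
    have "2 \<le> n"
      using n by simp
    from prob_isomorphism_ge[OF this m p(2,3) s] t1 t2 show ?thesis
      unfolding r_def by linarith
  qed
  show ?thesis
  proof (rule tendsto_sandwich[where f = "\<lambda>n. 1 - f1 n - f2 n" and h = "\<lambda>_. 1"])
    show "\<forall>\<^sub>F n in sequentially. 1 - f1 n - f2 n \<le> ?P n"
      using bound by (rule eventually_sequentiallyI)
  qed (use lim in auto)
qed

end
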